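(* As $\varepsilon\to0$, the family $(\mathcal L_\varepsilon)$ satisfies the large deviation principle in $\mathcal M^1(\mathcal C([0,1]))$ equipped with the weak topology, in the scale $\varepsilon^{-1}$, with good rate function $$\mathbf\Lambda^*(\mathcal L)=\sup_{F\in\mathcal C_b(\mathcal C([0,1]))}\left\{\int_{\mathcal C([0,1])}F(\xi)\,\mathcal L(d\xi)-\mathbf\Lambda(F)\right\}$$ (the Legendre dual of $\mathbf\Lambda$), where for every $F\in\mathcal C_b(\mathcal C([0,1]))$, $$\mathbf\Lambda(F)=\lim_{T\to\infty}T^{-1}\log\mathbb E\exp\int_0^TF(\xi_t^1)\,dt .$$
   Context: $W=(W(t),t\ge0)$ is a linear Brownian motion with $W(0)=0$. For $\varepsilon>0$ and $t\ge0$, $\xi_t^\varepsilon\in\mathcal C([0,1])$ is the function $s\mapsto\frac{W(t+\varepsilon s)-W(t)}{\sqrt\varepsilon}$ (so $\xi_t^1=(W(t+s)-W(t),s\in[0,1])$), and $\mathcal L_\varepsilon=\int_0^1\delta_{\xi_t^\varepsilon}\,dt$. $\mathcal M^1(\mathcal C([0,1]))$ is the set of Borel probability measures on $\mathcal C([0,1])$ and $\mathcal C_b$ denotes bounded continuous real functions. The LDP in the scale $\varepsilon^{-1}$ with good rate function $I$ means: $I$ has compact level sets, $\limsup_{\varepsilon\to0}\varepsilon\log\mathbb P(\mathcal L_\varepsilon\in C)\le-\inf_CI$ for $C$ closed and $\liminf_{\varepsilon\to0}\varepsilon\log\mathbb P(\mathcal L_\varepsilon\in O)\ge-\inf_OI$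 for $O$ open. *)

theory Defs
  imports "HOL-Probability.Probability"
begin

typedef unit_interval = "{0..1::real}"
  morphisms ui_real ui_of_real
  by (rule exI[of _ 0]) simp

instantiation unit_interval :: metric_space
begin

definition dist_unit_interval :: "unit_interval \<Rightarrow> unit_interval \<Rightarrow> real"
  where "dist_unit_interval x y = dist (ui_real x) (ui_real y)"

definition uniformity_unit_interval :: "(unit_interval \<times> unit_interval) filter"
  where "uniformity_unit_interval = (INF e\<in>{0 <..}. principal {(x, y). dist x y < e})"

definition open_unit_interval :: "unit_interval set \<Rightarrow> bool"
  where "open_unit_interval S = (\<forall>x\<in>S. \<forall>\<^sub>F (x', y) in uniformity. x' = x \<longrightarrow> y \<in> S)"

instance
proof
  fix x y z :: unit_interval
  show "dist x y = 0 \<longleftrightarrow> x = y"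
    by (simp add: dist_unit_interval_def ui_real_inject)
  show "dist x y \<le> dist x z + dist y z"
    unfolding dist_unit_interval_def by (rule dist_triangle2)
qed (rule open_unit_interval_def uniformity_unit_interval_def)+

end

(* Since the unit interval is compact, every continuous function on it is bounded, and
   the library's metric on bounded continuous functions is the sup metric of C([0,1]). *)
type_synonym C01 = "unit_interval \<Rightarrow>\<^sub>C real"

lemma ui_real_bounds: "0 \<le> ui_real s" "ui_real s \<le> 1"
  using ui_real[of s] by auto

lemma continuous_on_ui_real [continuous_intros]: "continuous_on S ui_real"
  by (auto simp: continuous_on_iff dist_unit_interval_def)

lemma continuous_on_ui_of_real: "continuous_on {0..1} ui_of_real"
  by (auto simp: continuous_on_iff dist_unit_interval_def ui_of_real_inverse)

lemma compact_unit_interval: "compact (UNIV :: unit_interval set)"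
proof -
  have "UNIV = ui_of_real ` {0..1}"
    by (metis UNIV_eq_I image_eqI ui_real ui_real_inverse)
  then show ?thesis
    using compact_continuous_image[OF continuous_on_ui_of_real] by auto
qed

lemma bcontfun_unit_interval:
  fixes f :: "unit_interval \<Rightarrow> real"
  shows "f \<in> bcontfun \<longleftrightarrow> continuous_on UNIV f"
  using compact_continuous_image[OF _ compact_unit_interval, of f]
  by (auto simp: bcontfun_def compact_imp_bounded)

text \<open>Only the values W t with t \<open>\<ge>\<close> 0 are constrained.\<close>

definition brownian_motion :: "'a measure \<Rightarrow> (real \<Rightarrow> 'a \<Rightarrow> real) \<Rightarrow> bool" where
  "brownian_motion M W \<longleftrightarrow>
     prob_space M \<and>
     (\<forall>t\<ge>0. W t \<in> borel_measurable M) \<and>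
     (\<forall>\<omega>\<in>space M. W 0 \<omega> = 0) \<and>
     (\<forall>(n::nat) (t::nat \<Rightarrow> real). 0 \<le> t 0 \<and> (\<forall>i<n. t i < t (Suc i)) \<longrightarrow>
        prob_space.indep_vars M (\<lambda>_. borel) (\<lambda>i \<omega>. W (t (Suc i)) \<omega> - W (t i) \<omega>) {..<n}) \<and>
     (\<forall>s t. 0 \<le> s \<and> s < t \<longrightarrow>
        distributed M lborel (\<lambda>\<omega>. W t \<omega> - W s \<omega>) (normal_density 0 (sqrt (t - s)))) \<and>
     (\<forall>\<omega>\<in>space M. continuous_on {0..} (\<lambda>t. W t \<omega>))"

definition xi :: "(real \<Rightarrow> 'a \<Rightarrow> real) \<Rightarrow> real \<Rightarrow> real \<Rightarrow> 'a \<Rightarrow> C01" where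
  "xi W \<epsilon> t \<omega> = Bcontfun (\<lambda>s. (W (t + \<epsilon> * ui_real s) \<omega> - W t \<omega>) / sqrt \<epsilon>)"

(* The integral of the Dirac masses at xi over t in [0,1], as a mixture of measures. *)
definition occupation_measure :: "(real \<Rightarrow> 'a \<Rightarrow> real) \<Rightarrow> real \<Rightarrow> 'a \<Rightarrow> C01 measure" where
  "occupation_measure W \<epsilon> \<omega> = restrict_space lborel {0..1} \<bind> (\<lambda>t. return borel (xi W \<epsilon> t \<omega>))"

lemma apply_xi:
  assumes "brownian_motion M W" "\<omega> \<in> space M" "\<epsilon> > 0" "t \<ge> 0"
  shows "apply_bcontfun (xi W \<epsilon> t \<omega>) s = (W (t + \<epsilon> * ui_real s) \<omega> - W t \<omega>) / sqrt \<epsilon>"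
proof -
  have W: "continuous_on {0..} (\<lambda>t. W t \<omega>)"
    using assms by (auto simp: brownian_motion_def)
  have "continuous_on UNIV (\<lambda>s. (W (t + \<epsilon> * ui_real s) \<omega> - W t \<omega>) / sqrt \<epsilon>)"
    using assms by (intro continuous_intros continuous_on_compose2[OF W]) (auto simp: ui_real_bounds)
  then show ?thesis
    by (simp add: xi_def Bcontfun_inverse bcontfun_unit_interval)
qed

lemma continuous_on_xi:
  assumes bm: "brownian_motion M W" "\<omega> \<in> space M" "\<epsilon> > 0"
  shows "continuous_on {0..1} (\<lambda>t. xi W \<epsilon> t \<omega>)"
proof -
  have W: "continuous_on {0..} (\<lambda>t. W t \<omega>)"
    using assms by (auto simp: brownian_motion_def)
  have "uniformly_continuous_on {0..1+\<epsilon>} (\<lambda>t. W t \<omega>)"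
    by (intro compact_uniformly_continuous continuous_on_subset[OF W]) auto
  note uc = this[unfolded uniformly_continuous_on_def, rule_format]
  show ?thesis
    unfolding continuous_on_iff
  proof (intro ballI allI impI)
    fix t e :: real
    assume t: "t \<in> {0..1}" and e: "0 < e"
    have e': "e * sqrt \<epsilon> / 4 > 0"
      using e bm by simp
    obtain d where d: "d > 0" and
      D: "\<And>x y. x \<in> {0..1+\<epsilon>} \<Longrightarrow> y \<in> {0..1+\<epsilon>} \<Longrightarrow> dist y x < d \<Longrightarrow>
            dist (W y \<omega>) (W x \<omega>) < e * sqrt \<epsilon> / 4"
      using uc[OF e'] by blast
    show "\<exists>d>0. \<forall>t'\<in>{0..1}. dist t' t < d \<longrightarrow> dist (xi W \<epsilon> t' \<omega>) (xi W \<epsilon> t \<omega>) < e"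
    proof (intro exI conjI ballI impI)
      fix t' :: real
      assume t': "t' \<in> {0..1}" "dist t' t < d"
      have "dist (xi W \<epsilon> t' \<omega>) (xi W \<epsilon> t \<omega>) \<le> e / 2"
      proof (rule dist_bound)
        fix s
        define h where "h = \<epsilon> * ui_real s"
        have h: "0 \<le> h" "h \<le> \<epsilon>"
          using ui_real_bounds[of s] bm(3) by (auto simp: h_def mult_left_le)
        have 1: "dist (W (t' + h) \<omega>) (W (t + h) \<omega>) < e * sqrt \<epsilon> / 4"
          using t t' h by (intro D) (auto simp: dist_real_def)
        have 2: "dist (W t' \<omega>) (W t \<omega>) < e * sqrt \<epsilon> / 4"
          using t t' bm(3) by (intro D) (auto simp: dist_real_def)
        have "\<bar>(W (t' + h) \<omega> - W t' \<omega>) - (W (t + h) \<omega> - W t \<omega>)\<bar> \<le> e / 2 * sqrt \<epsilon>"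
          using 1 2 unfolding dist_real_def by linarith
        then have "\<bar>((W (t' + h) \<omega> - W t' \<omega>) - (W (t + h) \<omega> - W t \<omega>)) / sqrt \<epsilon>\<bar> \<le> e / 2"
          using bm(3) by (simp add: abs_divide pos_divide_le_eq)
        then show "dist (apply_bcontfun (xi W \<epsilon> t' \<omega>) s) (apply_bcontfun (xi W \<epsilon> t \<omega>) s) \<le> e / 2"
          using t t' bm by (simp add: apply_xi dist_real_def h_def diff_divide_distrib)
      qed
      then show "dist (xi W \<epsilon> t' \<omega>) (xi W \<epsilon> t \<omega>) < e"
        using e by simp
    qed (rule d)
  qed
qed

lemma emeasure_occupation_measure:
  assumes bm: "brownian_motion M W" "\<omega> \<in> space M" "\<epsilon> > 0" and A: "A \<in> sets borel"
  shows "emeasure (occupation_measure W \<epsilon> \<omega>) A = emeasure lborel {t\<in>{0..1}. xi W \<epsilon> t \<omega> \<in> A}"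
proof -
  have eq: "sets (restrict_space lborel {0..1::real}) = sets (restrict_space borel {0..1})"
    by (simp add: sets_restrict_space)
  have meas: "(\<lambda>t. xi W \<epsilon> t \<omega>) \<in> restrict_space lborel {0..1} \<rightarrow>\<^sub>M borel"
    using borel_measurable_continuous_on_restrict[OF continuous_on_xi[OF bm]]
    by (simp add: measurable_cong_sets[OF eq refl])
  have "occupation_measure W \<epsilon> \<omega> = distr (restrict_space lborel {0..1}) borel (\<lambda>t. xi W \<epsilon> t \<omega>)"
    unfolding occupation_measure_def using meas
    by (intro bind_return_distr') (auto simp: space_restrict_space)
  moreover have "(\<lambda>t. xi W \<epsilon> t \<omega>) -` A \<inter> space (restrict_space lborel {0..1}) = {t\<in>{0..1}. xi W \<epsilon> t \<omega> \<in> A}"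
    by (auto simp: space_restrict_space)
  ultimately have "emeasure (occupation_measure W \<epsilon> \<omega>) A =
      emeasure (restrict_space lborel {0..1}) {t\<in>{0..1}. xi W \<epsilon> t \<omega> \<in> A}"
    using meas A by (simp only: emeasure_distr)
  then show ?thesis
    by (subst (asm) emeasure_restrict_space) auto
qed

definition borel_prob_measures :: "C01 measure set" where
  "borel_prob_measures = {\<mu>. sets \<mu> = sets borel \<and> prob_space \<mu>}"

(* The coarsest topology on the Borel probability measures making integration against every
   bounded continuous function continuous. *)
definition weak_topology :: "C01 measure topology" where
  "weak_topology = topology_generated_by
     {{\<mu> \<in> borel_prob_measures. (LINT \<xi>|\<mu>. apply_bcontfun F \<xi>) \<in> U} |
       (F :: C01 \<Rightarrow>\<^sub>C real) (U :: real set). open U}"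

lemma topspace_weak_topology: "topspace weak_topology = borel_prob_measures"
proof -
  have "borel_prob_measures \<in> {{\<mu> \<in> borel_prob_measures. (LINT \<xi>|\<mu>. apply_bcontfun F \<xi>) \<in> U} |
       (F :: C01 \<Rightarrow>\<^sub>C real) (U :: real set). open U}"
    by (rule CollectI, rule exI[of _ 0], rule exI[of _ UNIV]) auto
  then show ?thesis
    unfolding weak_topology_def topology_generated_by_topspace by blast
qed

(* Logarithm on [0, infinity) with log 0 = -infinity; the library has ln 0 = 0. *)
definition elog :: "real \<Rightarrow> ereal" where
  "elog p = (if p = 0 then -\<infinity> else ereal (ln p))"

text \<open>The large deviation principle in the scale \<open>1/\<epsilon>\<close>, as \<open>\<epsilon> \<rightarrow> 0\<close> through positive values,
  with good rate function \<open>I\<close>.\<close>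

definition good_ldp ::
  "'a measure \<Rightarrow> (real \<Rightarrow> 'a \<Rightarrow> 'b) \<Rightarrow> 'b topology \<Rightarrow> ('b \<Rightarrow> ereal) \<Rightarrow> bool" where
  "good_ldp M X T I \<longleftrightarrow>
     (\<forall>a::real. compactin T {x \<in> topspace T. I x \<le> ereal a}) \<and>
     (\<forall>C. closedin T C \<longrightarrow>
        Limsup (at_right 0) (\<lambda>\<epsilon>. ereal \<epsilon> * elog (measure M {\<omega> \<in> space M. X \<epsilon> \<omega> \<in> C}))
          \<le> - (INF x\<in>C. I x)) \<and>
     (\<forall>U. openin T U \<longrightarrow>
        Liminf (at_right 0) (\<lambda>\<epsilon>. ereal \<epsilon> * elog (measure M {\<omega> \<in> space M. X \<epsilon> \<omega> \<in> U}))
          \<ge> - (INF x\<in>U. I x))"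

definition log_mgf :: "'a measure \<Rightarrow> (real \<Rightarrow> 'a \<Rightarrow> real) \<Rightarrow> (C01 \<Rightarrow>\<^sub>C real) \<Rightarrow> real \<Rightarrow> real" where
  "log_mgf M W F T =
     ln (LINT \<omega>|M. exp (LINT t:{0..T}|lborel. apply_bcontfun F (xi W 1 t \<omega>))) / T"

definition Lam :: "'a measure \<Rightarrow> (real \<Rightarrow> 'a \<Rightarrow> real) \<Rightarrow> (C01 \<Rightarrow>\<^sub>C real) \<Rightarrow> real" where
  "Lam M W F = Lim at_top (log_mgf M W F)"

definition Lam_dual :: "'a measure \<Rightarrow> (real \<Rightarrow> 'a \<Rightarrow> real) \<Rightarrow> C01 measure \<Rightarrow> ereal" where
  "Lam_dual M W \<mu> =
     (SUP F :: C01 \<Rightarrow>\<^sub>C real. ereal ((LINT \<xi>|\<mu>. apply_bcontfun F \<xi>) - Lam M W F))"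

end

theory Submission
  imports Defs
begin

text \<open>After Brownian scaling, \<open>1/\<epsilon>\<close> plays the role of a time \<open>T\<close> and the windows \<open>\<xi>\<^sub>t\<close> form a
  stationary process in which windows over disjoint time intervals are independent. Cutting
  \<open>[0,T]\<close> into blocks of length \<open>S\<close> and discarding the windows that straddle two blocks therefore
  makes the logarithmic moment generating functional additive up to an error of relative size
  \<open>norm F / S\<close>; this gives the existence of \<open>\<Lambda>\<close> with a rate.

  For compactness, \<open>\<M>\<^sup>1\<close> is embedded in the compact space of positive normalized linear functionals
  on bounded continuous functions. Convexity of \<open>exp\<close> gives \<open>\<Lambda>(F) \<le> log \<integral> exp F d(Wiener)\<close>, so a
  functional \<open>l\<close> with \<open>l \<le> \<Lambda> + a\<close> is continuous along decreasing sequences and hence, by Daniell's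
  theorem, is a measure. Thus the rate function has compact level sets, and it is infinite at
  all functionals that are not measures, so that the upper bound follows from Chernoff's
  inequality and a finite cover, without exponential tightness.

  For the lower bound only finitely many functions \<open>F\<close> matter. For a block length \<open>S\<close> one minimizes the
  logarithmic moment generating function of a block minus the linear functional given by the target,
  plus a small quadratic penalty. At an almost minimizer the exponentially tilted block has nearly the
  right mean, and a second moment estimate for independent tilted blocks yields the bound.\<close>

section \<open>Windows of a path\<close>

text \<open>All block computations take place under one measure, \<open>wiener\<close>: the windows
  inside a block depend continuously on the rescaled block, whose law is the same for every length
  and position. So measurability follows from continuity, and \<epsilon> disappears once time is
  measured in units of \<epsilon>. Unit windows starting in [0,T] occupy a path of length T + 1,
  whence the shift in \<open>Z (T + 1)\<close>.

  Two obstacles shape the rest. A functional bounded by \<Lambda> + a could a priori be only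
  finitely additive; applying the bound to a large multiple c of a decreasing sequence leaves an
  error a / c, which forces continuity. In the lower bound the target may lie on the boundary of the
  attainable means, where no tilt has exactly the required mean. The quadratic penalty keeps the
  tilting parameter bounded, at the price of displacing the mean by \<eta> times the parameter. It
  also absorbs the error of relative size norm / S in the rate of convergence to \<Lambda>, although
  the tilt is chosen only after S.\<close>

definition pt :: "real \<Rightarrow> unit_interval" where
  "pt x = ui_of_real (max 0 (min 1 x))"

lemma ui_real_pt: "ui_real (pt x) = max 0 (min 1 x)"
  by (simp add: pt_def ui_of_real_inverse)

lemma pt_ui_real [simp]: "pt (ui_real s) = s"
  using ui_real_bounds[of s] by (simp add: pt_def min_absorb2 max_absorb2 ui_real_inverse)

lemma dist_pt: "dist (pt x) (pt y) \<le> \<bar>x - y\<bar>"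
  by (auto simp: dist_unit_interval_def ui_real_pt dist_real_def)

text \<open>Clamping is 1-Lipschitz and total, so a path on [0,1] extends continuously to the whole
  line and windows need no side conditions on the starting time.\<close>

lemma continuous_on_apply_pt [continuous_intros]:
  fixes \<beta> :: C01
  assumes "continuous_on S f"
  shows "continuous_on S (\<lambda>x. apply_bcontfun \<beta> (pt (f x)))"
proof -
  have "continuous_on UNIV pt"
    unfolding continuous_on_iff using dist_pt by (metis dist_real_def order_le_less_trans)
  from continuous_on_compose2[OF this assms] have "continuous_on S (\<lambda>x. pt (f x))" by simp
  from continuous_on_compose2[OF continuous_on_apply_bcontfun this, of UNIV] show ?thesis by simp
qed

lemma C01_uniform:
  fixes \<beta> :: C01
  assumes "e > 0"
  obtains d where "d > 0" "\<And>x y. \<bar>x - y\<bar> < d \<Longrightarrow> \<bar>apply_bcontfun \<beta> (pt x) - apply_bcontfun \<beta> (pt y)\<bar> < e"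
proof -
  have "uniformly_continuous_on UNIV (apply_bcontfun \<beta>)"
    by (intro compact_uniformly_continuous compact_unit_interval) auto
  then obtain d where "d > 0" "\<And>x y. dist x y < d \<Longrightarrow> dist (apply_bcontfun \<beta> x) (apply_bcontfun \<beta> y) < e"
    unfolding uniformly_continuous_on_def using assms by (metis UNIV_I dist_commute)
  then show ?thesis
    using order_le_less_trans[OF dist_pt] by (intro that[of d]) (auto simp: dist_real_def)
qed

text \<open>By Brownian scaling, the windows of length \<open>r\<close> inside a path over \<open>[0,1]\<close> play the role of
  the windows of length 1 inside a path over \<open>[0,1/r]\<close>. As \<open>pt\<close> clamps its argument, only
  \<open>0 \<le> \<tau> \<le> 1 - r\<close> is meaningful.\<close>

definition window :: "real \<Rightarrow> real \<Rightarrow> C01 \<Rightarrow> C01" where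
  "window r \<tau> \<beta> = Bcontfun (\<lambda>s. (apply_bcontfun \<beta> (pt (\<tau> + r * ui_real s)) - apply_bcontfun \<beta> (pt \<tau>)) / sqrt r)"

lemma apply_window:
  "apply_bcontfun (window r \<tau> \<beta>) s = (apply_bcontfun \<beta> (pt (\<tau> + r * ui_real s)) - apply_bcontfun \<beta> (pt \<tau>)) / sqrt r"
proof -
  have "continuous_on UNIV (\<lambda>s. (apply_bcontfun \<beta> (pt (\<tau> + r * ui_real s)) - apply_bcontfun \<beta> (pt \<tau>)) / sqrt r)"
    unfolding divide_inverse by (intro continuous_intros)
  then show ?thesis
    by (simp add: window_def Bcontfun_inverse bcontfun_unit_interval)
qed

text \<open>Both sides look at W at time a + h * (\<tau> + r * s), and the factors sqrt h and sqrt r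
  multiply. The condition \<tau> \<le> 1 - r keeps \<tau> + r * s in [0,1], where \<open>pt\<close>
  does not clamp.\<close>

lemma xi_window:
  assumes bm: "brownian_motion M W" "\<omega> \<in> space M" and h: "h > 0" and a: "a \<ge> 0"
    and r: "0 < r" "r \<le> 1" and \<tau>: "0 \<le> \<tau>" "\<tau> \<le> 1 - r"
  shows "xi W (r * h) (a + h * \<tau>) \<omega> = window r \<tau> (xi W h a \<omega>)"
proof (rule bcontfun_eqI)
  fix s
  have s: "0 \<le> r * ui_real s" "r * ui_real s \<le> r"
    using ui_real_bounds[of s] r by (auto simp: mult_left_le)
  have *: "ui_real (pt (\<tau> + r * ui_real s)) = \<tau> + r * ui_real s" "ui_real (pt \<tau>) = \<tau>"
    using s \<tau> r by (simp_all add: ui_real_pt max_absorb2 min_absorb2 add_mono[OF \<tau>(2) s(2), simplified])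
  have "0 \<le> a + h * \<tau>" using assms by simp
  moreover have "r * h > 0" using assms by simp
  ultimately show "apply_bcontfun (xi W (r * h) (a + h * \<tau>) \<omega>) s = apply_bcontfun (window r \<tau> (xi W h a \<omega>)) s"
    by (simp add: apply_window apply_xi[OF bm] h a * real_sqrt_mult algebra_simps flip: diff_divide_distrib)
qed

lemma dist_window_le:
  assumes "r > 0"
  shows "dist (window r \<tau> \<beta>) (window r \<tau> \<gamma>) \<le> 2 / sqrt r * dist \<beta> \<gamma>"
proof (rule dist_bound)
  fix s
  let ?x = "pt (\<tau> + r * ui_real s)" and ?y = "pt \<tau>"
  have "\<bar>(apply_bcontfun \<beta> ?x - apply_bcontfun \<beta> ?y) - (apply_bcontfun \<gamma> ?x - apply_bcontfun \<gamma> ?y)\<bar> \<le> 2 * dist \<beta> \<gamma>"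
    using dist_bounded[of \<beta> ?x \<gamma>] dist_bounded[of \<beta> ?y \<gamma>] unfolding dist_real_def by linarith
  then have "\<bar>((apply_bcontfun \<beta> ?x - apply_bcontfun \<beta> ?y) - (apply_bcontfun \<gamma> ?x - apply_bcontfun \<gamma> ?y)) / sqrt r\<bar> \<le> 2 * dist \<beta> \<gamma> / sqrt r"
    using assms by (simp add: abs_divide divide_right_mono)
  then show "dist (apply_bcontfun (window r \<tau> \<beta>) s) (apply_bcontfun (window r \<tau> \<gamma>) s) \<le> 2 / sqrt r * dist \<beta> \<gamma>"
    by (simp add: apply_window dist_real_def diff_divide_distrib)
qed

lemma continuous_on_window_path: "r > 0 \<Longrightarrow> continuous_on UNIV (window r \<tau>)"
  by (rule lipschitz_on_continuous_on[of "2 / sqrt r"])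
    (use dist_window_le in \<open>auto simp: lipschitz_on_def\<close>)

lemma continuous_on_window_time:
  assumes r: "r > 0"
  shows "continuous_on UNIV (\<lambda>\<tau>. window r \<tau> \<beta>)"
  unfolding continuous_on_iff
proof (intro ballI allI impI)
  fix \<tau> e :: real assume e: "e > 0"
  have "e * sqrt r / 4 > 0" using e r by simp
  from C01_uniform[OF this, of \<beta>] obtain d where d: "d > 0"
    and D: "\<And>x y. \<bar>x - y\<bar> < d \<Longrightarrow> \<bar>apply_bcontfun \<beta> (pt x) - apply_bcontfun \<beta> (pt y)\<bar> < e * sqrt r / 4" by blast
  show "\<exists>d>0. \<forall>\<tau>'\<in>UNIV. dist \<tau>' \<tau> < d \<longrightarrow> dist (window r \<tau>' \<beta>) (window r \<tau> \<beta>) < e"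
  proof (intro exI conjI ballI impI)
    fix \<tau>' assume t: "dist \<tau>' \<tau> < d"
    have "dist (window r \<tau>' \<beta>) (window r \<tau> \<beta>) \<le> e / 2"
    proof (rule dist_bound)
      fix s
      have "\<bar>apply_bcontfun \<beta> (pt (\<tau>' + r * ui_real s)) - apply_bcontfun \<beta> (pt (\<tau> + r * ui_real s))\<bar> < e * sqrt r / 4"
        "\<bar>apply_bcontfun \<beta> (pt \<tau>') - apply_bcontfun \<beta> (pt \<tau>)\<bar> < e * sqrt r / 4"
        by (rule D, use t in \<open>simp add: dist_real_def\<close>)+
      then have "\<bar>(apply_bcontfun \<beta> (pt (\<tau>' + r * ui_real s)) - apply_bcontfun \<beta> (pt \<tau>')) -
        (apply_bcontfun \<beta> (pt (\<tau> + r * ui_real s)) - apply_bcontfun \<beta> (pt \<tau>))\<bar> \<le> e / 2 * sqrt r"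
        by linarith
      then show "dist (apply_bcontfun (window r \<tau>' \<beta>) s) (apply_bcontfun (window r \<tau> \<beta>) s) \<le> e / 2"
        using r by (simp add: apply_window dist_real_def pos_divide_le_eq abs_divide flip: diff_divide_distrib)
    qed
    then show "dist (window r \<tau>' \<beta>) (window r \<tau> \<beta>) < e" using e by simp
  qed (rule d)
qed

lemma continuous_on_apply_bcontfun_compose [continuous_intros]:
  fixes F :: "'a::topological_space \<Rightarrow>\<^sub>C 'b::metric_space"
  shows "continuous_on S f \<Longrightarrow> continuous_on S (\<lambda>x. apply_bcontfun F (f x))"
  using continuous_on_compose2[OF continuous_on_apply_bcontfun[of UNIV F], of S f] by simp

lemma abs_apply_le:
  fixes F :: "'a::topological_space \<Rightarrow>\<^sub>C real"
  shows "\<bar>apply_bcontfun F x\<bar> \<le> norm F"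
  using norm_bounded[of F x] by simp

text \<open>The starting points stop at 1 - r, where the window reaches the end of the path, and the
  integral is not divided by 1 - r. With r = 1 / S, multiplication by S therefore gives exactly the
  integral over starting points in [0, S - 1] of a path of length S.\<close>

definition window_mean :: "real \<Rightarrow> (C01 \<Rightarrow>\<^sub>C real) \<Rightarrow> C01 \<Rightarrow> real" where
  "window_mean r F \<beta> = (LINT \<tau>:{0..1-r}|lborel. apply_bcontfun F (window r \<tau> \<beta>))"

lemma set_integrable_window:
  fixes F :: "C01 \<Rightarrow>\<^sub>C real"
  assumes "r > 0"
  shows "set_integrable lborel {a..b} (\<lambda>\<tau>. apply_bcontfun F (window r \<tau> \<beta>))"
  by (intro borel_integrable_atLeastAtMost' continuous_on_apply_bcontfun_compose
        continuous_on_subset[OF continuous_on_window_time[OF assms]]) auto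

lemma abs_set_integral_le:
  fixes f :: "real \<Rightarrow> real"
  assumes "a \<le> b" "set_integrable lborel {a..b} f" "\<And>x. x \<in> {a..b} \<Longrightarrow> \<bar>f x\<bar> \<le> K"
  shows "\<bar>LINT x:{a..b}|lborel. f x\<bar> \<le> K * (b - a)"
proof -
  have "\<bar>LINT x:{a..b}|lborel. f x\<bar> \<le> (LINT x:{a..b}|lborel. \<bar>f x\<bar>)"
    using set_integral_norm_bound[OF assms(2)] by simp
  also have "\<dots> \<le> (LINT x:{a..b}|lborel. K)"
    by (intro set_integral_mono set_integrable_abs assms) (auto simp: set_integrable_def assms)
  also have "\<dots> = K * (b - a)" using assms(1) by (simp add: set_lebesgue_integral_def)
  finally show ?thesis .
qed

lemma abs_window_mean_le:
  assumes "0 < r" "r \<le> 1"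
  shows "\<bar>window_mean r F \<beta>\<bar> \<le> norm F"
proof -
  have "\<bar>window_mean r F \<beta>\<bar> \<le> norm F * (1 - r - 0)"
    unfolding window_mean_def
    by (intro abs_set_integral_le set_integrable_window abs_apply_le) (use assms in auto)
  also have "\<dots> \<le> norm F" using assms by (simp add: mult_left_le)
  finally show ?thesis .
qed

text \<open>Dominated convergence in the path variable. This continuity lets exponential functionals
  of a block be inserted into \<open>expectation_prod_xi\<close>, and makes them measurable.\<close>

lemma continuous_on_window_mean:
  assumes "0 < r"
  shows "continuous_on S (window_mean r F)"
proof (rule continuous_on_sequentiallyI)
  fix u :: "nat \<Rightarrow> C01" and \<beta> assume u: "u \<longlonglongrightarrow> \<beta>"
  show "(\<lambda>n. window_mean r F (u n)) \<longlonglongrightarrow> window_mean r F \<beta>"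
    unfolding window_mean_def set_lebesgue_integral_def
  proof (rule integral_dominated_convergence[where w = "\<lambda>x. indicator {0..1-r} x * norm F"])
    show "(\<lambda>x. indicator {0..1 - r} x *\<^sub>R apply_bcontfun F (window r x \<beta>)) \<in> borel_measurable lborel"
      "(\<lambda>x. indicator {0..1 - r} x *\<^sub>R apply_bcontfun F (window r x (u i))) \<in> borel_measurable lborel" for i
      using set_integrable_window[OF assms] unfolding set_integrable_def by auto
    show "integrable lborel (\<lambda>x. indicator {0..1 - r} x * norm F)"
      by (intro integrable_mult_left integrable_real_indicator) (auto simp: emeasure_lborel_Icc_eq)
    show "AE x in lborel. (\<lambda>i. indicator {0..1 - r} x *\<^sub>R apply_bcontfun F (window r x (u i)))
          \<longlonglongrightarrow> indicator {0..1 - r} x *\<^sub>R apply_bcontfun F (window r x \<beta>)"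
      by (intro AE_I2 tendsto_intros continuous_on_tendsto_compose[OF _ u, of UNIV]
          continuous_on_apply_bcontfun_compose continuous_on_window_path assms) auto
    show "AE x in lborel. norm (indicator {0..1 - r} x *\<^sub>R apply_bcontfun F (window r x (u i)))
          \<le> indicator {0..1 - r} x * norm F" for i
      by (auto simp: indicator_def abs_apply_le)
  qed
qed

lemma window_mean_sum:
  assumes "0 < r"
  shows "window_mean r (\<Sum>F\<in>\<F>. c F *\<^sub>R F) \<beta> = (\<Sum>F\<in>\<F>. c F * window_mean r F \<beta>)"
proof (induction \<F> rule: infinite_finite_induct)
  case (insert G \<F>)
  have "window_mean r (c G *\<^sub>R G + H) \<beta> = c G * window_mean r G \<beta> + window_mean r H \<beta>" for H
    using set_integrable_window[OF assms]
    by (simp add: window_mean_def set_integral_add)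
  then show ?case using insert by simp
qed (simp_all add: window_mean_def set_lebesgue_integral_def)

lemma set_integral_affine:
  fixes f :: "real \<Rightarrow> real"
  assumes "h > 0"
  shows "(LINT t:{a..a + h * c}|lborel. f t) = h * (LINT \<tau>:{0..c}|lborel. f (a + h * \<tau>))"
proof -
  have "indicator {a..a + h * c} (a + h * \<tau>) = (indicator {0..c} \<tau> :: real)" for \<tau>
    using assms by (auto simp: indicator_def zero_le_mult_iff)
  then show ?thesis
    unfolding set_lebesgue_integral_def
    using assms by (subst lborel_integral_real_affine[of h _ a]) auto
qed

lemma integral_xi_window:
  assumes bm: "brownian_motion M W" "\<omega> \<in> space M" and h: "h > 0" and a: "a \<ge> 0"
    and r: "0 < r" "r \<le> 1"
  shows "(LINT t:{a..a + h * (1 - r)}|lborel. apply_bcontfun F (xi W (r * h) t \<omega>)) = h * window_mean r F (xi W h a \<omega>)"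
  unfolding set_integral_affine[OF h] window_mean_def
  by (intro arg_cong[where f = "(*) h"] set_lebesgue_integral_cong)
    (auto simp: xi_window[OF bm h a r])

section \<open>Independence and stationarity of the windows\<close>

definition ramp :: "nat \<Rightarrow> nat \<Rightarrow> C01" where
  "ramp N i = Bcontfun (\<lambda>s. max 0 (min 1 (real N * ui_real s - real i)))"

lemma apply_ramp: "apply_bcontfun (ramp N i) s = max 0 (min 1 (real N * ui_real s - real i))"
proof -
  have "continuous_on UNIV (\<lambda>s. max 0 (min 1 (real N * ui_real s - real i)))"
    by (intro continuous_intros)
  then show ?thesis by (simp add: ramp_def Bcontfun_inverse bcontfun_unit_interval)
qed

text \<open>The ramp with index i rises from 0 to 1 over the cell [i/N, (i+1)/N]. With the
  increments as coefficients the sum is the polygonal path through the grid values, so a window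
  becomes a limit of functions of finitely many increments, whose joint law is known.\<close>

definition interp :: "nat \<Rightarrow> (nat \<Rightarrow> real) \<Rightarrow> C01" where
  "interp N z = (\<Sum>i<N. z i *\<^sub>R ramp N i)"

lemma apply_bcontfun_sum:
  fixes f :: "'b \<Rightarrow> 'a::topological_space \<Rightarrow>\<^sub>C 'c::real_normed_vector"
  shows "apply_bcontfun (\<Sum>i\<in>A. f i) x = (\<Sum>i\<in>A. apply_bcontfun (f i) x)"
  by (induction A rule: infinite_finite_induct) auto

lemma apply_interp:
  "apply_bcontfun (interp N z) s = (\<Sum>i<N. z i * max 0 (min 1 (real N * ui_real s - real i)))"
  by (simp add: interp_def apply_bcontfun_sum apply_ramp)

lemma interp_cong: "(\<And>i. i < N \<Longrightarrow> z i = z' i) \<Longrightarrow> interp N z = interp N z'"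
  by (simp add: interp_def)

lemma measurable_interp [measurable]:
  "interp N \<in> borel_measurable (PiM {..<N} (\<lambda>_. borel))"
proof -
  have "(\<lambda>z i. if i < N then z i else 0) \<in> borel_measurable (PiM {..<N} (\<lambda>_. borel :: real measure))"
  proof (rule measurable_coordinatewise_then_product)
    fix i show "(\<lambda>z. if i < N then z i else 0) \<in> borel_measurable (PiM {..<N} (\<lambda>_. borel :: real measure))"
      by (cases "i < N") auto
  qed
  moreover have "interp N \<in> borel_measurable borel"
    unfolding interp_def
    by (intro borel_measurable_continuous_onI continuous_intros continuous_on_product_coordinates)
  ultimately have "(\<lambda>z. interp N (\<lambda>i. if i < N then z i else 0)) \<in> borel_measurable (PiM {..<N} (\<lambda>_. borel))"
    by (rule measurable_compose)
  then show ?thesis by (simp cong: interp_cong)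
qed

text \<open>In the cell of x the polygon differs from its value at the left grid point by at most
  one increment, and this value is within e of the path at x.\<close>

lemma interp_close:
  fixes \<beta> :: C01
  assumes N: "N > 0" and \<beta>0: "apply_bcontfun \<beta> (pt 0) = 0"
    and z: "\<And>i. i < N \<Longrightarrow> z i = apply_bcontfun \<beta> (pt (real (Suc i) / real N)) - apply_bcontfun \<beta> (pt (real i / real N))"
    and e: "\<And>x y. \<bar>x - y\<bar> \<le> 1 / real N \<Longrightarrow> \<bar>apply_bcontfun \<beta> (pt x) - apply_bcontfun \<beta> (pt y)\<bar> \<le> e"
  shows "dist (interp N z) \<beta> \<le> 2 * e"
proof (rule dist_bound)
  fix s
  define x where "x = ui_real s"
  have x: "0 \<le> x" "x \<le> 1" by (simp_all add: x_def ui_real_bounds)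
  define b where "b = (\<lambda>y. apply_bcontfun \<beta> (pt y))"
  have tel: "(\<Sum>i<j. z i) = b (real j / real N)" if "j \<le> N" for j
    using that by (induction j) (auto simp: z b_def \<beta>0)
  define j where "j = nat \<lfloor>real N * x\<rfloor>"
  have j: "real j \<le> real N * x" "real N * x < real j + 1"
    using x N by (auto simp: j_def of_nat_nat)
  have jN: "j \<le> N"
  proof -
    have "real N * x \<le> real N" using x by (simp add: mult_left_le)
    then show ?thesis using j by linarith
  qed
  have xj: "\<bar>real j / real N - x\<bar> \<le> 1 / real N"
  proof -
    have "real j / real N - x = (real j - real N * x) / real N"
      using N by (simp add: field_simps)
    moreover have "\<bar>real j - real N * x\<bar> \<le> 1" using j by linarith
    ultimately show ?thesis by (simp add: abs_divide divide_right_mono)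
  qed
  have one: "max 0 (min 1 (real N * x - real i)) = 1" if "i < j" for i
  proof -
    have "real i + 1 \<le> real j" using that by linarith
    then show ?thesis using j by linarith
  qed
  have e0: "0 \<le> e" using e[of 0 0] by simp
  have "\<bar>(\<Sum>i<N. z i * max 0 (min 1 (real N * x - real i))) - b x\<bar> \<le> 2 * e"
  proof (cases "j = N")
    \<comment> \<open>At the right end point x = 1 the cell index is N, for which there is no ramp;
      all ramps equal 1 there and the sum telescopes completely.\<close>
    case True
    have "(\<Sum>i<N. z i * max 0 (min 1 (real N * x - real i))) = (\<Sum>i<N. z i)"
      using one True by (intro sum.cong) auto
    also have "\<dots> = b (real j / real N)" using tel True by simp
    finally show ?thesis using e[OF xj] e0 by (simp add: b_def)
  next
    case False
    then have "j < N" using jN by simp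
    have "(\<Sum>i<N. z i * max 0 (min 1 (real N * x - real i))) = (\<Sum>i<Suc j. z i * max 0 (min 1 (real N * x - real i)))"
      using \<open>j < N\<close> j by (intro sum.mono_neutral_right) auto
    also have "\<dots> = (\<Sum>i<j. z i * max 0 (min 1 (real N * x - real i))) + z j * (real N * x - real j)"
      using j by (simp add: max_def min_def)
    also have "(\<Sum>i<j. z i * max 0 (min 1 (real N * x - real i))) = (\<Sum>i<j. z i)"
      using one by (intro sum.cong) auto
    also have "\<dots> = b (real j / real N)" using tel jN by simp
    finally have eq: "(\<Sum>i<N. z i * max 0 (min 1 (real N * x - real i))) = b (real j / real N) + z j * (real N * x - real j)" .
    have "\<bar>z j\<bar> \<le> e"
      unfolding z[OF \<open>j < N\<close>] by (rule e) (simp flip: diff_divide_distrib)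
    moreover have "\<bar>z j * (real N * x - real j)\<bar> \<le> \<bar>z j\<bar> * 1"
      unfolding abs_mult using j by (intro mult_left_mono) auto
    ultimately have "\<bar>z j * (real N * x - real j)\<bar> \<le> e" by simp
    with e[OF xj] show ?thesis unfolding eq b_def by linarith
  qed
  then show "dist (apply_bcontfun (interp N z) s) (apply_bcontfun \<beta> s) \<le> 2 * e"
    by (simp add: dist_real_def apply_interp x_def b_def)
qed

definition increment :: "(real \<Rightarrow> 'a \<Rightarrow> real) \<Rightarrow> real \<Rightarrow> real \<Rightarrow> nat \<Rightarrow> nat \<Rightarrow> 'a \<Rightarrow> real" where
  "increment W h a N i \<omega> = (W (a + h * real (Suc i) / real N) \<omega> - W (a + h * real i / real N) \<omega>) / sqrt h"

text \<open>The joint law of the N normalized increments of a block. Neither h nor a occurs in it: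
  this is the source of both scaling and stationarity.\<close>

definition gauss_product :: "nat \<Rightarrow> (nat \<Rightarrow> real) measure" where
  "gauss_product N = PiM {..<N} (\<lambda>_. density lborel (\<lambda>x. ennreal (normal_density 0 (sqrt (1 / real N)) x)))"

locale brownian =
  fixes M :: "'a measure" and W :: "real \<Rightarrow> 'a \<Rightarrow> real"
  assumes bm: "brownian_motion M W"
begin

sublocale prob_space M
  using bm by (simp add: brownian_motion_def)

lemma measurable_W [measurable]: "t \<ge> 0 \<Longrightarrow> W t \<in> borel_measurable M"
  using bm by (simp add: brownian_motion_def)

lemma measurable_increment:
  "h > 0 \<Longrightarrow> a \<ge> 0 \<Longrightarrow> increment W h a N i \<in> borel_measurable M"
  unfolding increment_def by (intro borel_measurable_divide borel_measurable_diff measurable_W) auto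

lemma interp_increment_tendsto:
  assumes "\<omega> \<in> space M" and h: "h > 0" and a: "a \<ge> 0"
  shows "(\<lambda>n. interp (Suc n) (\<lambda>i. increment W h a (Suc n) i \<omega>)) \<longlonglongrightarrow> xi W h a \<omega>"
proof (rule metric_LIMSEQ_I)
  fix e :: real assume e: "e > 0"
  let ?b = "xi W h a \<omega>"
  have pos: "e / 4 > 0" using e by simp
  obtain d where d: "d > 0"
    and D: "\<And>x y. \<bar>x - y\<bar> < d \<Longrightarrow> \<bar>apply_bcontfun ?b (pt x) - apply_bcontfun ?b (pt y)\<bar> < e / 4"
    using C01_uniform[OF pos, of ?b] by blast
  obtain n0 where n0: "1 / real (Suc n0) < d" using nat_approx_posE[OF d] by auto
  show "\<exists>n0. \<forall>n\<ge>n0. dist (interp (Suc n) (\<lambda>i. increment W h a (Suc n) i \<omega>)) ?b < e"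
  proof (intro exI allI impI)
    fix n assume "n \<ge> n0"
    then have "1 / real (Suc n) < d" using n0 by (smt (verit) frac_le of_nat_0_less_iff of_nat_mono Suc_le_mono zero_less_Suc)
    have [simp]: "ui_real (pt (real i / real (Suc n))) = real i / real (Suc n)" if "i \<le> Suc n" for i
      using that by (simp add: ui_real_pt max_def min_def)
    have "dist (interp (Suc n) (\<lambda>i. increment W h a (Suc n) i \<omega>)) ?b \<le> 2 * (e / 4)"
    proof (rule interp_close)
      show "apply_bcontfun ?b (pt 0) = 0"
        using assms by (simp add: apply_xi[OF bm] ui_real_pt)
      show "increment W h a (Suc n) i \<omega> = apply_bcontfun ?b (pt (real (Suc i) / real (Suc n))) - apply_bcontfun ?b (pt (real i / real (Suc n)))"
        if "i < Suc n" for i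
        using that assms by (simp add: apply_xi[OF bm] increment_def diff_divide_distrib del: of_nat_Suc)
      show "\<bar>apply_bcontfun ?b (pt x) - apply_bcontfun ?b (pt y)\<bar> \<le> e / 4" if "\<bar>x - y\<bar> \<le> 1 / real (Suc n)" for x y
        using D[of x y] that \<open>1 / real (Suc n) < d\<close> by linarith
    qed simp
    then show "dist (interp (Suc n) (\<lambda>i. increment W h a (Suc n) i \<omega>)) ?b < e" using e by simp
  qed
qed

lemma measurable_interp_increment:
  assumes "h > 0" "a \<ge> 0"
  shows "(\<lambda>\<omega>. interp N (\<lambda>i. increment W h a N i \<omega>)) \<in> borel_measurable M"
proof -
  have "(\<lambda>\<omega>. \<lambda>i\<in>{..<N}. increment W h a N i \<omega>) \<in> measurable M (PiM {..<N} (\<lambda>_. borel))"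
    by (intro measurable_restrict measurable_increment assms)
  from measurable_compose[OF this measurable_interp] show ?thesis
    by (simp cong: interp_cong)
qed

text \<open>A pointwise limit of measurable polygonal paths. This avoids comparing the Borel sets of
  the sup metric with the sigma-algebra generated by the evaluations.\<close>

lemma measurable_xi [measurable]:
  assumes "h > 0" "a \<ge> 0"
  shows "xi W h a \<in> borel_measurable M"
  by (rule borel_measurable_LIMSEQ_metric[OF measurable_interp_increment interp_increment_tendsto])
    (use assms in auto)

lemma distr_increment:
  assumes "h > 0" "a \<ge> 0" "N > 0"
  shows "distr M borel (increment W h a N i) = density lborel (\<lambda>x. ennreal (normal_density 0 (sqrt (1 / real N)) x))"
proof -
  let ?s = "a + h * real i / real N" and ?t = "a + h * real (Suc i) / real N"
  have st: "0 \<le> ?s" "?s < ?t" using assms by (auto simp: divide_strict_right_mono)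
  have diff: "?t - ?s = h / real N" by (simp add: distrib_left add_divide_distrib)
  have "distributed M lborel (\<lambda>\<omega>. W ?t \<omega> - W ?s \<omega>) (normal_density 0 (sqrt (?t - ?s)))"
    using bm st unfolding brownian_motion_def by blast
  from normal_density_affine[OF this, of "1 / sqrt h" 0] st assms
  have "distributed M lborel (increment W h a N i) (normal_density 0 (\<bar>1 / sqrt h\<bar> * sqrt (h / real N)))"
    unfolding diff increment_def by simp
  also have "\<bar>1 / sqrt h\<bar> * sqrt (h / real N) = sqrt (1 / real N)"
    using assms by (simp add: real_sqrt_divide)
  finally have "distr M lborel (increment W h a N i) = density lborel (\<lambda>x. ennreal (normal_density 0 (sqrt (1 / real N)) x))"
    by (rule distributed_distr_eq_density)
  then show ?thesis by (simp cong: distr_cong)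
qed

lemma indep_increments:
  assumes h: "h > 0" and a: "a \<ge> 0" and N: "N > 0"
  shows "indep_vars (\<lambda>_. borel) (increment W h a N) {..<n}"
proof -
  define t where "t i = a + h * real i / real N" for i
  have "0 \<le> t 0 \<and> (\<forall>i<n. t i < t (Suc i))"
    using assms by (auto simp: t_def divide_strict_right_mono)
  then have "indep_vars (\<lambda>_. borel) (\<lambda>i \<omega>. W (t (Suc i)) \<omega> - W (t i) \<omega>) {..<n}"
    using bm unfolding brownian_motion_def by blast
  from indep_vars_compose2[OF this, of "\<lambda>_ x. x / sqrt h" "\<lambda>_. borel"] show ?thesis
    by (simp add: t_def increment_def[abs_def])
qed

lemma expectation_interp:
  fixes G :: "C01 \<Rightarrow> real"
  assumes h: "h > 0" and a: "a \<ge> 0" and N: "N > 0" and G: "G \<in> borel_measurable borel"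
  shows "(LINT \<omega>|M. G (interp N (\<lambda>i. increment W h a N i \<omega>))) = (LINT z|gauss_product N. G (interp N z))"
proof -
  let ?X = "\<lambda>\<omega>. \<lambda>i\<in>{..<N}. increment W h a N i \<omega>"
  have "distr M (PiM {..<N} (\<lambda>_. borel)) ?X = PiM {..<N} (\<lambda>i. distr M borel (increment W h a N i))"
    using N by (intro iffD1[OF indep_vars_iff_distr_eq_PiM' indep_increments[OF h a N]])
      (auto simp: measurable_increment h a lessThan_empty_iff)
  then have eq: "gauss_product N = distr M (PiM {..<N} (\<lambda>_. borel)) ?X"
    by (simp add: gauss_product_def distr_increment h a N)
  have "(LINT z|gauss_product N. G (interp N z)) = (LINT \<omega>|M. G (interp N (?X \<omega>)))"
    unfolding eq
    by (intro integral_distr measurable_restrict measurable_increment h a measurable_compose[OF measurable_interp G])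
  also have "(\<lambda>\<omega>. interp N (?X \<omega>)) = (\<lambda>\<omega>. interp N (\<lambda>i. increment W h a N i \<omega>))"
    by (simp cong: interp_cong)
  finally show ?thesis ..
qed

text \<open>Block j uses the increments with indices from j * N to j * N + N - 1 of one long grid
  started at a. These index sets are disjoint, so functions of different blocks are
  independent.\<close>

lemma expectation_prod_interp:
  fixes G :: "nat \<Rightarrow> C01 \<Rightarrow> real"
  assumes h: "h > 0" and a: "a \<ge> 0" and N: "N > 0"
    and G: "\<And>j. j < k \<Longrightarrow> G j \<in> borel_measurable borel" and B: "\<And>j \<beta>. j < k \<Longrightarrow> \<bar>G j \<beta>\<bar> \<le> B"
  shows "(LINT \<omega>|M. (\<Prod>j<k. G j (interp N (\<lambda>i. increment W h (a + h * real j) N i \<omega>)))) =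
    (\<Prod>j<k. LINT \<omega>|M. G j (interp N (\<lambda>i. increment W h (a + h * real j) N i \<omega>)))"
proof -
  let ?K = "\<lambda>j. {j*N..<j*N+N}"
  have "indep_vars (\<lambda>j. PiM (?K j) (\<lambda>_. borel)) (\<lambda>j \<omega>. restrict (\<lambda>i. increment W h a N i \<omega>) (?K j)) {..<k}"
  proof (rule indep_vars_restrict[OF indep_increments[OF h a N, of "k * N"]])
    show "?K j \<subseteq> {..<k * N}" if "j \<in> {..<k}" for j
    proof -
      have "Suc j * N \<le> k * N" using that by (intro mult_right_mono) auto
      then show ?thesis by auto
    qed
    have aux: "i = j" if "x \<in> ?K i" "x \<in> ?K j" for i j x
    proof -
      have "x div N = i" if "x \<in> ?K i" for i
        using that by (intro div_nat_eqI) (auto simp: mult.commute)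
      then show ?thesis using that by metis
    qed
    show "disjoint_family_on ?K {..<k}"
      unfolding disjoint_family_on_def using aux by blast
  qed
  then have "indep_vars (\<lambda>_. borel) (\<lambda>j \<omega>. G j (interp N (\<lambda>i. restrict (\<lambda>i. increment W h a N i \<omega>) (?K j) (j * N + i)))) {..<k}"
  proof (rule indep_vars_compose2)
    fix j assume j: "j \<in> {..<k}"
    have "(\<lambda>z. \<lambda>i\<in>{..<N}. z (j * N + i)) \<in> measurable (PiM (?K j) (\<lambda>_. borel)) (PiM {..<N} (\<lambda>_. borel :: real measure))"
      by (intro measurable_restrict measurable_component_singleton) auto
    from measurable_compose[OF measurable_compose[OF this measurable_interp] G] j
    show "(\<lambda>z. G j (interp N (\<lambda>i. z (j * N + i)))) \<in> borel_measurable (PiM (?K j) (\<lambda>_. borel))"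
      by (simp cong: interp_cong)
  qed
  also have "(\<lambda>j \<omega>. G j (interp N (\<lambda>i. restrict (\<lambda>i. increment W h a N i \<omega>) (?K j) (j * N + i)))) =
     (\<lambda>j \<omega>. G j (interp N (\<lambda>i. increment W h (a + h * real j) N i \<omega>)))"
  proof -
    have 1: "a + h * real (j * N + i) / real N = a + h * real j + h * real i / real N" for i j
      using N by (simp add: field_simps)
    have "increment W h a N (j * N + i) \<omega> = increment W h (a + h * real j) N i \<omega>" for i j \<omega>
      using 1[of j i] 1[of j "Suc i"] by (simp add: increment_def add.assoc)
    then show ?thesis by (simp cong: interp_cong)
  qed
  finally have ind: "indep_vars (\<lambda>_. borel) (\<lambda>j \<omega>. G j (interp N (\<lambda>i. increment W h (a + h * real j) N i \<omega>))) {..<k}" .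
  show ?thesis
  proof (rule indep_vars_lebesgue_integral[OF _ ind])
    fix j assume "j \<in> {..<k}"
    then show "integrable M (\<lambda>\<omega>. G j (interp N (\<lambda>i. increment W h (a + h * real j) N i \<omega>)))"
      using h a by (intro integrable_const_bound[where B=B] measurable_compose[OF measurable_interp_increment G])
        (auto simp: B)
  qed simp
qed

lemma integrable_bounded:
  fixes f :: "'a \<Rightarrow> real"
  assumes "f \<in> borel_measurable M" "\<And>\<omega>. \<omega> \<in> space M \<Longrightarrow> \<bar>f \<omega>\<bar> \<le> B"
  shows "integrable M f"
  using assms by (intro integrable_const_bound[where B=B]) auto

definition wiener :: "C01 measure" where
  "wiener = distr M borel (xi W 1 0)"

lemma prob_space_wiener: "prob_space wiener"
  unfolding wiener_def by (rule prob_space_distr) simp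

lemma sets_wiener [simp, measurable_cong]: "sets wiener = sets borel"
  by (simp add: wiener_def)

text \<open>For every mesh the approximating expectation is an integral against
  \<open>gauss_product\<close>, which is the same for all h and a; hence so is the limit.\<close>

lemma expectation_xi_eq:
  fixes G :: "C01 \<Rightarrow> real"
  assumes h: "h > 0" and a: "a \<ge> 0"
    and G: "continuous_on UNIV G" and B: "\<And>\<beta>. \<bar>G \<beta>\<bar> \<le> B"
  shows "(LINT \<omega>|M. G (xi W h a \<omega>)) = (LINT \<beta>|wiener. G \<beta>)"
proof -
  note Gm = borel_measurable_continuous_onI[OF G]
  have lim: "(\<lambda>n. LINT z|gauss_product (Suc n). G (interp (Suc n) z)) \<longlonglongrightarrow> (LINT \<omega>|M. G (xi W h a \<omega>))"
    if h: "h > 0" and a: "a \<ge> 0" for h a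
  proof -
    have "(\<lambda>n. LINT \<omega>|M. G (interp (Suc n) (\<lambda>i. increment W h a (Suc n) i \<omega>))) \<longlonglongrightarrow> (LINT \<omega>|M. G (xi W h a \<omega>))"
    proof (rule integral_dominated_convergence[where w = "\<lambda>_. B"])
      show "AE \<omega> in M. (\<lambda>n. G (interp (Suc n) (\<lambda>i. increment W h a (Suc n) i \<omega>))) \<longlonglongrightarrow> G (xi W h a \<omega>)"
        by (intro AE_I2 continuous_on_tendsto_compose[OF G] interp_increment_tendsto h a) auto
    qed (auto simp: B intro!: measurable_compose[OF measurable_xi Gm] measurable_compose[OF measurable_interp_increment Gm] h a)
    then show ?thesis by (simp only: expectation_interp[OF h a zero_less_Suc Gm])
  qed
  have "(LINT \<omega>|M. G (xi W h a \<omega>)) = (LINT \<omega>|M. G (xi W 1 0 \<omega>))"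
    by (rule LIMSEQ_unique[OF lim[OF h a] lim]) auto
  then show ?thesis
    unfolding wiener_def using Gm by (subst integral_distr) auto
qed

text \<open>Factorization survives the passage from polygonal paths to paths because G is bounded
  and continuous. All later uses of independence go through this identity.\<close>

proposition expectation_prod_xi:
  fixes G :: "nat \<Rightarrow> C01 \<Rightarrow> real"
  assumes h: "h > 0" and a: "a \<ge> 0"
    and G: "\<And>j. j < k \<Longrightarrow> continuous_on UNIV (G j)" and B: "\<And>j \<beta>. j < k \<Longrightarrow> \<bar>G j \<beta>\<bar> \<le> B"
  shows "(LINT \<omega>|M. (\<Prod>j<k. G j (xi W h (a + h * real j) \<omega>))) = (\<Prod>j<k. LINT \<beta>|wiener. G j \<beta>)"
proof -
  have a': "a + h * real j \<ge> 0" for j using h a by simp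
  note Gm = borel_measurable_continuous_onI[OF G]
  let ?I = "\<lambda>n j \<omega>. interp (Suc n) (\<lambda>i. increment W h (a + h * real j) (Suc n) i \<omega>)"
  have m: "(\<lambda>\<omega>. G j (?I n j \<omega>)) \<in> borel_measurable M" if "j < k" for j n
    by (intro measurable_compose[OF measurable_interp_increment Gm] h a' that)
  have m': "(\<lambda>\<omega>. G j (xi W h (a + h * real j) \<omega>)) \<in> borel_measurable M" if "j < k" for j
    by (intro measurable_compose[OF measurable_xi Gm] h a' that)
  have l: "(\<lambda>n. G j (?I n j \<omega>)) \<longlonglongrightarrow> G j (xi W h (a + h * real j) \<omega>)" if "j < k" "\<omega> \<in> space M" for j \<omega>
    by (intro continuous_on_tendsto_compose[OF G] interp_increment_tendsto h a' that) auto
  have "(\<lambda>n. LINT \<omega>|M. (\<Prod>j<k. G j (?I n j \<omega>))) \<longlonglongrightarrow> (LINT \<omega>|M. (\<Prod>j<k. G j (xi W h (a + h * real j) \<omega>)))"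
  proof (rule integral_dominated_convergence[where w = "\<lambda>_. B ^ k"])
    show "AE \<omega> in M. norm (\<Prod>j<k. G j (?I n j \<omega>)) \<le> B ^ k" for n
    proof (intro AE_I2)
      fix \<omega>
      have "norm (\<Prod>j<k. G j (?I n j \<omega>)) \<le> (\<Prod>j<k. B)"
        unfolding prod_norm[symmetric] by (intro prod_mono) (auto simp: B)
      then show "norm (\<Prod>j<k. G j (?I n j \<omega>)) \<le> B ^ k" by simp
    qed
    show "AE \<omega> in M. (\<lambda>n. \<Prod>j<k. G j (?I n j \<omega>)) \<longlonglongrightarrow> (\<Prod>j<k. G j (xi W h (a + h * real j) \<omega>))"
      by (intro AE_I2 tendsto_prod l) auto
  qed (auto intro!: borel_measurable_prod m m')
  moreover have "(LINT \<omega>|M. (\<Prod>j<k. G j (?I n j \<omega>))) = (\<Prod>j<k. LINT \<omega>|M. G j (?I n j \<omega>))" for n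
    by (rule expectation_prod_interp[OF h a _ Gm B]) auto
  moreover have "(\<lambda>n. \<Prod>j<k. LINT \<omega>|M. G j (?I n j \<omega>)) \<longlonglongrightarrow> (\<Prod>j<k. LINT \<omega>|M. G j (xi W h (a + h * real j) \<omega>))"
  proof (intro tendsto_prod)
    fix j assume "j \<in> {..<k}"
    then show "(\<lambda>n. LINT \<omega>|M. G j (?I n j \<omega>)) \<longlonglongrightarrow> (LINT \<omega>|M. G j (xi W h (a + h * real j) \<omega>))"
      by (intro integral_dominated_convergence[where w = "\<lambda>_. B"] AE_I2 l m m') (auto simp: B)
  qed
  ultimately have "(LINT \<omega>|M. (\<Prod>j<k. G j (xi W h (a + h * real j) \<omega>))) = (\<Prod>j<k. LINT \<omega>|M. G j (xi W h (a + h * real j) \<omega>))"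
    by (simp add: LIMSEQ_unique)
  then show ?thesis using expectation_xi_eq[OF h a' G B] by simp
qed

end

section \<open>The logarithmic moment generating functional\<close>

lemma set_integrable_Icc:
  fixes f :: "real \<Rightarrow> real"
  assumes "continuous_on {0..T} f" "0 \<le> a" "b \<le> T"
  shows "set_integrable lborel {a..b} f"
  by (rule borel_integrable_atLeastAtMost'[OF continuous_on_subset[OF assms(1)]]) (use assms in auto)

lemma set_integral_split:
  fixes f :: "real \<Rightarrow> real"
  assumes "continuous_on {0..T} f" "0 \<le> a" "a \<le> b" "b \<le> c" "c \<le> T"
  shows "(LINT t:{a..c}|lborel. f t) = (LINT t:{a..b}|lborel. f t) + (LINT t:{b..c}|lborel. f t)"
proof -
  have i: "set_integrable lborel {a..c} f" "set_integrable lborel {a..b} f" "set_integrable lborel {b..c} f"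
    by (rule set_integrable_Icc[OF assms(1)]; use assms in simp)+
  show ?thesis
    using Henstock_Kurzweil_Integration.integral_combine[OF assms(3,4) set_borel_integral_eq_integral(1)[OF i(1)]]
    by (simp add: i set_borel_integral_eq_integral(2))
qed

text \<open>The bound is K times the length left uncovered: a piece of length e at the end of each
  of the k blocks, and the remainder beyond h * k.\<close>

lemma block_integral:
  fixes f :: "real \<Rightarrow> real"
  assumes f: "continuous_on {0..T} f" and K: "\<And>x. x \<in> {0..T} \<Longrightarrow> \<bar>f x\<bar> \<le> K"
    and e: "0 \<le> e" "e \<le> h" and kh: "h * real k \<le> T"
  shows "\<bar>(LINT t:{0..T}|lborel. f t) - (\<Sum>j<k. LINT t:{h * real j..h * real j + (h - e)}|lborel. f t)\<bar>
           \<le> K * (T - real k * (h - e))"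
proof -
  have bd: "\<bar>LINT t:{a..b}|lborel. f t\<bar> \<le> K * (b - a)" if "0 \<le> a" "a \<le> b" "b \<le> T" for a b
    by (intro abs_set_integral_le K set_integrable_Icc[OF f]) (use that in auto)
  have h: "h \<ge> 0" using e by simp
  have "\<bar>(LINT t:{0..h * real k}|lborel. f t) - (\<Sum>j<k. LINT t:{h * real j..h * real j + (h - e)}|lborel. f t)\<bar>
           \<le> K * (real k * e)" using kh
  proof (induction k)
    case 0
    then show ?case using bd[of 0 0] by simp
  next
    case (Suc k)
    let ?a = "h * real k"
    have a: "0 \<le> ?a" "?a \<le> ?a + (h - e)" "?a + (h - e) \<le> h * real (Suc k)" "h * real (Suc k) \<le> T"
      using h e Suc.prems by (auto simp: algebra_simps)
    have IH: "\<bar>(LINT t:{0..?a}|lborel. f t) - (\<Sum>j<k. LINT t:{h * real j..h * real j + (h - e)}|lborel. f t)\<bar> \<le> K * (real k * e)"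
      using a by (intro Suc.IH) linarith
    have "(LINT t:{0..h * real (Suc k)}|lborel. f t) = (LINT t:{0..?a}|lborel. f t) +
        (LINT t:{?a..?a + (h - e)}|lborel. f t) + (LINT t:{?a + (h - e)..h * real (Suc k)}|lborel. f t)"
      using set_integral_split[OF f, of 0 ?a "h * real (Suc k)"] set_integral_split[OF f, of ?a "?a + (h - e)" "h * real (Suc k)"] a
      by simp
    moreover have "\<bar>LINT t:{?a + (h - e)..h * real (Suc k)}|lborel. f t\<bar> \<le> K * e"
      using bd[of "?a + (h - e)" "h * real (Suc k)"] a by (simp add: algebra_simps)
    ultimately show ?case using IH by (simp add: algebra_simps)
  qed
  moreover have "(LINT t:{0..T}|lborel. f t) = (LINT t:{0..h * real k}|lborel. f t) + (LINT t:{h * real k..T}|lborel. f t)"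
    using h kh by (intro set_integral_split[OF f]) auto
  moreover have "\<bar>LINT t:{h * real k..T}|lborel. f t\<bar> \<le> K * (T - h * real k)"
    using h kh by (intro bd) auto
  ultimately show ?thesis by (simp add: algebra_simps)
qed

text \<open>The mesh 1 / (N + 1) divides 1, so that the grid points can later be sorted by their
  fractional parts.\<close>

lemma riemann_sum_tendsto:
  fixes f :: "real \<Rightarrow> real"
  assumes f: "continuous_on {0..real n} f"
  shows "(\<lambda>N. (\<Sum>q<n * Suc N. f (real q / real (Suc N))) / real (Suc N)) \<longlonglongrightarrow> (LINT t:{0..real n}|lborel. f t)"
proof (rule metric_LIMSEQ_I)
  fix e :: real assume e: "e > 0"
  define e' where "e' = e / (real n + 1)"
  have e': "e' > 0" using e by (simp add: e'_def)
  have "uniformly_continuous_on {0..real n} f"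
    by (intro compact_uniformly_continuous f) auto
  then obtain d where d: "d > 0" and D: "\<And>x y. x \<in> {0..real n} \<Longrightarrow> y \<in> {0..real n} \<Longrightarrow> \<bar>y - x\<bar> < d \<Longrightarrow> \<bar>f y - f x\<bar> < e'"
    unfolding uniformly_continuous_on_def dist_real_def using e' by metis
  obtain N0 where N0: "1 / real (Suc N0) < d" using nat_approx_posE[OF d] by auto
  show "\<exists>N0. \<forall>N\<ge>N0. dist ((\<Sum>q<n * Suc N. f (real q / real (Suc N))) / real (Suc N)) (LINT t:{0..real n}|lborel. f t) < e"
  proof (intro exI allI impI)
    fix N assume "N \<ge> N0"
    then have Nd: "1 / real (Suc N) < d"
      using N0 by (smt (verit) frac_le of_nat_0_less_iff of_nat_mono Suc_le_mono zero_less_Suc)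
    define x where "x q = real q / real (Suc N)" for q
    have x0: "0 \<le> x q" for q by (simp add: x_def)
    have xS: "x (Suc q) = x q + 1 / real (Suc N)" for q by (simp add: x_def add_divide_distrib)
    have "\<bar>(LINT t:{0..x q}|lborel. f t) - (\<Sum>p<q. f (x p)) / real (Suc N)\<bar> \<le> real q * (e' / real (Suc N))"
      if "q \<le> n * Suc N" for q using that
    proof (induction q)
      case 0
      have "\<bar>LINT t:{0..0}|lborel. f t\<bar> \<le> \<bar>f 0\<bar> * (0 - 0)"
        by (intro abs_set_integral_le set_integrable_Icc[OF f]) auto
      then show ?case by (simp add: x_def)
    next
      case (Suc q)
      have xn: "x (Suc q) \<le> real n"
      proof -
        have "real (Suc q) \<le> real n * real (Suc N)"
          using Suc.prems by (metis of_nat_mono of_nat_mult)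
        then show ?thesis by (simp add: x_def divide_le_eq)
      qed
      have xx: "x q \<le> x (Suc q)" by (simp add: xS)
      have int: "set_integrable lborel {x q..x (Suc q)} f"
        using x0 xn by (intro set_integrable_Icc[OF f]) auto
      have c: "set_integrable lborel {x q..x (Suc q)} (\<lambda>_. f (x q))"
        by (intro borel_integrable_atLeastAtMost' continuous_intros)
      have "\<bar>LINT t:{x q..x (Suc q)}|lborel. f t - f (x q)\<bar> \<le> e' * (x (Suc q) - x q)"
      proof (rule abs_set_integral_le[OF xx set_integral_diff(1)[OF int c]])
        fix t assume "t \<in> {x q..x (Suc q)}"
        then show "\<bar>f t - f (x q)\<bar> \<le> e'"
          using xS[of q] x0[of q] xn Nd by (intro less_imp_le D) auto
      qed
      also have "x (Suc q) - x q = 1 / real (Suc N)" by (simp add: xS)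
      also have "(LINT t:{x q..x (Suc q)}|lborel. f t - f (x q)) = (LINT t:{x q..x (Suc q)}|lborel. f t) - f (x q) * (x (Suc q) - x q)"
        using xx by (subst set_integral_diff(2)[OF int c]) (simp add: set_lebesgue_integral_def)
      finally have "\<bar>(LINT t:{x q..x (Suc q)}|lborel. f t) - f (x q) / real (Suc N)\<bar> \<le> e' / real (Suc N)"
        by (simp add: xS)
      moreover have "(LINT t:{0..x (Suc q)}|lborel. f t) = (LINT t:{0..x q}|lborel. f t) + (LINT t:{x q..x (Suc q)}|lborel. f t)"
        using x0 xx xn by (intro set_integral_split[OF f]) auto
      moreover have "\<bar>(LINT t:{0..x q}|lborel. f t) - (\<Sum>p<q. f (x p)) / real (Suc N)\<bar> \<le> real q * (e' / real (Suc N))"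
        using Suc by simp
      moreover have "(\<Sum>p<Suc q. f (x p)) / real (Suc N) = (\<Sum>p<q. f (x p)) / real (Suc N) + f (x q) / real (Suc N)"
        by (simp add: add_divide_distrib)
      moreover have "real (Suc q) * (e' / real (Suc N)) = real q * (e' / real (Suc N)) + e' / real (Suc N)"
        by (simp only: of_nat_Suc distrib_right mult_1_left)
      ultimately show ?case by linarith
    qed
    note main = this
    have xe: "x (n * Suc N) = real n" unfolding x_def of_nat_mult by (simp del: of_nat_Suc)
    have "\<bar>(LINT t:{0..real n}|lborel. f t) - (\<Sum>p<n * Suc N. f (x p)) / real (Suc N)\<bar> \<le> real (n * Suc N) * (e' / real (Suc N))"
      using main[of "n * Suc N"] unfolding xe by simp
    moreover have "real (n * Suc N) * (e' / real (Suc N)) = real n * e'" unfolding of_nat_mult by (simp del: of_nat_Suc)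
    moreover have "real n * e' < e" using e by (simp add: e'_def field_simps)
    ultimately show "dist ((\<Sum>q<n * Suc N. f (real q / real (Suc N))) / real (Suc N)) (LINT t:{0..real n}|lborel. f t) < e"
      unfolding dist_real_def x_def by linarith
  qed
qed

lemma exp_mean_le:
  fixes a :: "nat \<Rightarrow> real"
  assumes "N > 0"
  shows "exp ((\<Sum>i<N. a i) / real N) \<le> (\<Sum>i<N. exp (a i)) / real N"
proof -
  have "exp (\<Sum>i<N. (1 / real N) *\<^sub>R a i) \<le> (\<Sum>i<N. (1 / real N) * exp (a i))"
    using assms by (intro convex_on_sum[OF _ _ exp_convex]) auto
  then show ?thesis by (simp add: sum_divide_distrib)
qed

text \<open>Letting T tend to infinity for two values S and S' compares b at S and S' up to K / S +
  K / S', so b is Cauchy along the integers, and g follows it. Unlike a subadditivity argument this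
  yields the rate K / S.\<close>

lemma almost_additive_limit:
  fixes g b :: "real \<Rightarrow> real"
  assumes gb: "\<And>S T. 1 \<le> S \<Longrightarrow> S \<le> T \<Longrightarrow> \<bar>g T - b S\<bar> \<le> K * (1 / S + 2 * S / T)"
  obtains l where "(g \<longlongrightarrow> l) at_top" "\<And>S. 1 \<le> S \<Longrightarrow> \<bar>l - b S\<bar> \<le> K / S"
proof -
  have lim: "((\<lambda>T. K * (1 / S + 2 * S / T)) \<longlongrightarrow> K * (1 / S + 0)) at_top" for S :: real
    by (intro tendsto_intros real_tendsto_divide_at_top[OF tendsto_const] filterlim_ident)
  have K: "K \<ge> 0" using gb[of 1 1] by (smt (verit) zero_le_mult_iff div_by_1)
  have bb: "\<bar>b S - b S'\<bar> \<le> K / S + K / S'" if "1 \<le> S" "1 \<le> S'" for S S'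
  proof (rule tendsto_lowerbound[where F = at_top])
    show "((\<lambda>T. K * (1 / S + 2 * S / T) + K * (1 / S' + 2 * S' / T)) \<longlongrightarrow> K / S + K / S') at_top"
      using tendsto_add[OF lim[of S] lim[of S']] by simp
    show "\<forall>\<^sub>F T in at_top. \<bar>b S - b S'\<bar> \<le> K * (1 / S + 2 * S / T) + K * (1 / S' + 2 * S' / T)"
      using eventually_ge_at_top[of "max S S'"]
    proof eventually_elim
      case (elim T)
      then show ?case using gb[of S T] gb[of S' T] that by simp
    qed
  qed simp
  have KS: "(\<lambda>n. K / real (Suc n)) \<longlonglongrightarrow> 0"
    using tendsto_mult_right_zero[OF LIMSEQ_inverse_real_of_nat, of K] by (simp add: divide_inverse)
  have "Cauchy (\<lambda>n. b (real (Suc n)))"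
  proof (rule metric_CauchyI)
    fix e :: real assume "e > 0"
    then have "eventually (\<lambda>n. K / real (Suc n) < e / 2) sequentially"
      using order_tendstoD(2)[OF KS, of "e / 2"] by simp
    then obtain n0 where "\<And>n. n \<ge> n0 \<Longrightarrow> K / real (Suc n) < e / 2"
      unfolding eventually_sequentially by blast
    then show "\<exists>n0. \<forall>m\<ge>n0. \<forall>n\<ge>n0. dist (b (real (Suc m))) (b (real (Suc n))) < e"
      using bb unfolding dist_real_def by (smt (verit) field_sum_of_halves of_nat_1 of_nat_mono le_add1 plus_1_eq_Suc)
  qed
  then obtain l where l: "(\<lambda>n. b (real (Suc n))) \<longlonglongrightarrow> l"
    by (auto simp: Cauchy_convergent_iff convergent_def)
  have bl: "\<bar>l - b S\<bar> \<le> K / S" if "1 \<le> S" for S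
  proof (rule tendsto_le[OF sequentially_bot])
    show "(\<lambda>n. \<bar>b (real (Suc n)) - b S\<bar>) \<longlonglongrightarrow> \<bar>l - b S\<bar>" by (intro tendsto_intros l)
    show "(\<lambda>n. K / real (Suc n) + K / S) \<longlonglongrightarrow> K / S"
      using tendsto_add[OF KS tendsto_const[of "K / S"]] by simp
    show "\<forall>\<^sub>F n in sequentially. \<bar>b (real (Suc n)) - b S\<bar> \<le> K / real (Suc n) + K / S"
      using that by (intro always_eventually allI bb) auto
  qed
  have "(g \<longlongrightarrow> l) at_top"
  proof (rule tendstoI)
    fix e :: real assume e: "e > 0"
    \<comment> \<open>Two errors K / S have to be paid, one between g and b S and one between b S
      and l; this choice makes their sum smaller than e.\<close>
    define S where "S = max 1 (4 * K / e + 1)"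
    have S: "1 \<le> S" "4 * K / e < S" by (auto simp: S_def)
    have S2: "2 * K / S < e"
    proof -
      have "4 * K < S * e" using S e by (simp add: divide_less_eq)
      then have "2 * K < e * S" using K by (simp add: mult.commute)
      then show ?thesis using S by (simp add: divide_less_eq)
    qed
    have "K * (1 / S + 0) + K / S < e" using S2 by simp
    then have "\<forall>\<^sub>F T in at_top. K * (1 / S + 2 * S / T) + K / S < e"
      using order_tendstoD(2)[OF tendsto_add[OF lim[of S] tendsto_const[of "K / S"]]] by blast
    then show "\<forall>\<^sub>F T in at_top. dist (g T) l < e"
      using eventually_ge_at_top[of S]
    proof eventually_elim
      case (elim T)
      then show ?case using gb[of S T] bl[of S] S unfolding dist_real_def by linarith
    qed
  qed
  then show ?thesis using that bl by blast
qed

section \<open>Exponential moments over long time intervals\<close>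

context brownian
begin

text \<open>By Brownian scaling, \<open>Z S F\<close> is the exponential moment of the integral of \<open>F\<close> over the
  windows of unit length inside a path of length \<open>S\<close>.\<close>

definition Z :: "real \<Rightarrow> (C01 \<Rightarrow>\<^sub>C real) \<Rightarrow> real" where
  "Z S F = (LINT \<beta>|wiener. exp (S * window_mean (1 / S) F \<beta>))"

lemma integral_xi:
  assumes "\<omega> \<in> space M" "\<epsilon> > 0" "S \<ge> 1" "a \<ge> 0"
  shows "(LINT t:{a..a + \<epsilon> * (S - 1)}|lborel. apply_bcontfun F (xi W \<epsilon> t \<omega>)) =
    \<epsilon> * (S * window_mean (1 / S) F (xi W (\<epsilon> * S) a \<omega>))"
proof -
  have "1 / S * (\<epsilon> * S) = \<epsilon>" "\<epsilon> * S * (1 - 1 / S) = \<epsilon> * (S - 1)"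
    using assms by (auto simp: field_simps)
  then show ?thesis
    using integral_xi_window[OF bm, of \<omega> "\<epsilon> * S" a "1 / S" F] assms by (simp add: mult.assoc)
qed

lemma continuous_on_xi_Icc:
  assumes "\<omega> \<in> space M" "\<epsilon> > 0" "T \<ge> 0"
  shows "continuous_on {0..T} (\<lambda>t. apply_bcontfun F (xi W \<epsilon> t \<omega>))"
proof -
  \<comment> \<open>Windows starting before T end before T + \<epsilon>, so all of them are windows
    inside one block of this length, and continuity in the starting time applies.\<close>
  define h where "h = T + \<epsilon>"
  have h: "h > 0" "\<epsilon> / h > 0" "\<epsilon> / h \<le> 1" "\<epsilon> / h * h = \<epsilon>" using assms by (auto simp: h_def)
  have "continuous_on {0..T} (\<lambda>t. apply_bcontfun F (window (\<epsilon> / h) (t / h) (xi W h 0 \<omega>)))"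
    by (intro continuous_on_apply_bcontfun_compose continuous_on_compose2[OF continuous_on_window_time[OF h(2)]] continuous_intros)
      (use h in auto)
  moreover have "window (\<epsilon> / h) (t / h) (xi W h 0 \<omega>) = xi W \<epsilon> t \<omega>" if "t \<in> {0..T}" for t
  proof -
    have "1 - \<epsilon> / h = T / h" using h(1) by (simp add: h_def field_simps)
    then have "t / h \<le> 1 - \<epsilon> / h" using that h(1) by (simp add: divide_right_mono)
    then show ?thesis
      using xi_window[OF bm assms(1) h(1) _ h(2,3), of 0 "t / h"] h that by simp
  qed
  ultimately show ?thesis by (elim continuous_on_eq) simp
qed

lemma continuous_on_exp_window_mean:
  "S \<ge> 1 \<Longrightarrow> continuous_on UNIV (\<lambda>\<beta>. exp (S * window_mean (1 / S) F \<beta>))"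
  by (intro continuous_intros continuous_on_window_mean) auto

lemma exp_window_mean_bounds:
  assumes "S \<ge> 1"
  shows "exp (- (S * norm F)) \<le> exp (S * window_mean (1 / S) F \<beta>)" "exp (S * window_mean (1 / S) F \<beta>) \<le> exp (S * norm F)"
proof -
  have "\<bar>S * window_mean (1 / S) F \<beta>\<bar> \<le> S * norm F"
    using abs_window_mean_le[of "1 / S" F \<beta>] assms by (simp add: abs_mult)
  then show "exp (- (S * norm F)) \<le> exp (S * window_mean (1 / S) F \<beta>)" "exp (S * window_mean (1 / S) F \<beta>) \<le> exp (S * norm F)"
    by (simp_all add: abs_le_iff)
qed

lemma integrable_wiener:
  fixes G :: "C01 \<Rightarrow> real"
  assumes "continuous_on UNIV G" "\<And>\<beta>. \<bar>G \<beta>\<bar> \<le> B"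
  shows "integrable wiener G"
proof -
  interpret w: prob_space wiener by (rule prob_space_wiener)
  show ?thesis
    using assms(2) borel_measurable_continuous_onI[OF assms(1)]
    by (intro w.integrable_const_bound[where B=B]) auto
qed

lemma Z_bounds:
  assumes "S \<ge> 1"
  shows "exp (- (S * norm F)) \<le> Z S F" "Z S F \<le> exp (S * norm F)"
proof -
  interpret w: prob_space wiener by (rule prob_space_wiener)
  have int: "integrable wiener (\<lambda>\<beta>. exp (S * window_mean (1 / S) F \<beta>))"
    using exp_window_mean_bounds[OF assms]
    by (intro integrable_wiener[where B="exp (S * norm F)"] continuous_on_exp_window_mean assms) auto
  show "exp (- (S * norm F)) \<le> Z S F" "Z S F \<le> exp (S * norm F)"
    unfolding Z_def using exp_window_mean_bounds[OF assms] int
    by (auto intro!: w.integral_ge_const w.integral_le_const)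
qed

lemma Z_pos: "S \<ge> 1 \<Longrightarrow> Z S F > 0"
  using Z_bounds(1)[of S F] by (meson exp_gt_zero less_le_trans)

lemma abs_ln_Z: "S \<ge> 1 \<Longrightarrow> \<bar>ln (Z S F)\<bar> \<le> S * norm F"
  using Z_bounds[of S F] Z_pos[of S F] by (metis abs_le_iff ln_exp ln_le_cancel_iff exp_gt_zero minus_le_iff)

text \<open>Brownian scaling removes \<epsilon>: the integral over [0, \<epsilon> * T] is \<epsilon>
  times a functional of a single rescaled block of length T + 1 in units of \<epsilon>.\<close>

lemma expectation_exp_integral:
  assumes "\<epsilon> > 0" "T \<ge> 0"
  shows "(LINT \<omega>|M. exp (1 / \<epsilon> * (LINT t:{0..\<epsilon> * T}|lborel. apply_bcontfun F (xi W \<epsilon> t \<omega>)))) = Z (T + 1) F"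
proof -
  have "(LINT \<omega>|M. exp (1 / \<epsilon> * (LINT t:{0..\<epsilon> * T}|lborel. apply_bcontfun F (xi W \<epsilon> t \<omega>)))) =
     (LINT \<omega>|M. exp ((T + 1) * window_mean (1 / (T + 1)) F (xi W (\<epsilon> * (T + 1)) 0 \<omega>)))"
    using integral_xi[of _ \<epsilon> "T + 1" 0 F] assms by (intro Bochner_Integration.integral_cong) auto
  also have "\<dots> = Z (T + 1) F"
    unfolding Z_def using exp_window_mean_bounds(2)[of "T + 1" F] assms
    by (intro expectation_xi_eq[where B="exp ((T + 1) * norm F)"] continuous_on_exp_window_mean) auto
  finally show ?thesis .
qed

lemma log_mgf_eq: "T \<ge> 0 \<Longrightarrow> log_mgf M W F T = ln (Z (T + 1) F) / T"
  using expectation_exp_integral[of 1 T F] by (simp add: log_mgf_def)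

lemma measurable_integral_xi:
  fixes F :: "C01 \<Rightarrow>\<^sub>C real"
  assumes "\<epsilon> > 0" "T \<ge> 0"
  shows "(\<lambda>\<omega>. LINT t:{0..\<epsilon> * T}|lborel. apply_bcontfun F (xi W \<epsilon> t \<omega>)) \<in> borel_measurable M"
proof -
  have "(\<lambda>\<omega>. \<epsilon> * ((T + 1) * window_mean (1 / (T + 1)) F (xi W (\<epsilon> * (T + 1)) 0 \<omega>))) \<in> borel_measurable M"
    using assms
    by (intro borel_measurable_times borel_measurable_const measurable_compose[OF measurable_xi borel_measurable_continuous_onI]
        continuous_on_window_mean) auto
  then show ?thesis
    using integral_xi[of _ \<epsilon> "T + 1" 0 F] assms by (simp cong: measurable_cong)
qed

lemma abs_integral_xi:
  assumes "\<omega> \<in> space M" "\<epsilon> > 0" "T \<ge> 0"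
  shows "\<bar>LINT t:{0..T}|lborel. apply_bcontfun F (xi W \<epsilon> t \<omega>)\<bar> \<le> norm F * T"
  using abs_set_integral_le[OF assms(3) set_integrable_Icc[OF continuous_on_xi_Icc[OF assms]] abs_apply_le]
  by simp

text \<open>Keeping only the windows inside the k blocks changes the exponent by at most D,
  uniformly in the path. The exponential moment of the kept part is exactly \<open>Z S F ^ k\<close>
  by independence.\<close>

lemma Z_almost_multiplicative:
  assumes S: "1 \<le> S" and kS: "S * real k \<le> T"
  shows "\<bar>ln (Z (T + 1) F) - real k * ln (Z S F)\<bar> \<le> norm F * (T - real k * (S - 1))"
proof -
  have T: "T \<ge> 0" using S kS by (meson of_nat_0_le_iff order.trans zero_le_mult_iff zero_le_one)
  define D where "D = norm F * (T - real k * (S - 1))"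
  define X where "X \<omega> = (LINT t:{0..T}|lborel. apply_bcontfun F (xi W 1 t \<omega>))" for \<omega>
  define Y where "Y \<omega> = (\<Prod>j<k. exp (S * window_mean (1 / S) F (xi W S (0 + S * real j) \<omega>)))" for \<omega>
  have XY: "exp (X \<omega>) \<le> exp D * Y \<omega>" "exp (- D) * Y \<omega> \<le> exp (X \<omega>)" if "\<omega> \<in> space M" for \<omega>
  proof -
    have "\<bar>X \<omega> - (\<Sum>j<k. LINT t:{S * real j..S * real j + (S - 1)}|lborel. apply_bcontfun F (xi W 1 t \<omega>))\<bar> \<le> D"
      unfolding X_def D_def
      using that T S kS by (intro block_integral continuous_on_xi_Icc abs_apply_le) auto
    moreover have "(LINT t:{S * real j..S * real j + (S - 1)}|lborel. apply_bcontfun F (xi W 1 t \<omega>)) =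
        S * window_mean (1 / S) F (xi W S (0 + S * real j) \<omega>)" for j
      using integral_xi[OF that, of 1 S "S * real j" F] S by simp
    ultimately have "\<bar>X \<omega> - (\<Sum>j<k. S * window_mean (1 / S) F (xi W S (0 + S * real j) \<omega>))\<bar> \<le> D" by simp
    then show "exp (X \<omega>) \<le> exp D * Y \<omega>" "exp (- D) * Y \<omega> \<le> exp (X \<omega>)"
      by (auto simp: Y_def exp_sum[symmetric] exp_add[symmetric])
  qed
  have Xm: "X \<in> borel_measurable M" using measurable_integral_xi[of 1 T F] T by (simp add: X_def[abs_def])
  have Ym: "Y \<in> borel_measurable M"
    unfolding Y_def[abs_def]
    by (intro borel_measurable_prod measurable_compose[OF measurable_xi borel_measurable_continuous_onI] continuous_on_exp_window_mean)
      (use S in auto)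
  have B: "\<bar>exp (S * window_mean (1 / S) F \<beta>)\<bar> \<le> exp (S * norm F)" for \<beta>
    using exp_window_mean_bounds(2)[OF S] by simp
  have EY: "(LINT \<omega>|M. Y \<omega>) = Z S F ^ k"
    unfolding Y_def Z_def
    by (subst expectation_prod_xi[OF _ _ continuous_on_exp_window_mean B]) (use S in auto)
  have Ypos: "Y \<omega> > 0" for \<omega> by (auto simp: Y_def intro: prod_pos)
  have Xb: "\<bar>exp (X \<omega>)\<bar> \<le> exp (norm F * T)" if "\<omega> \<in> space M" for \<omega>
    using abs_integral_xi[OF that _ T, of 1 F] by (simp add: X_def)
  have Xi: "integrable M (\<lambda>\<omega>. exp (X \<omega>))"
    using Xm Xb by (intro integrable_bounded[where B = "exp (norm F * T)"]) auto
  have Yi: "integrable M Y"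
  proof (intro integrable_bounded[where B = "exp D * exp (norm F * T)"] Ym)
    fix \<omega> assume w: "\<omega> \<in> space M"
    have "Y \<omega> = exp D * (exp (- D) * Y \<omega>)" by (simp add: exp_minus)
    also have "\<dots> \<le> exp D * exp (norm F * T)"
      using Xb[OF w] by (intro mult_left_mono order_trans[OF XY(2)[OF w]]) auto
    finally show "\<bar>Y \<omega>\<bar> \<le> exp D * exp (norm F * T)" using Ypos[of \<omega>] by simp
  qed
  have EX: "(LINT \<omega>|M. exp (X \<omega>)) = Z (T + 1) F"
    using expectation_exp_integral[of 1 T F] T by (simp add: X_def)
  have 1: "Z (T + 1) F \<le> exp D * Z S F ^ k"
    unfolding EX[symmetric] EY[symmetric] integral_mult_right_zero[symmetric]
    by (intro integral_mono Xi integrable_mult_right Yi XY)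
  have 2: "exp (- D) * Z S F ^ k \<le> Z (T + 1) F"
    unfolding EX[symmetric] EY[symmetric] integral_mult_right_zero[symmetric]
    by (intro integral_mono Xi integrable_mult_right Yi XY)
  have pos: "Z S F > 0" "Z (T + 1) F > 0" using Z_pos S T by auto
  have "ln (Z (T + 1) F) \<le> ln (exp D * Z S F ^ k)"
    using 1 pos by (subst ln_le_cancel_iff) auto
  moreover have "ln (exp (- D) * Z S F ^ k) \<le> ln (Z (T + 1) F)"
    using 2 pos by (subst ln_le_cancel_iff) auto
  ultimately show ?thesis
    using pos by (simp add: ln_mult ln_realpow D_def)
qed

text \<open>With k the integer part of T / S, the uncovered length is at most S + T / S. Replacing k
  by T / S costs another S * norm F, since ln (Z S F) is at most S * norm F in absolute value.
  Division by T gives the bound.\<close>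

lemma Z_rate:
  assumes S: "1 \<le> S" and ST: "S \<le> T"
  shows "\<bar>log_mgf M W F T - ln (Z S F) / S\<bar> \<le> norm F * (1 / S + 2 * S / T)"
proof -
  define k where "k = nat \<lfloor>T / S\<rfloor>"
  have "T / S \<ge> 0" using S ST by simp
  then have k: "real k \<le> T / S" "T / S < real k + 1" by (auto simp: k_def)
  have k1: "S * real k \<le> T" using k S by (simp add: pos_le_divide_eq mult.commute)
  have k2: "T < S * real k + S" using k S by (simp add: pos_divide_less_eq algebra_simps)
  have T: "T > 0" using S ST by simp
  have "\<bar>ln (Z (T + 1) F) - real k * ln (Z S F)\<bar> \<le> norm F * (T - real k * (S - 1))"
    by (rule Z_almost_multiplicative[OF S k1])
  also have "\<dots> \<le> norm F * (S + T / S)"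
    using k1 k2 k by (intro mult_left_mono) (auto simp: algebra_simps)
  finally have 1: "\<bar>ln (Z (T + 1) F) - real k * ln (Z S F)\<bar> \<le> norm F * (S + T / S)" .
  have "\<bar>(real k * S - T) * ln (Z S F)\<bar> \<le> S * (S * norm F)"
    unfolding abs_mult using k1 k2 abs_ln_Z[OF S, of F] by (intro mult_mono) (auto simp: mult.commute)
  then have 2: "\<bar>(real k - T / S) * ln (Z S F)\<bar> \<le> S * norm F"
  proof -
    assume a: "\<bar>(real k * S - T) * ln (Z S F)\<bar> \<le> S * (S * norm F)"
    have "(real k - T / S) * ln (Z S F) = ((real k * S - T) * ln (Z S F)) / S"
      using S by (simp add: field_simps)
    then have "\<bar>(real k - T / S) * ln (Z S F)\<bar> = \<bar>(real k * S - T) * ln (Z S F)\<bar> / S"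
      using S by (simp add: abs_divide)
    also have "\<dots> \<le> S * (S * norm F) / S" using a S by (intro divide_right_mono) auto
    finally show ?thesis using S by simp
  qed
  have "\<bar>ln (Z (T + 1) F) - T / S * ln (Z S F)\<bar> \<le> norm F * (S + T / S) + S * norm F"
    using 1 2 by (simp add: left_diff_distrib)
  then have "\<bar>ln (Z (T + 1) F) - T / S * ln (Z S F)\<bar> / T \<le> (norm F * (S + T / S) + S * norm F) / T"
    using T by (intro divide_right_mono) auto
  also have "(norm F * (S + T / S) + S * norm F) / T = norm F * (1 / S + 2 * S / T)"
    using T S by (simp add: field_simps)
  also have "\<bar>ln (Z (T + 1) F) - T / S * ln (Z S F)\<bar> / T = \<bar>(ln (Z (T + 1) F) - T / S * ln (Z S F)) / T\<bar>"
    using T by (simp add: abs_divide)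
  also have "(ln (Z (T + 1) F) - T / S * ln (Z S F)) / T = log_mgf M W F T - ln (Z S F) / S"
    using T by (simp add: log_mgf_eq diff_divide_distrib)
  finally show ?thesis .
qed

text \<open>The error depends on F only through its norm. This uniformity matters in the lower
  bound, where the rate is applied to a tilt that depends on S.\<close>

lemma log_mgf_tendsto: "(log_mgf M W F \<longlongrightarrow> Lam M W F) at_top"
  and Lam_rate: "1 \<le> S \<Longrightarrow> \<bar>Lam M W F - ln (Z S F) / S\<bar> \<le> norm F / S"
proof -
  obtain l where l: "(log_mgf M W F \<longlongrightarrow> l) at_top" "\<And>S. 1 \<le> S \<Longrightarrow> \<bar>l - ln (Z S F) / S\<bar> \<le> norm F / S"
    using almost_additive_limit[of "log_mgf M W F" "\<lambda>S. ln (Z S F) / S" "norm F"] Z_rate by blast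
  have "Lam M W F = l"
    unfolding Lam_def by (rule tendsto_Lim[OF _ l(1)]) simp
  with l show "(log_mgf M W F \<longlongrightarrow> Lam M W F) at_top" "1 \<le> S \<Longrightarrow> \<bar>Lam M W F - ln (Z S F) / S\<bar> \<le> norm F / S"
    by auto
qed

text \<open>Windows whose starting points differ by integers are independent, so averaging over the
  fractional part of the starting point and convexity of \<open>exp\<close> reduce to independent samples.\<close>

lemma Z_le_power: "Z (real n + 1) F \<le> (LINT \<beta>|wiener. exp (apply_bcontfun F \<beta>)) ^ n"
proof -
  define f where "f \<omega> t = apply_bcontfun F (xi W 1 t \<omega>)" for \<omega> t
  define R where "R N \<omega> = exp ((\<Sum>q<n * Suc N. f \<omega> (real q / real (Suc N))) / real (Suc N))" for N \<omega>
  have fm: "(\<lambda>\<omega>. f \<omega> t) \<in> borel_measurable M" if "t \<ge> 0" for t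
    unfolding f_def using that
    by (intro measurable_compose[OF measurable_xi borel_measurable_continuous_onI] continuous_on_apply_bcontfun) auto
  have fb: "\<bar>f \<omega> t\<bar> \<le> norm F" for \<omega> t by (simp add: f_def abs_apply_le)
  have Rm: "R N \<in> borel_measurable M" for N
    unfolding R_def[abs_def]
    by (intro borel_measurable_exp borel_measurable_divide borel_measurable_sum borel_measurable_const measurable_compose[OF _ borel_measurable_exp] fm) auto
  have Rb: "\<bar>R N \<omega>\<bar> \<le> exp (real n * norm F)" for N \<omega>
  proof -
    have "(\<Sum>q<n * Suc N. f \<omega> (real q / real (Suc N))) \<le> (\<Sum>q<n * Suc N. norm F)"
      using fb by (intro sum_mono) (auto simp: abs_le_iff)
    also have "\<dots> = real n * norm F * real (Suc N)" by (simp add: algebra_simps)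
    finally show ?thesis by (simp add: R_def divide_le_eq)
  qed
  have lim: "(\<lambda>N. LINT \<omega>|M. R N \<omega>) \<longlonglongrightarrow> (LINT \<omega>|M. exp (LINT t:{0..real n}|lborel. f \<omega> t))"
  proof (rule integral_dominated_convergence[where w = "\<lambda>_. exp (real n * norm F)"])
    show "(\<lambda>\<omega>. exp (LINT t:{0..real n}|lborel. f \<omega> t)) \<in> borel_measurable M"
      using measurable_integral_xi[of 1 "real n" F] by (simp add: f_def)
    show "AE \<omega> in M. (\<lambda>N. R N \<omega>) \<longlonglongrightarrow> exp (LINT t:{0..real n}|lborel. f \<omega> t)"
      unfolding R_def f_def
      by (intro AE_I2 tendsto_exp riemann_sum_tendsto continuous_on_xi_Icc) auto
  qed (use Rm Rb in auto)
  have "(LINT \<omega>|M. R N \<omega>) \<le> (LINT \<beta>|wiener. exp (apply_bcontfun F \<beta>)) ^ n" for N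
  proof -
    define Q where "Q i \<omega> = (\<Prod>m<n. exp (apply_bcontfun F (xi W 1 (real i / real (Suc N) + 1 * real m) \<omega>)))" for i \<omega>
    have Qm: "Q i \<in> borel_measurable M" for i
      unfolding Q_def[abs_def]
      by (intro borel_measurable_prod measurable_compose[OF measurable_xi borel_measurable_continuous_onI]
          continuous_on_exp continuous_on_apply_bcontfun) auto
    have Qb: "\<bar>Q i \<omega>\<bar> \<le> exp (norm F) ^ n" for i \<omega>
    proof -
      have "\<bar>Q i \<omega>\<bar> \<le> (\<Prod>m<n. exp (norm F))"
        unfolding Q_def abs_prod using abs_apply_le[of F] by (intro prod_mono) (auto simp: abs_le_iff)
      then show ?thesis by simp
    qed
    have Qi: "integrable M (Q i)" for i
      by (rule integrable_bounded[OF Qm Qb])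
    have EQ: "(LINT \<omega>|M. Q i \<omega>) = (LINT \<beta>|wiener. exp (apply_bcontfun F \<beta>)) ^ n" for i
      unfolding Q_def using abs_apply_le[of F]
      by (subst expectation_prod_xi[where B = "exp (norm F)"])
        (auto intro!: continuous_on_exp continuous_on_apply_bcontfun simp: abs_le_iff)
    have "R N \<omega> \<le> (\<Sum>i<Suc N. Q i \<omega>) / real (Suc N)" for \<omega>
    proof -
      \<comment> \<open>Writing q = m * (N + 1) + i puts the points i / (N + 1) + m with a common
        fractional part into one class. Exponentials of class sums are the products
        \<open>Q i\<close>, and convexity is applied to the average over i.\<close>
      have "(\<Sum>q<n * Suc N. f \<omega> (real q / real (Suc N))) = (\<Sum>m<n. \<Sum>i<Suc N. f \<omega> (real (m * Suc N + i) / real (Suc N)))"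
      proof -
        have "sum g {m * k..<m * k + k} = (\<Sum>i<k. g (m * k + i))" for g :: "nat \<Rightarrow> real" and m k
          using sum.shift_bounds_nat_ivl[of g 0 "m * k" k] by (simp add: atLeast0LessThan add.commute)
        then show ?thesis unfolding sum.nat_group[symmetric] by (simp only:)
      qed
      also have "\<dots> = (\<Sum>i<Suc N. \<Sum>m<n. f \<omega> (real (m * Suc N + i) / real (Suc N)))"
        by (rule sum.swap)
      also have "\<dots> = (\<Sum>i<Suc N. \<Sum>m<n. f \<omega> (real i / real (Suc N) + 1 * real m))"
      proof -
        have "real (m * Suc N + i) / real (Suc N) = real i / real (Suc N) + 1 * real m" for m i
          unfolding of_nat_add of_nat_mult add_divide_distrib by (simp del: of_nat_Suc)
        then show ?thesis by simp
      qed
      finally have eq: "(\<Sum>q<n * Suc N. f \<omega> (real q / real (Suc N))) = \<dots>" .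
      show ?thesis
        unfolding R_def eq using exp_mean_le[of "Suc N" "\<lambda>i. \<Sum>m<n. f \<omega> (real i / real (Suc N) + 1 * real m)"]
        by (simp add: Q_def f_def exp_sum)
    qed
    then have "(LINT \<omega>|M. R N \<omega>) \<le> (LINT \<omega>|M. (\<Sum>i<Suc N. Q i \<omega>) / real (Suc N))"
      by (intro integral_mono integrable_bounded[OF Rm Rb] integrable_divide Bochner_Integration.integrable_sum Qi)
    also have "\<dots> = (\<Sum>i<Suc N. LINT \<omega>|M. Q i \<omega>) / real (Suc N)"
      by (simp only: integral_divide_zero Bochner_Integration.integral_sum[OF Qi])
    also have "\<dots> = (LINT \<beta>|wiener. exp (apply_bcontfun F \<beta>)) ^ n"
      by (simp only: EQ) (simp del: of_nat_Suc)
    finally show ?thesis .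
  qed
  then have "(LINT \<omega>|M. exp (LINT t:{0..real n}|lborel. f \<omega> t)) \<le> (LINT \<beta>|wiener. exp (apply_bcontfun F \<beta>)) ^ n"
    by (intro LIMSEQ_le_const2[OF lim]) auto
  then show ?thesis
    using expectation_exp_integral[of 1 "real n" F] by (simp add: f_def)
qed

text \<open>The gain is that the right-hand side involves a single Wiener path, so that dominated
  convergence controls it along bounded pointwise convergent sequences of F.\<close>

proposition Lam_le: "Lam M W F \<le> ln (LINT \<beta>|wiener. exp (apply_bcontfun F \<beta>))"
proof (rule tendsto_upperbound)
  show "(\<lambda>n. log_mgf M W F (real (Suc n))) \<longlonglongrightarrow> Lam M W F"
    using filterlim_compose[OF log_mgf_tendsto filterlim_real_sequentially] by (rule LIMSEQ_Suc)
  show "\<forall>\<^sub>F n in sequentially. log_mgf M W F (real (Suc n)) \<le> ln (LINT \<beta>|wiener. exp (apply_bcontfun F \<beta>))"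
  proof (intro always_eventually allI)
    fix n
    let ?E = "LINT \<beta>|wiener. exp (apply_bcontfun F \<beta>)"
    interpret w: prob_space wiener by (rule prob_space_wiener)
    have "integrable wiener (\<lambda>\<beta>. exp (apply_bcontfun F \<beta>))"
      using abs_apply_le[of F]
      by (intro integrable_wiener[where B = "exp (norm F)"] continuous_on_exp continuous_on_apply_bcontfun) (auto simp: abs_le_iff)
    then have "exp (- norm F) \<le> ?E"
      using abs_apply_le[of F] by (intro w.integral_ge_const) (auto simp: abs_le_iff minus_le_iff)
    then have E: "?E > 0" by (meson exp_gt_zero less_le_trans)
    have "ln (Z (real (Suc n) + 1) F) \<le> ln (?E ^ Suc n)"
      using Z_le_power[of "Suc n" F] Z_pos[of "real (Suc n) + 1" F] E by (subst ln_le_cancel_iff) auto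
    also have "\<dots> = real (Suc n) * ln ?E" using E by (subst ln_realpow) auto
    finally show "log_mgf M W F (real (Suc n)) \<le> ln ?E"
      by (simp add: log_mgf_eq divide_le_eq mult.commute del: of_nat_Suc)
  qed
qed simp

end

section \<open>Daniell's representation theorem on a metric space\<close>

lemma apply_Bcontfun:
  fixes f :: "'a::topological_space \<Rightarrow> real"
  assumes "continuous_on UNIV f" "\<And>x. \<bar>f x\<bar> \<le> b"
  shows "apply_bcontfun (Bcontfun f) = f"
  using assms by (intro Bcontfun_inverse bcontfun_normI[where b=b]) auto

text \<open>The last assumption is Daniell's continuity condition, which separates integrals from
  functionals that are only finitely additive.\<close>

locale daniell =
  fixes l :: "('a::metric_space \<Rightarrow>\<^sub>C real) \<Rightarrow> real"
  assumes add: "l (F + G) = l F + l G"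
    and scale: "l (c *\<^sub>R F) = c * l F"
    and nonneg: "(\<And>x. 0 \<le> apply_bcontfun F x) \<Longrightarrow> 0 \<le> l F"
    and one: "l (const_bcontfun 1) = 1"
    and monotone_tendsto: "(\<And>n x. 0 \<le> apply_bcontfun (H n) x) \<Longrightarrow>
      (\<And>n x. apply_bcontfun (H (Suc n)) x \<le> apply_bcontfun (H n) x) \<Longrightarrow>
      (\<And>x. (\<lambda>n. apply_bcontfun (H n) x) \<longlonglongrightarrow> 0) \<Longrightarrow> (\<lambda>n. l (H n)) \<longlonglongrightarrow> 0"
begin

lemma zero: "l 0 = 0"
  using scale[of 0 0] by simp

lemma diff: "l (F - G) = l F - l G"
  using add[of F "(-1) *\<^sub>R G"] scale[of "-1" G] by simp

lemma mono: "(\<And>x. apply_bcontfun F x \<le> apply_bcontfun G x) \<Longrightarrow> l F \<le> l G"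
  using nonneg[of "G - F"] by (simp add: diff)

lemma sum: "l (\<Sum>i\<in>A. F i) = (\<Sum>i\<in>A. l (F i))"
  by (induction A rule: infinite_finite_induct) (auto simp: zero add)

text \<open>Functions take the place of covering sets: the sum dominates the indicator of A. Sums
  are taken in \<open>ennreal\<close> because they may diverge.\<close>

definition covers :: "'a set \<Rightarrow> (nat \<Rightarrow> 'a \<Rightarrow>\<^sub>C real) \<Rightarrow> bool" where
  "covers A F \<longleftrightarrow> (\<forall>n x. 0 \<le> apply_bcontfun (F n) x) \<and> (\<forall>x\<in>A. 1 \<le> (\<Sum>n. ennreal (apply_bcontfun (F n) x)))"

definition outer :: "'a set \<Rightarrow> ennreal" where
  "outer A = (INF F\<in>Collect (covers A). \<Sum>n. ennreal (l (F n)))"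

lemma outer_le: "covers A F \<Longrightarrow> outer A \<le> (\<Sum>n. ennreal (l (F n)))"
  unfolding outer_def by (intro INF_lower) auto

lemma outer_le_single:
  assumes "\<And>x. 0 \<le> apply_bcontfun F x" "\<And>x. x \<in> A \<Longrightarrow> 1 \<le> apply_bcontfun F x"
  shows "outer A \<le> ennreal (l F)"
proof -
  let ?F = "\<lambda>n::nat. if n = 0 then F else 0"
  have s: "(\<Sum>n. ennreal (apply_bcontfun (?F n) x)) = ennreal (apply_bcontfun F x)" for x
    by (subst suminf_finite[of "{0}"]) auto
  have "covers A ?F"
    using assms ennreal_leI[OF assms(2)] unfolding covers_def s by auto
  from outer_le[OF this] show ?thesis
    by (subst (asm) suminf_finite[of "{0}"]) (auto simp: zero)
qed

lemma outer_approx: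
  assumes "outer A < top" "e > 0"
  obtains F where "covers A F" "(\<Sum>n. ennreal (l (F n))) \<le> outer A + ennreal e"
proof -
  have "outer A < outer A + ennreal e" using assms by (simp add: ennreal_add_left_cancel_less[of _ 0, simplified] less_top)
  then obtain F where "covers A F" "(\<Sum>n. ennreal (l (F n))) < outer A + ennreal e"
    unfolding outer_def INF_less_iff by auto
  then show ?thesis using that by (auto intro: less_imp_le)
qed

lemma suminf_half_powers:
  assumes "e \<ge> 0"
  shows "(\<Sum>n. ennreal (e * (1/2) ^ Suc n)) = ennreal e"
proof -
  have "(\<lambda>n. e * (1/2) ^ Suc n) sums (e * 1)"
    by (intro sums_mult power_half_series)
  then show ?thesis using assms by (intro suminf_ennreal_eq) auto
qed

lemma suminf_add_half_powers:
  assumes "e \<ge> 0"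
  shows "(\<Sum>n. a n + ennreal (e * (1/2) ^ Suc n)) = (\<Sum>n. a n) + ennreal e"
  unfolding suminf_half_powers[OF assms, symmetric] by (rule suminf_add[symmetric]) auto

lemma outer_subadditive: "outer (\<Union>i. A i) \<le> (\<Sum>i. outer (A i))"
proof (rule ennreal_le_epsilon)
  fix e :: real assume e: "0 < e" and fin: "(\<Sum>i. outer (A i)) < top"
  have "\<exists>F. covers (A i) F \<and> (\<Sum>n. ennreal (l (F n))) \<le> outer (A i) + ennreal (e * (1/2) ^ Suc i)" for i
  proof -
    have "e * (1/2) ^ Suc i > 0" using e by simp
    from outer_approx[OF ennreal_suminf_lessD[OF fin] this, of i] show ?thesis by blast
  qed
  then obtain F where F: "\<And>i. covers (A i) (F i)"
    and Fl: "\<And>i. (\<Sum>n. ennreal (l (F i n))) \<le> outer (A i) + ennreal (e * (1/2) ^ Suc i)" by metis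
  let ?H = "\<lambda>p. F (fst p) (snd p)"
  have "covers (\<Union>i. A i) (\<lambda>m. ?H (prod_decode m))"
    unfolding covers_def
  proof (intro conjI allI ballI)
    show "0 \<le> apply_bcontfun (?H (prod_decode m)) x" for m x using F by (auto simp: covers_def)
    fix x assume "x \<in> (\<Union>i. A i)"
    then obtain i where i: "x \<in> A i" by auto
    have "1 \<le> (\<Sum>n. ennreal (apply_bcontfun (F i n) x))" using F i by (auto simp: covers_def)
    also have "\<dots> \<le> (\<Sum>i. \<Sum>n. ennreal (apply_bcontfun (F i n) x))"
      using sum_le_suminf[of "\<lambda>i. \<Sum>n. ennreal (apply_bcontfun (F i n) x)" "{i}"] by auto
    also have "\<dots> = (\<Sum>m. ennreal (apply_bcontfun (?H (prod_decode m)) x))"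
      by (rule suminf_ennreal_2dimen[symmetric, where f="\<lambda>p. ennreal (apply_bcontfun (?H p) x)"]) simp
    finally show "1 \<le> (\<Sum>m. ennreal (apply_bcontfun (?H (prod_decode m)) x))" .
  qed
  then have "outer (\<Union>i. A i) \<le> (\<Sum>m. ennreal (l (?H (prod_decode m))))" by (rule outer_le)
  also have "\<dots> = (\<Sum>i. \<Sum>n. ennreal (l (F i n)))"
    by (rule suminf_ennreal_2dimen[where f="\<lambda>p. ennreal (l (?H p))"]) simp
  also have "\<dots> \<le> (\<Sum>i. outer (A i) + ennreal (e * (1/2) ^ Suc i))"
    by (intro suminf_le Fl) auto
  also have "\<dots> = (\<Sum>i. outer (A i)) + ennreal e"
    using e by (intro suminf_add_half_powers) simp
  finally show "outer (\<Union>i. A i) \<le> (\<Sum>i. outer (A i)) + ennreal e" .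
qed

lemma outer_empty: "outer {} = 0"
  using outer_le_single[of 0 "{}"] by (simp add: zero)

lemma outer_mono: "A \<subseteq> B \<Longrightarrow> outer A \<le> outer B"
  unfolding outer_def covers_def by (intro INF_superset_mono) auto

lemma outer_measure_space_outer: "outer_measure_space (Pow UNIV) outer"
  unfolding outer_measure_space_def positive_def increasing_def countably_subadditive_def
  using outer_empty outer_mono outer_subadditive by auto

text \<open>Multiplying a covering by the functions \<open>g k\<close>, which decrease to the indicator of the closed
  set \<open>C\<close>, covers the part of the set inside \<open>C\<close>; the differences \<open>g k - g (k + 1)\<close> cover the part
  outside.\<close>

lemma closed_in_lambda_system:
  assumes C: "closed C"
  shows "C \<in> lambda_system UNIV (Pow UNIV) outer"
proof (cases "C = {}")
  case True
  then show ?thesis by (simp add: lambda_system_def outer_empty)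
next
  case False
  define g where "g k x = max 0 (1 - real k * infdist x C)" for k x
  have g: "0 \<le> g k x" "g k x \<le> 1" "g 0 x = 1" "g (Suc k) x \<le> g k x" for k x
  proof -
    have "real k * infdist x C \<le> real (Suc k) * infdist x C" "0 \<le> real k * infdist x C"
      by (intro mult_right_mono) (auto simp: infdist_nonneg)
    then show "0 \<le> g k x" "g k x \<le> 1" "g 0 x = 1" "g (Suc k) x \<le> g k x"
      unfolding g_def by linarith+
  qed
  have gC: "g k x = 1" if "x \<in> C" for k x using that by (simp add: g_def)
  have gcont: "continuous_on UNIV (g k)" for k
    unfolding g_def by (intro continuous_intros)
  have glim: "(\<lambda>k. g k x) \<longlonglongrightarrow> 0" if "x \<notin> C" for x
  proof (rule tendsto_eventually)
    have "infdist x C > 0"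
      using in_closed_iff_infdist_zero[OF C False] that infdist_nonneg[of x C] by (metis less_eq_real_def)
    then obtain k0 where k0: "1 < real k0 * infdist x C" using reals_Archimedean3 by blast
    show "\<forall>\<^sub>F k in sequentially. g k x = 0"
      using eventually_ge_at_top[of k0]
    proof eventually_elim
      case (elim k)
      then have "real k0 * infdist x C \<le> real k * infdist x C"
        by (intro mult_right_mono infdist_nonneg) auto
      then show ?case using k0 by (simp add: g_def)
    qed
  qed
  have sub: "outer (C \<inter> A) + outer (A - C) \<le> (\<Sum>n. ennreal (l (F n)))" if F: "covers A F" for A F
  proof (rule ennreal_le_epsilon)
    fix e :: real assume e: "0 < e"
    have F0: "0 \<le> apply_bcontfun (F n) x" for n x using F by (simp add: covers_def)
    define P where "P n k = Bcontfun (\<lambda>x. apply_bcontfun (F n) x * g k x)" for n k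
    have P: "apply_bcontfun (P n k) x = apply_bcontfun (F n) x * g k x" for n k x
    proof -
      have "continuous_on UNIV (\<lambda>x. apply_bcontfun (F n) x * g k x)"
        by (intro continuous_intros gcont continuous_on_apply_bcontfun)
      moreover have "\<bar>apply_bcontfun (F n) x * g k x\<bar> \<le> norm (F n) * 1" for x
        unfolding abs_mult using g by (intro mult_mono) (auto simp: abs_apply_le)
      ultimately show ?thesis unfolding P_def by (subst apply_Bcontfun[where b="norm (F n)"]) auto
    qed
    have P0: "P n 0 = F n" for n by (rule bcontfun_eqI) (simp add: P g)
    have Pdec: "l (P n (Suc k)) \<le> l (P n k)" for n k
      by (rule mono) (simp add: P mult_left_mono g F0)
    have Pnn: "0 \<le> l (P n k)" for n k by (rule nonneg) (simp add: P g F0)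
    \<comment> \<open>\<open>L n\<close> is the share of \<open>l (F n)\<close> carried by C. The
      limit in k need not be attained, so the cover of C \<inter> A stops at an index
      \<open>K n\<close> with error e / 2^(n+1).\<close>
    define L where "L n = (INF k. l (P n k))" for n
    have PL: "(\<lambda>k. l (P n k)) \<longlonglongrightarrow> L n" for n
      unfolding L_def using Pdec Pnn by (intro LIMSEQ_decseq_INF decseq_SucI bdd_belowI2[where m=0]) auto
    have "\<exists>k. l (P n k) < L n + e * (1/2) ^ Suc n" for n
      using order_tendstoD(2)[OF PL, of n "L n + e * (1/2) ^ Suc n"] e eventually_sequentially by auto
    then obtain K where K: "\<And>n. l (P n (K n)) < L n + e * (1/2) ^ Suc n" by metis
    have L: "0 \<le> L n" "L n \<le> l (F n)" for n
      using LIMSEQ_le_const[OF PL, of 0 n] Pnn LIMSEQ_le_const2[OF PL, of n "l (F n)"] decseq_SucI[of "\<lambda>k. l (P n k)"] Pdec P0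
      by (auto simp: decseq_def) (metis le0)
    have "covers (C \<inter> A) (\<lambda>n. P n (K n))"
      using F by (auto simp: covers_def P gC g)
    then have 1: "outer (C \<inter> A) \<le> (\<Sum>n. ennreal (l (P n (K n))))" by (rule outer_le)
    \<comment> \<open>For the part outside C all differences are used; they telescope to
      \<open>l (F n) - L n\<close>, so both covers together cost no more than the original one plus
      e.\<close>
    define H where "H p = P (fst p) (snd p) - P (fst p) (Suc (snd p))" for p :: "nat \<times> nat"
    have Hx: "apply_bcontfun (H (n, k)) x = apply_bcontfun (F n) x * (g k x - g (Suc k) x)" for n k x
      by (simp add: H_def P right_diff_distrib)
    have Hnn: "0 \<le> apply_bcontfun (H p) x" for p x
      using Hx[of "fst p" "snd p" x] F0 g(4) by simp
    have tele: "(\<Sum>k. ennreal (apply_bcontfun (H (n, k)) x)) = ennreal (apply_bcontfun (F n) x)" if "x \<notin> C" for n x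
    proof -
      have "(\<lambda>k. g k x - g (Suc k) x) sums (g 0 x - 0)"
        by (rule telescope_sums'[OF glim[OF that]])
      from sums_mult[OF this, of "apply_bcontfun (F n) x"]
      have "(\<lambda>k. apply_bcontfun (H (n, k)) x) sums apply_bcontfun (F n) x"
        by (simp add: Hx g)
      then show ?thesis using Hnn by (intro suminf_ennreal_eq) auto
    qed
    have "covers (A - C) (\<lambda>m. H (prod_decode m))"
      unfolding covers_def
    proof (intro conjI allI ballI)
      fix x assume x: "x \<in> A - C"
      then have "1 \<le> (\<Sum>n. ennreal (apply_bcontfun (F n) x))" using F by (auto simp: covers_def)
      also have "\<dots> = (\<Sum>m. ennreal (apply_bcontfun (H (prod_decode m)) x))"
        using x by (intro suminf_ennreal_2dimen[symmetric, where f="\<lambda>p. ennreal (apply_bcontfun (H p) x)"]) (simp add: tele)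
      finally show "1 \<le> (\<Sum>m. ennreal (apply_bcontfun (H (prod_decode m)) x))" .
    qed (rule Hnn)
    then have "outer (A - C) \<le> (\<Sum>m. ennreal (l (H (prod_decode m))))" by (rule outer_le)
    also have "\<dots> = (\<Sum>n. ennreal (l (F n) - L n))"
    proof (rule suminf_ennreal_2dimen[where f="\<lambda>p. ennreal (l (H p))"])
      fix n
      have "(\<lambda>k. l (P n k) - l (P n (Suc k))) sums (l (P n 0) - L n)"
        by (rule telescope_sums'[OF PL])
      then have "(\<lambda>k. l (H (n, k))) sums (l (F n) - L n)"
        by (simp add: H_def diff P0)
      then show "ennreal (l (F n) - L n) = (\<Sum>k. ennreal (l (H (n, k))))"
        using nonneg[OF Hnn] by (intro suminf_ennreal_eq[symmetric]) auto
    qed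
    finally have "outer (C \<inter> A) + outer (A - C) \<le> (\<Sum>n. ennreal (l (P n (K n)))) + (\<Sum>n. ennreal (l (F n) - L n))"
      using 1 by (intro add_mono)
    also have "\<dots> = (\<Sum>n. ennreal (l (P n (K n))) + ennreal (l (F n) - L n))"
      by (rule suminf_add) auto
    also have "\<dots> \<le> (\<Sum>n. ennreal (l (F n)) + ennreal (e * (1/2) ^ Suc n))"
    proof (intro suminf_le)
      fix n
      have "l (F n) \<ge> 0" using F0 by (rule nonneg)
      then show "ennreal (l (P n (K n))) + ennreal (l (F n) - L n) \<le> ennreal (l (F n)) + ennreal (e * (1/2) ^ Suc n)"
        using K[of n] L[of n] Pnn[of n "K n"] e by (simp flip: ennreal_plus) 
    qed auto
    also have "\<dots> = (\<Sum>n. ennreal (l (F n))) + ennreal e"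
      using e by (intro suminf_add_half_powers) simp
    finally show "outer (C \<inter> A) + outer (A - C) \<le> (\<Sum>n. ennreal (l (F n))) + ennreal e" .
  qed
  have "outer (C \<inter> A) + outer (A - C) = outer A" for A
  proof (rule antisym)
    show "outer (C \<inter> A) + outer (A - C) \<le> outer A"
      unfolding outer_def[of A] using sub by (intro INF_greatest) auto
    interpret sigma_algebra UNIV "Pow UNIV :: 'a set set" by (rule sigma_algebra_Pow)
    have "subadditive (Pow UNIV) outer"
      using outer_measure_space_outer unfolding outer_measure_space_def
      by (blast intro: countably_subadditive_subadditive)
    from subadditiveD[OF this, of "C \<inter> A" "A - C"] show "outer A \<le> outer (C \<inter> A) + outer (A - C)"
      by (simp add: Int_Diff_disjoint Int_Diff_Un Int_commute[of C])
  qed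
  then show ?thesis
    by (auto simp: lambda_system_def Int_commute Diff_eq)
qed

definition rep :: "'a measure" where
  "rep = measure_of UNIV (sets borel) outer"

lemma sets_rep [simp, measurable_cong]: "sets rep = sets borel"
  unfolding rep_def by (metis sets.sigma_sets_eq sets_measure_of space_borel top_greatest Pow_UNIV)

lemma space_rep [simp]: "space rep = UNIV"
  by (metis sets_rep sets_eq_imp_space_eq space_borel)

lemma emeasure_rep:
  assumes "A \<in> sets borel"
  shows "emeasure rep A = outer A"
proof -
  interpret sigma_algebra UNIV "Pow UNIV :: 'a set set" by (rule sigma_algebra_Pow)
  have ms: "measure_space UNIV (lambda_system UNIV (Pow UNIV) outer) outer"
    by (rule caratheodory_lemma[OF outer_measure_space_outer])
  then interpret L: sigma_algebra UNIV "lambda_system UNIV (Pow UNIV) outer"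
    by (simp add: measure_space_def)
  have "sets (borel :: 'a measure) = sigma_sets UNIV {C. closed C}"
    by (simp add: borel_eq_closed)
  also have "\<dots> \<subseteq> lambda_system UNIV (Pow UNIV) outer"
    by (intro L.sigma_sets_subset) (use closed_in_lambda_system in blast)
  finally have sub: "sets (borel :: 'a measure) \<subseteq> lambda_system UNIV (Pow UNIV) outer" .
  show ?thesis
    unfolding rep_def
  proof (rule emeasure_measure_of_sigma)
    show "sigma_algebra UNIV (sets (borel :: 'a measure))"
      using sets.sigma_algebra_axioms[of "borel :: 'a measure"] by simp
    show "positive (sets borel) outer" by (simp add: positive_def outer_empty)
    show "countably_additive (sets borel) outer"
      using ms sub unfolding measure_space_def countably_additive_def by blast
  qed fact
qed

text \<open>Daniell's condition enters here: the deficits max 0 (1 - s N) of the partial sums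
  decrease to 0 pointwise, so their values under l vanish in the limit and a cover of the whole
  space costs at least 1.\<close>

lemma outer_UNIV: "outer UNIV = 1"
proof (rule antisym)
  show "outer UNIV \<le> 1"
    using outer_le_single[of "const_bcontfun 1" UNIV] by (simp add: one const_bcontfun.rep_eq)
  show "1 \<le> outer UNIV"
    unfolding outer_def
  proof (rule INF_greatest)
    fix F assume "F \<in> Collect (covers UNIV)"
    then have F0: "0 \<le> apply_bcontfun (F n) x" and F1: "1 \<le> (\<Sum>n. ennreal (apply_bcontfun (F n) x))" for n x
      by (auto simp: covers_def)
    define s where "s N x = (\<Sum>n<N. apply_bcontfun (F n) x)" for N x
    have s: "0 \<le> s N x" "s N x \<le> s (Suc N) x" for N x by (auto simp: s_def F0 sum_nonneg)
    define G where "G N = Bcontfun (\<lambda>x. max 0 (1 - s N x))" for N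
    have G: "apply_bcontfun (G N) x = max 0 (1 - s N x)" for N x
    proof -
      have "continuous_on UNIV (\<lambda>x. max 0 (1 - s N x))"
        unfolding s_def by (intro continuous_intros continuous_on_apply_bcontfun)
      moreover have "\<bar>max 0 (1 - s N x)\<bar> \<le> 1" for x using s[of N x] by auto
      ultimately show ?thesis unfolding G_def by (subst apply_Bcontfun[where b=1]) auto
    qed
    have "(\<lambda>N. l (G N)) \<longlonglongrightarrow> 0"
    proof (rule monotone_tendsto)
      show "0 \<le> apply_bcontfun (G N) x" "apply_bcontfun (G (Suc N)) x \<le> apply_bcontfun (G N) x" for N x
        unfolding G using s(1)[of N x] s(2)[of N x] by linarith+
      show "(\<lambda>N. apply_bcontfun (G N) x) \<longlonglongrightarrow> 0" for x
      proof (rule order_tendstoI)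
        fix e :: real assume e: "0 < e"
        have "(\<lambda>N. \<Sum>n<N. ennreal (apply_bcontfun (F n) x)) \<longlonglongrightarrow> (\<Sum>n. ennreal (apply_bcontfun (F n) x))"
          by (intro summable_LIMSEQ) auto
        then have "(\<lambda>N. ennreal (s N x)) \<longlonglongrightarrow> (\<Sum>n. ennreal (apply_bcontfun (F n) x))"
          by (simp add: s_def F0 sum_ennreal)
        moreover have "ennreal (1 - e) < (\<Sum>n. ennreal (apply_bcontfun (F n) x))"
          using e F1[of x] by (metis diff_less_eq ennreal_1 ennreal_lessI less_add_same_cancel1 less_le_trans zero_less_one)
        ultimately have "\<forall>\<^sub>F N in sequentially. ennreal (1 - e) < ennreal (s N x)"
          by (rule order_tendstoD(1))
        then show "\<forall>\<^sub>F N in sequentially. apply_bcontfun (G N) x < e"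
        proof eventually_elim
          case (elim N)
          then have "1 - e < s N x" using s(1)[of N x] by (metis ennreal_leI not_less)
          then show ?case using e by (simp add: G)
        qed
      qed (auto simp: G intro!: always_eventually)
    qed
    from tendsto_add[OF tendsto_ennrealI[OF this] tendsto_const[of "\<Sum>n. ennreal (l (F n))"]]
    have lim: "(\<lambda>N. ennreal (l (G N)) + (\<Sum>n. ennreal (l (F n)))) \<longlonglongrightarrow> (\<Sum>n. ennreal (l (F n)))" by simp
    show "1 \<le> (\<Sum>n. ennreal (l (F n)))"
    proof (rule LIMSEQ_le_const[OF lim], intro exI allI impI)
      fix N
      have "1 = l (const_bcontfun 1)" by (simp add: one)
      also have "\<dots> \<le> l (G N + (\<Sum>n<N. F n))"
        by (rule mono) (simp add: G apply_bcontfun_sum s_def const_bcontfun.rep_eq)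
      also have "\<dots> = l (G N) + (\<Sum>n<N. l (F n))" by (simp add: add sum)
      finally have "1 \<le> ennreal (l (G N) + (\<Sum>n<N. l (F n)))"
        by (metis ennreal_1 ennreal_leI)
      also have "\<dots> = ennreal (l (G N)) + (\<Sum>n<N. ennreal (l (F n)))"
        using nonneg[of "G N"] nonneg[OF F0] by (simp add: G ennreal_plus sum_nonneg sum_ennreal)
      also have "\<dots> \<le> ennreal (l (G N)) + (\<Sum>n. ennreal (l (F n)))"
        by (intro add_left_mono sum_le_suminf) auto
      finally show "1 \<le> ennreal (l (G N)) + (\<Sum>n. ennreal (l (F n)))" .
    qed
  qed
qed

lemma prob_space_rep: "prob_space rep"
  by standard (simp add: emeasure_rep outer_UNIV)

lemma measure_rep_le:
  assumes "A \<in> sets borel" "\<And>x. 0 \<le> apply_bcontfun F x" "\<And>x. x \<in> A \<Longrightarrow> 1 \<le> apply_bcontfun F x"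
  shows "measure rep A \<le> l F"
  using outer_le_single[OF assms(2,3)] nonneg[OF assms(2)] emeasure_rep[OF assms(1)]
  by (metis enn2real_leI measure_def)

lemma integrable_rep:
  fixes F :: "'a \<Rightarrow>\<^sub>C real"
  shows "integrable rep (apply_bcontfun F)"
proof -
  interpret prob_space rep by (rule prob_space_rep)
  show ?thesis
    using borel_measurable_continuous_onI[OF continuous_on_apply_bcontfun[of UNIV F]] abs_apply_le[of F]
    by (intro integrable_const_bound[where B="norm F"]) auto
qed

text \<open>N * F is cut into the slices \<open>G i\<close> between heights i and i + 1. Where slice
  i + 1 is positive, slice i equals 1, so the integral of \<open>G (Suc i)\<close> is at most the
  measure of that set and hence at most \<open>l (G i)\<close>. Shifting the index by one costs 1 /
  N after division.\<close>

lemma integral_rep_le_unit: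
  assumes F: "\<And>x. 0 \<le> apply_bcontfun F x" "\<And>x. apply_bcontfun F x \<le> 1"
  shows "(LINT x|rep. apply_bcontfun F x) \<le> l F"
proof (rule field_le_epsilon)
  fix e :: real assume "0 < e"
  then obtain n where n: "1 / real (Suc n) < e" using nat_approx_posE by blast
  define N where "N = Suc n"
  have N: "N > 0" by (simp add: N_def)
  define c where "c i x = max 0 (min 1 (real N * apply_bcontfun F x - real i))" for i x
  define G where "G i = Bcontfun (c i)" for i
  have G: "apply_bcontfun (G i) x = c i x" for i x
  proof -
    have "continuous_on UNIV (c i)"
      unfolding c_def by (intro continuous_intros continuous_on_apply_bcontfun)
    moreover have "\<bar>c i x\<bar> \<le> 1" for x by (auto simp: c_def)
    ultimately show ?thesis unfolding G_def by (subst apply_Bcontfun[where b=1]) auto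
  qed
  have clip: "(\<Sum>i<m. max 0 (min 1 (y - real i))) = min (real m) y" if "0 \<le> y" for m y
    using that by (induction m) (auto simp: max_def min_def)
  have GF: "(\<Sum>i<N. G i) = real N *\<^sub>R F"
  proof (rule bcontfun_eqI)
    fix x
    have "real N * apply_bcontfun F x \<le> real N" using F by (simp add: mult_left_le)
    then show "apply_bcontfun (\<Sum>i<N. G i) x = apply_bcontfun (real N *\<^sub>R F) x"
      using F clip[of "real N * apply_bcontfun F x" N] by (simp add: apply_bcontfun_sum G c_def)
  qed
  interpret prob_space rep by (rule prob_space_rep)
  have S: "(LINT x|rep. apply_bcontfun (G (Suc i)) x) \<le> l (G i)" for i
  proof -
    let ?A = "{x. apply_bcontfun (G (Suc i)) x > 0}"
    have A: "?A \<in> sets borel"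
      by (intro borel_open open_Collect_less continuous_intros continuous_on_apply_bcontfun)
    have "(LINT x|rep. apply_bcontfun (G (Suc i)) x) \<le> (LINT x|rep. indicator ?A x)"
    proof (rule integral_mono[OF integrable_rep])
      show "integrable rep (indicator ?A :: 'a \<Rightarrow> real)"
        using A by (intro integrable_real_indicator) (simp_all add: emeasure_eq_measure)
      have "c (Suc i) x \<le> 1" for x by (simp add: c_def)
      then show "apply_bcontfun (G (Suc i)) x \<le> indicator ?A x" for x
        unfolding indicator_def G by simp
    qed
    also have "\<dots> = measure rep ?A" using A by simp
    also have "\<dots> \<le> l (G i)"
    proof (rule measure_rep_le[OF A])
      show "0 \<le> apply_bcontfun (G i) x" for x by (simp add: G c_def)
      show "1 \<le> apply_bcontfun (G i) x" if "x \<in> ?A" for x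
      proof -
        have "real N * apply_bcontfun F x > real (Suc i)"
          using that unfolding G c_def mem_Collect_eq by linarith
        then show ?thesis unfolding G c_def by linarith
      qed
    qed
    finally show ?thesis .
  qed
  have Z: "(LINT x|rep. apply_bcontfun (G 0) x) \<le> 1"
    by (intro integral_le_const integrable_rep) (auto simp: G c_def)
  have "real N * (LINT x|rep. apply_bcontfun F x) = (LINT x|rep. apply_bcontfun (real N *\<^sub>R F) x)" by simp
  also have "\<dots> = (\<Sum>i<N. LINT x|rep. apply_bcontfun (G i) x)"
    unfolding GF[symmetric] apply_bcontfun_sum by (intro Bochner_Integration.integral_sum integrable_rep)
  also have "\<dots> = (LINT x|rep. apply_bcontfun (G 0) x) + (\<Sum>i<n. LINT x|rep. apply_bcontfun (G (Suc i)) x)"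
    unfolding N_def by (rule sum.lessThan_Suc_shift)
  also have "\<dots> \<le> 1 + (\<Sum>i<n. l (G i))"
    by (intro add_mono Z sum_mono S)
  also have "\<dots> \<le> 1 + (\<Sum>i<N. l (G i))"
    using nonneg[of "G n"] by (simp add: N_def G c_def)
  also have "\<dots> = 1 + real N * l F"
    by (simp add: GF sum[symmetric] scale)
  finally have "(LINT x|rep. apply_bcontfun F x) \<le> 1 / real N + l F"
    using N by (simp add: field_simps)
  then show "(LINT x|rep. apply_bcontfun F x) \<le> l F + e" using n by (simp add: N_def)
qed

text \<open>After an affine change F takes values in [0,1]; the one-sided inequality for G and for 1
  - G gives equality because both functionals have total mass 1.\<close>

theorem integral_rep: "(LINT x|rep. apply_bcontfun F x) = l F"
proof -
  interpret prob_space rep by (rule prob_space_rep)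
  define c where "c = norm F + 1"
  have c: "c > 0" "\<And>x. \<bar>apply_bcontfun F x\<bar> \<le> c" using order_trans[OF abs_apply_le[of F], of c] by (auto simp: c_def add_nonneg_pos)
  define G where "G = (1 / (2 * c)) *\<^sub>R (F + const_bcontfun c)"
  have G: "apply_bcontfun G x = (apply_bcontfun F x + c) / (2 * c)" for x
    by (simp add: G_def const_bcontfun.rep_eq)
  have G01: "0 \<le> apply_bcontfun G x" "apply_bcontfun G x \<le> 1" for x
    using c(2)[of x] c(1) by (auto simp: G abs_le_iff)
  have lc: "l (const_bcontfun a) = a" for a
  proof -
    have "(const_bcontfun a :: 'a \<Rightarrow>\<^sub>C real) = a *\<^sub>R const_bcontfun 1"
      by (rule bcontfun_eqI) (simp add: const_bcontfun.rep_eq)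
    then show ?thesis by (simp only: scale one mult_1_right)
  qed
  have "(LINT x|rep. apply_bcontfun (const_bcontfun 1 - G) x) \<le> l (const_bcontfun 1 - G)"
    using G01 by (intro integral_rep_le_unit) (auto simp: const_bcontfun.rep_eq)
  moreover have "(LINT x|rep. apply_bcontfun (const_bcontfun 1 - G) x) = 1 - (LINT x|rep. apply_bcontfun G x)"
    by (simp add: const_bcontfun.rep_eq integrable_rep prob_space[unfolded space_rep])
  ultimately have "(LINT x|rep. apply_bcontfun G x) \<ge> l G" by (simp add: diff one)
  then have "(LINT x|rep. apply_bcontfun G x) = l G"
    using integral_rep_le_unit[OF G01] by simp
  moreover have "(LINT x|rep. apply_bcontfun G x) = ((LINT x|rep. apply_bcontfun F x) + c) / (2 * c)"
    by (simp add: G integrable_rep prob_space[unfolded space_rep])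
  moreover have "l G = (l F + c) / (2 * c)" by (simp add: G_def scale add lc)
  ultimately show ?thesis using c(1) by simp
qed

end

section \<open>The weak topology inside the space of functionals\<close>

definition integrals :: "C01 measure \<Rightarrow> (C01 \<Rightarrow>\<^sub>C real) \<Rightarrow> real" where
  "integrals \<mu> F = (LINT \<xi>|\<mu>. apply_bcontfun F \<xi>)"

text \<open>The weak topology is handled as the trace of the product topology on functionals under
  the map \<open>integrals\<close>; here \<open>open V\<close> refers to that product
  topology.\<close>

lemma openin_weak_topologyE:
  assumes "openin weak_topology U"
  obtains V where "open V" "U = {\<mu> \<in> borel_prob_measures. integrals \<mu> \<in> V}"
proof -
  have "\<exists>V. open V \<and> U = {\<mu> \<in> borel_prob_measures. integrals \<mu> \<in> V}"
    using assms[unfolded weak_topology_def openin_topology_generated_by_iff]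
  proof (induction rule: generate_topology_on.induct)
    case Empty
    show ?case by (rule exI[of _ "{}"]) auto
  next
    case (Int a b)
    then obtain V V' where "open V" "a = {\<mu> \<in> borel_prob_measures. integrals \<mu> \<in> V}"
      "open V'" "b = {\<mu> \<in> borel_prob_measures. integrals \<mu> \<in> V'}" by auto
    then show ?case by (intro exI[of _ "V \<inter> V'"]) auto
  next
    case (UN K)
    then have "\<forall>k\<in>K. \<exists>V. open V \<and> k = {\<mu> \<in> borel_prob_measures. integrals \<mu> \<in> V}" by blast
    from bchoice[OF this] obtain V where
      "\<forall>k\<in>K. open (V k) \<and> k = {\<mu> \<in> borel_prob_measures. integrals \<mu> \<in> V k}" by blast
    then have "open (\<Union>k\<in>K. V k)" "\<Union>K = {\<mu> \<in> borel_prob_measures. integrals \<mu> \<in> (\<Union>k\<in>K. V k)}"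
      by blast+
    then show ?case by blast
  next
    case (Basis s)
    then obtain F :: "C01 \<Rightarrow>\<^sub>C real" and U :: "real set"
      where "s = {\<mu> \<in> borel_prob_measures. (LINT \<xi>|\<mu>. apply_bcontfun F \<xi>) \<in> U}" "open U" by auto
    then show ?case
      using open_vimage[OF \<open>open U\<close> continuous_on_product_coordinates[of F]]
      by (intro exI[of _ "(\<lambda>l. l F) -` U"]) (auto simp: integrals_def)
  qed
  then show ?thesis using that by blast
qed

text \<open>The bound by the norm places the set in a product of compact intervals, so Tychonoff
  applies; the other conditions are closed. A state may be only finitely additive.\<close>

definition states :: "((C01 \<Rightarrow>\<^sub>C real) \<Rightarrow> real) set" where
  "states = {l. (\<forall>F. \<bar>l F\<bar> \<le> norm F) \<and> (\<forall>F G. l (F + G) = l F + l G) \<and> (\<forall>c F. l (c *\<^sub>R F) = c * l F) \<and>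
     (\<forall>F. (\<forall>x. 0 \<le> apply_bcontfun F x) \<longrightarrow> 0 \<le> l F) \<and> l (const_bcontfun 1) = 1}"

lemma compact_states: "compact states"
proof -
  have "compactin (product_topology (\<lambda>_. euclidean) UNIV) (PiE UNIV (\<lambda>F::C01 \<Rightarrow>\<^sub>C real. {- norm F..norm F}))"
    by (subst compactin_PiE) auto
  then have "compact (PiE UNIV (\<lambda>F::C01 \<Rightarrow>\<^sub>C real. {- norm F..norm F}))"
    by (simp add: euclidean_product_topology)
  moreover have "closed states"
    unfolding states_def
    by (intro closed_Collect_conj closed_Collect_all closed_Collect_imp closed_Collect_le closed_Collect_eq
        open_Collect_const continuous_intros continuous_on_product_coordinates)
  moreover have "states \<subseteq> PiE UNIV (\<lambda>F::C01 \<Rightarrow>\<^sub>C real. {- norm F..norm F})"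
    by (auto simp: states_def abs_le_iff minus_le_iff)
  ultimately show ?thesis by (metis compact_Int_closed inf.absorb_iff2)
qed

lemma integrable_bcontfun:
  fixes F :: "C01 \<Rightarrow>\<^sub>C real"
  assumes "\<mu> \<in> borel_prob_measures"
  shows "integrable \<mu> (apply_bcontfun F)"
proof -
  interpret prob_space \<mu> using assms by (simp add: borel_prob_measures_def)
  have "apply_bcontfun F \<in> borel_measurable \<mu>"
    using assms borel_measurable_continuous_onI[OF continuous_on_apply_bcontfun[of UNIV F]]
    by (simp add: borel_prob_measures_def cong: measurable_cong_sets)
  then show ?thesis by (intro integrable_const_bound[where B="norm F"]) (auto simp: abs_apply_le)
qed

lemma integrals_in_states:
  assumes "\<mu> \<in> borel_prob_measures"
  shows "integrals \<mu> \<in> states"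
proof -
  interpret prob_space \<mu> using assms by (simp add: borel_prob_measures_def)
  note int = integrable_bcontfun[OF assms]
  have "\<bar>integrals \<mu> F\<bar> \<le> norm F" for F
    unfolding integrals_def abs_le_iff minus_le_iff[of _ "norm F"] using abs_apply_le[of F]
    by (auto intro!: integral_le_const integral_ge_const int simp: abs_le_iff minus_le_iff)
  then show ?thesis
    by (auto simp: states_def integrals_def int integral_nonneg const_bcontfun.rep_eq prob_space)
qed

lemma Lam_dual_le_iff:
  "Lam_dual M W \<mu> \<le> ereal a \<longleftrightarrow> (\<forall>F. integrals \<mu> F \<le> Lam M W F + a)"
  by (auto simp: Lam_dual_def SUP_le_iff integrals_def algebra_simps)

context brownian
begin

text \<open>The bound applied to c * H n gives l (H n) \<le> (ln E n + a) / c, where E n is the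
  Wiener integral of exp (c * H n) and tends to 1. Since c is arbitrary, l (H n) tends to 0, which
  is Daniell's condition.\<close>

lemma state_representable:
  assumes l: "l \<in> states" and a: "\<And>F. l F \<le> Lam M W F + a"
  obtains \<mu> where "\<mu> \<in> borel_prob_measures" "integrals \<mu> = l"
proof -
  interpret daniell l
  proof
    fix H :: "nat \<Rightarrow> C01 \<Rightarrow>\<^sub>C real"
    assume H0: "\<And>n x. 0 \<le> apply_bcontfun (H n) x"
      and Hdec: "\<And>n x. apply_bcontfun (H (Suc n)) x \<le> apply_bcontfun (H n) x"
      and Hlim: "\<And>x. (\<lambda>n. apply_bcontfun (H n) x) \<longlonglongrightarrow> 0"
    have HB: "apply_bcontfun (H n) x \<le> norm (H 0)" for n x
    proof (induction n)
      case 0 show ?case using abs_apply_le[of "H 0" x] by simp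
    next
      case (Suc n) then show ?case using Hdec[of n x] by simp
    qed
    have lH: "0 \<le> l (H n)" for n using l H0 by (simp add: states_def)
    interpret w: prob_space wiener by (rule prob_space_wiener)
    show "(\<lambda>n. l (H n)) \<longlonglongrightarrow> 0"
    proof (rule order_tendstoI)
      fix e :: real assume e: "0 < e"
      \<comment> \<open>Large enough that the constant a contributes less than e / 2 after division
        by c; the other half is left to ln (E n).\<close>
      define c where "c = 2 * (\<bar>a\<bar> + 1) / e"
      have c: "c > 0" "\<bar>a\<bar> / c < e / 2" using e by (auto simp: c_def field_simps)
      define E where "E n = (LINT \<beta>|wiener. exp (apply_bcontfun (c *\<^sub>R H n) \<beta>))" for n
      have "(\<lambda>n. E n) \<longlonglongrightarrow> (LINT \<beta>|wiener. exp (c * 0))"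
        unfolding E_def
      proof (rule integral_dominated_convergence[where w = "\<lambda>_. exp (c * norm (H 0))"])
        show "(\<lambda>\<beta>. exp (apply_bcontfun (c *\<^sub>R H n) \<beta>)) \<in> borel_measurable wiener" for n
          by (subst measurable_cong_sets[OF sets_wiener refl])
            (intro borel_measurable_continuous_onI continuous_intros continuous_on_apply_bcontfun)
        show "AE \<beta> in wiener. (\<lambda>n. exp (apply_bcontfun (c *\<^sub>R H n) \<beta>)) \<longlonglongrightarrow> exp (c * 0)"
          by (simp only: scaleR_bcontfun.rep_eq real_scaleR_def, intro AE_I2 tendsto_exp tendsto_mult tendsto_const Hlim)
        show "AE \<beta> in wiener. norm (exp (apply_bcontfun (c *\<^sub>R H n) \<beta>)) \<le> exp (c * norm (H 0))" for n
          using HB c(1) by (auto simp: mult_left_mono)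
      qed simp_all
      then have "(\<lambda>n. ln (E n)) \<longlonglongrightarrow> 0"
        using tendsto_ln[of E 1 sequentially] by (simp add: w.prob_space)
      then have "\<forall>\<^sub>F n in sequentially. ln (E n) < c * (e / 2)"
        using c(1) e by (intro order_tendstoD(2)) auto
      then show "\<forall>\<^sub>F n in sequentially. l (H n) < e"
      proof eventually_elim
        case (elim n)
        have "c * l (H n) = l (c *\<^sub>R H n)" using l by (simp add: states_def)
        also have "\<dots> \<le> Lam M W (c *\<^sub>R H n) + a" by (rule a)
        also have "\<dots> \<le> ln (E n) + a" using Lam_le[of "c *\<^sub>R H n"] by (simp add: E_def)
        also have "\<dots> < c * (e / 2) + c * (e / 2)"
          using elim c by (simp add: divide_less_eq mult.commute abs_le_iff)
        finally show ?case using c(1) by (simp add: distrib_left[symmetric])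
      qed
    qed (use lH in \<open>auto intro!: always_eventually intro: less_le_trans\<close>)
  qed (use l in \<open>auto simp: states_def\<close>)
  have "rep \<in> borel_prob_measures" by (simp add: borel_prob_measures_def prob_space_rep)
  moreover have "integrals rep = l" by (simp add: fun_eq_iff integrals_def integral_rep)
  ultimately show ?thesis by (rule that)
qed

text \<open>The level set corresponds to the states below \<Lambda> + a. These form a closed subset
  of a compact space and are all measures, so an open cover of the level set lifts to an open cover
  of a compact set.\<close>

lemma compactin_Lam_dual:
  "compactin weak_topology {\<mu> \<in> topspace weak_topology. Lam_dual M W \<mu> \<le> ereal a}"
  unfolding compactin_def
proof (intro conjI allI impI)
  let ?L = "{\<mu> \<in> topspace weak_topology. Lam_dual M W \<mu> \<le> ereal a}"
  fix \<U> assume "Ball \<U> (openin weak_topology) \<and> ?L \<subseteq> \<Union>\<U>"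
  then have U: "\<And>U. U \<in> \<U> \<Longrightarrow> openin weak_topology U" and cov: "?L \<subseteq> \<Union>\<U>" by auto
  have "\<forall>U\<in>\<U>. \<exists>V. open V \<and> U = {\<mu> \<in> borel_prob_measures. integrals \<mu> \<in> V}"
    using U openin_weak_topologyE by metis
  from bchoice[OF this] obtain V where
    "\<forall>U\<in>\<U>. open (V U) \<and> U = {\<mu> \<in> borel_prob_measures. integrals \<mu> \<in> V U}" by blast
  then have V: "open (V U)" "U = {\<mu> \<in> borel_prob_measures. integrals \<mu> \<in> V U}" if "U \<in> \<U>" for U
    using that by blast+
  let ?K = "states \<inter> {l. \<forall>F. l F \<le> Lam M W F + a}"
  have K: "compact ?K"
    by (intro compact_Int_closed compact_states closed_Collect_all closed_Collect_le continuous_intros continuous_on_product_coordinates)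
  have "?K \<subseteq> (\<Union>U\<in>\<U>. V U)"
  proof
    fix l assume l: "l \<in> ?K"
    then obtain \<mu> where \<mu>: "\<mu> \<in> borel_prob_measures" "integrals \<mu> = l"
      using state_representable[of l a] by auto
    then have "\<mu> \<in> ?L" using l by (simp add: topspace_weak_topology Lam_dual_le_iff)
    then obtain U where "U \<in> \<U>" "\<mu> \<in> U" using cov by auto
    then show "l \<in> (\<Union>U\<in>\<U>. V U)" using V(2)[of U] \<mu> by auto
  qed
  then obtain \<F> where F: "\<F> \<subseteq> \<U>" "finite \<F>" "?K \<subseteq> (\<Union>U\<in>\<F>. V U)"
    using compactE_image[OF K, of \<U> V] V(1) by blast
  have "?L \<subseteq> \<Union>\<F>"
  proof
    fix \<mu> assume \<mu>: "\<mu> \<in> ?L"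
    then have "integrals \<mu> \<in> ?K"
      by (simp add: topspace_weak_topology Lam_dual_le_iff integrals_in_states)
    then obtain U where "U \<in> \<F>" "integrals \<mu> \<in> V U" using F by auto
    then show "\<mu> \<in> \<Union>\<F>" using V(2)[of U] F(1) \<mu> by (auto simp: topspace_weak_topology)
  qed
  then show "\<exists>\<F>. finite \<F> \<and> \<F> \<subseteq> \<U> \<and> ?L \<subseteq> \<Union>\<F>" using F by blast
qed auto

end

context brownian
begin

section \<open>Occupation measures\<close>

lemma occupation_measure_eq_distr:
  assumes "\<omega> \<in> space M" "\<epsilon> > 0"
  shows "occupation_measure W \<epsilon> \<omega> = distr (restrict_space lborel {0..1}) borel (\<lambda>t. xi W \<epsilon> t \<omega>)"
    and "(\<lambda>t. xi W \<epsilon> t \<omega>) \<in> restrict_space lborel {0..1} \<rightarrow>\<^sub>M borel"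
proof -
  have eq: "sets (restrict_space lborel {0..1::real}) = sets (restrict_space borel {0..1})"
    by (simp add: sets_restrict_space)
  show meas: "(\<lambda>t. xi W \<epsilon> t \<omega>) \<in> restrict_space lborel {0..1} \<rightarrow>\<^sub>M borel"
    using borel_measurable_continuous_on_restrict[OF continuous_on_xi[OF bm assms]]
    by (simp add: measurable_cong_sets[OF eq refl])
  show "occupation_measure W \<epsilon> \<omega> = distr (restrict_space lborel {0..1}) borel (\<lambda>t. xi W \<epsilon> t \<omega>)"
    unfolding occupation_measure_def using meas
    by (intro bind_return_distr') (auto simp: space_restrict_space)
qed

lemma occupation_measure_in:
  assumes "\<omega> \<in> space M" "\<epsilon> > 0"
  shows "occupation_measure W \<epsilon> \<omega> \<in> borel_prob_measures"
proof -
  have "prob_space (restrict_space lborel {0..1::real})"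
    by (rule prob_spaceI) (simp add: space_restrict_space emeasure_restrict_space)
  then show ?thesis
    using prob_space.prob_space_distr[of "restrict_space lborel {0..1}"] occupation_measure_eq_distr[OF assms]
    by (simp add: borel_prob_measures_def)
qed

lemma integrals_occupation_measure:
  assumes "\<omega> \<in> space M" "\<epsilon> > 0"
  shows "integrals (occupation_measure W \<epsilon> \<omega>) F = (LINT t:{0..1}|lborel. apply_bcontfun F (xi W \<epsilon> t \<omega>))"
  unfolding integrals_def occupation_measure_eq_distr(1)[OF assms]
  by (subst integral_distr[OF occupation_measure_eq_distr(2)[OF assms]])
    (auto simp: integral_restrict_space set_lebesgue_integral_def borel_measurable_continuous_onI continuous_on_apply_bcontfun)

lemma integrals_occupation_window:
  assumes "\<omega> \<in> space M" "\<epsilon> > 0"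
  shows "integrals (occupation_measure W \<epsilon> \<omega>) F =
    \<epsilon> * ((1 / \<epsilon> + 1) * window_mean (1 / (1 / \<epsilon> + 1)) F (xi W (\<epsilon> * (1 / \<epsilon> + 1)) 0 \<omega>))"
  using integral_xi[OF assms, of "1 / \<epsilon> + 1" 0 F] assms by (simp add: integrals_occupation_measure)

text \<open>The occupation measure is determined by one block of length 1 + \<epsilon>, and its
  integrals depend continuously on that block. Preimages of weakly open sets are thus open, although
  uncountably many test functions define the topology.\<close>

lemma measurable_occupation_event:
  assumes "openin weak_topology U" and \<epsilon>: "\<epsilon> > 0"
  shows "{\<omega> \<in> space M. occupation_measure W \<epsilon> \<omega> \<in> U} \<in> sets M"
proof -
  obtain V where V: "open V" "U = {\<mu> \<in> borel_prob_measures. integrals \<mu> \<in> V}"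
    using openin_weak_topologyE[OF assms(1)] .
  let ?\<Psi> = "\<lambda>\<beta> F. \<epsilon> * ((1 / \<epsilon> + 1) * window_mean (1 / (1 / \<epsilon> + 1)) F \<beta>)"
  have "0 < 1 / (1 / \<epsilon> + 1)" using \<epsilon> by (simp add: add_pos_pos)
  then have "continuous_on UNIV ?\<Psi>"
    by (intro continuous_on_coordinatewise_then_product continuous_on_mult_left continuous_on_window_mean)
  then have "open (?\<Psi> -` V)" by (rule open_vimage[OF V(1)])
  then have "xi W (\<epsilon> * (1 / \<epsilon> + 1)) 0 -` (?\<Psi> -` V) \<inter> space M \<in> sets M"
    using \<epsilon> by (intro measurable_sets[OF measurable_xi] borel_open) (auto simp: add_pos_pos)
  also have "xi W (\<epsilon> * (1 / \<epsilon> + 1)) 0 -` (?\<Psi> -` V) \<inter> space M = {\<omega> \<in> space M. occupation_measure W \<epsilon> \<omega> \<in> U}"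
  proof -
    have "integrals (occupation_measure W \<epsilon> \<omega>) = ?\<Psi> (xi W (\<epsilon> * (1 / \<epsilon> + 1)) 0 \<omega>)" if "\<omega> \<in> space M" for \<omega>
      using integrals_occupation_window[OF that \<epsilon>] by (simp add: fun_eq_iff)
    then show ?thesis using occupation_measure_in[OF _ \<epsilon>] by (auto simp: V(2))
  qed
  finally show ?thesis .
qed

section \<open>The upper bound\<close>

lemma chernoff:
  assumes \<epsilon>: "\<epsilon> > 0"
  shows "measure M {\<omega> \<in> space M. c < integrals (occupation_measure W \<epsilon> \<omega>) F} \<le> exp (1 / \<epsilon> * (log_mgf M W F (1 / \<epsilon>) - c))"
    and "{\<omega> \<in> space M. c < integrals (occupation_measure W \<epsilon> \<omega>) F} \<in> sets M"
proof -
  let ?X = "\<lambda>\<omega>. LINT t:{0..\<epsilon> * (1 / \<epsilon>)}|lborel. apply_bcontfun F (xi W \<epsilon> t \<omega>)"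
  have e1: "\<epsilon> * (1 / \<epsilon>) = 1" and e0: "0 \<le> 1 / \<epsilon>" using \<epsilon> by auto
  have X: "integrals (occupation_measure W \<epsilon> \<omega>) F = ?X \<omega>" if "\<omega> \<in> space M" for \<omega>
    unfolding e1 by (rule integrals_occupation_measure[OF that \<epsilon>])
  have Xm: "?X \<in> borel_measurable M" by (rule measurable_integral_xi[OF \<epsilon> e0])
  have "{\<omega> \<in> space M. c < integrals (occupation_measure W \<epsilon> \<omega>) F} = {\<omega> \<in> space M. c < ?X \<omega>}"
    by (intro Collect_cong conj_cong refl) (simp only: X)
  then show m: "{\<omega> \<in> space M. c < integrals (occupation_measure W \<epsilon> \<omega>) F} \<in> sets M"
    using borel_measurable_less[OF borel_measurable_const Xm] by (simp only:)
  have Xb: "?X \<omega> \<le> norm F" if "\<omega> \<in> space M" for \<omega>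
    using abs_integral_xi[OF that \<epsilon>, of 1 F] unfolding e1 by simp
  have int: "integrable M (\<lambda>\<omega>. exp (1 / \<epsilon> * ?X \<omega>))"
    using Xm Xb \<epsilon> by (intro integrable_bounded[where B = "exp (1 / \<epsilon> * norm F)"])
      (auto intro!: borel_measurable_exp divide_right_mono)
  have "measure M {\<omega> \<in> space M. c < integrals (occupation_measure W \<epsilon> \<omega>) F} =
     (LINT \<omega>|M. indicator {\<omega> \<in> space M. c < integrals (occupation_measure W \<epsilon> \<omega>) F} \<omega>)"
    using m by simp
  also have "\<dots> \<le> (LINT \<omega>|M. exp (- c / \<epsilon>) * exp (1 / \<epsilon> * ?X \<omega>))"
  proof (rule integral_mono)
    show "integrable M (indicator {\<omega> \<in> space M. c < integrals (occupation_measure W \<epsilon> \<omega>) F} :: 'a \<Rightarrow> real)"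
      using m by (intro integrable_real_indicator) (auto simp: emeasure_eq_measure)
    show "integrable M (\<lambda>\<omega>. exp (- c / \<epsilon>) * exp (1 / \<epsilon> * ?X \<omega>))" by (intro integrable_mult_right int)
    show "indicator {\<omega> \<in> space M. c < integrals (occupation_measure W \<epsilon> \<omega>) F} \<omega> \<le> exp (- c / \<epsilon>) * exp (1 / \<epsilon> * ?X \<omega>)"
      if "\<omega> \<in> space M" for \<omega>
    proof (cases "c < ?X \<omega>")
      case True
      then have "0 \<le> (?X \<omega> - c) / \<epsilon>" using \<epsilon> by (intro divide_nonneg_pos) auto
      then have "0 \<le> - c / \<epsilon> + 1 / \<epsilon> * ?X \<omega>" by (simp only: diff_divide_distrib) simp
      then have "1 \<le> exp (- c / \<epsilon>) * exp (1 / \<epsilon> * ?X \<omega>)"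
        by (simp only: exp_add[symmetric] one_le_exp_iff)
      then show ?thesis by (rule order_trans[OF indicator_le_1])
    qed (use X[OF that] in \<open>simp add: indicator_def\<close>)
  qed
  also have "\<dots> = exp (- c / \<epsilon>) * Z (1 / \<epsilon> + 1) F"
    by (simp only: integral_mult_right_zero expectation_exp_integral[OF \<epsilon> e0])
  also have "Z (1 / \<epsilon> + 1) F = exp (1 / \<epsilon> * log_mgf M W F (1 / \<epsilon>))"
    using \<epsilon> Z_pos[of "1 / \<epsilon> + 1" F] by (simp add: log_mgf_eq)
  finally show "measure M {\<omega> \<in> space M. c < integrals (occupation_measure W \<epsilon> \<omega>) F} \<le> exp (1 / \<epsilon> * (log_mgf M W F (1 / \<epsilon>) - c))"
    by (simp add: exp_add[symmetric] right_diff_distrib)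
qed

lemma filterlim_inverse_scale: "filterlim (\<lambda>\<epsilon>::real. 1 / \<epsilon>) at_top (at_right 0)"
  using filterlim_inverse_at_top_right by (simp add: inverse_eq_divide)

text \<open>The integrals of an occupation measure in C lie in the compact set
  \<open>states - V\<close>. Each of its members violates l F \<le> \<Lambda> F + a for some F:
  otherwise it would be a measure in C with rate at most a. Compactness leaves finitely many F, each
  treated by Chernoff's inequality.\<close>

proposition upper_bound:
  assumes C: "closedin weak_topology C" and a: "\<And>\<mu>. \<mu> \<in> C \<Longrightarrow> ereal a < Lam_dual M W \<mu>" and b: "b < a"
  shows "\<forall>\<^sub>F \<epsilon> in at_right 0. measure M {\<omega> \<in> space M. occupation_measure W \<epsilon> \<omega> \<in> C} \<le> exp (- b / \<epsilon>)"
proof -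
  have "openin weak_topology (topspace weak_topology - C)" using C by (simp add: closedin_def)
  then obtain V where V: "open V" "borel_prob_measures - C = {\<mu> \<in> borel_prob_measures. integrals \<mu> \<in> V}"
    using openin_weak_topologyE by (metis topspace_weak_topology)
  have CP: "C \<subseteq> borel_prob_measures"
    using closedin_subset[OF C] by (simp add: topspace_weak_topology)
  have K: "compact (states - V)" by (intro compact_diff compact_states V)
  have cov: "states - V \<subseteq> (\<Union>F. {l. Lam M W F + a < l F})"
  proof
    fix l assume l: "l \<in> states - V"
    have False if le: "\<And>F. l F \<le> Lam M W F + a"
    proof -
      obtain \<mu> where \<mu>: "\<mu> \<in> borel_prob_measures" "integrals \<mu> = l"
        by (rule state_representable[OF _ le]) (use l in auto)
      then have "\<mu> \<in> C" using V l by auto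
      moreover have "Lam_dual M W \<mu> \<le> ereal a" using that \<mu> by (simp add: Lam_dual_le_iff)
      ultimately show False using a by (simp add: not_less[symmetric])
    qed
    then show "l \<in> (\<Union>F. {l. Lam M W F + a < l F})" by (force simp: not_less[symmetric])
  qed
  have op: "open {l :: (C01 \<Rightarrow>\<^sub>C real) \<Rightarrow> real. Lam M W F + a < l F}" for F
    by (intro open_Collect_less continuous_intros continuous_on_product_coordinates)
  obtain \<F> where \<F>: "\<F> \<subseteq> UNIV" "finite \<F>" "states - V \<subseteq> (\<Union>F\<in>\<F>. {l. Lam M W F + a < l F})"
    by (rule compactE_image[OF K, of UNIV "\<lambda>F. {l. Lam M W F + a < l F}", OF op cov])
  \<comment> \<open>One d pays for the distance between \<open>log_mgf\<close> and its limit at the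
    finitely many F, the other for the number of these F.\<close>
  define d where "d = (a - b) / 2"
  have "2 * d = a - b" by (simp add: d_def)
  then have d: "d > 0" "a = b + 2 * d" using b by auto
  have "\<forall>\<^sub>F T in at_top. \<forall>F\<in>\<F>. log_mgf M W F T < Lam M W F + d"
    using \<F>(2) d order_tendstoD(2)[OF log_mgf_tendsto] by (simp add: eventually_ball_finite_distrib)
  moreover have "\<forall>\<^sub>F T in at_top. real (card \<F>) \<le> exp (T * d)"
  proof -
    have "filterlim (\<lambda>T. exp (T * d)) at_top at_top"
      using d by (intro filterlim_compose[OF exp_at_top] filterlim_at_top_mult_tendsto_pos[OF tendsto_const _ filterlim_ident])
    then show ?thesis by (simp add: filterlim_at_top)
  qed
  ultimately have "\<forall>\<^sub>F \<epsilon> in at_right 0. (\<forall>F\<in>\<F>. log_mgf M W F (1 / \<epsilon>) < Lam M W F + d) \<and> real (card \<F>) \<le> exp (1 / \<epsilon> * d)"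
    using filterlim_inverse_scale by (intro eventually_conj) (auto simp: filterlim_iff)
  moreover have "\<forall>\<^sub>F \<epsilon>::real in at_right 0. \<epsilon> > 0" by (simp add: eventually_at_right_less)
  ultimately show ?thesis
  proof eventually_elim
    case (elim \<epsilon>)
    then have \<epsilon>: "\<epsilon> > 0" by simp
    let ?A = "\<lambda>F. {\<omega> \<in> space M. Lam M W F + a < integrals (occupation_measure W \<epsilon> \<omega>) F}"
    have "measure M {\<omega> \<in> space M. occupation_measure W \<epsilon> \<omega> \<in> C} \<le> measure M (\<Union>F\<in>\<F>. ?A F)"
    proof (rule finite_measure_mono)
      show "{\<omega> \<in> space M. occupation_measure W \<epsilon> \<omega> \<in> C} \<subseteq> (\<Union>F\<in>\<F>. ?A F)"
      proof
        fix \<omega> assume w: "\<omega> \<in> {\<omega> \<in> space M. occupation_measure W \<epsilon> \<omega> \<in> C}"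
        then have "occupation_measure W \<epsilon> \<omega> \<notin> borel_prob_measures - C" "integrals (occupation_measure W \<epsilon> \<omega>) \<in> states"
          using CP by (auto intro: integrals_in_states)
        then have "integrals (occupation_measure W \<epsilon> \<omega>) \<in> states - V"
          using V(2) w CP by auto
        then show "\<omega> \<in> (\<Union>F\<in>\<F>. ?A F)" using \<F>(3) w by auto
      qed
    qed (use \<F>(2) chernoff(2)[OF \<epsilon>] in auto)
    also have "\<dots> \<le> (\<Sum>F\<in>\<F>. measure M (?A F))"
      using \<F>(2) chernoff(2)[OF \<epsilon>] by (intro finite_measure_subadditive_finite) auto
    also have "\<dots> \<le> (\<Sum>F\<in>\<F>. exp (1 / \<epsilon> * (- b - d)))"
    proof (rule sum_mono)
      fix F assume F: "F \<in> \<F>"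
      have "measure M (?A F) \<le> exp (1 / \<epsilon> * (log_mgf M W F (1 / \<epsilon>) - (Lam M W F + a)))"
        by (rule chernoff(1)[OF \<epsilon>])
      also have "\<dots> \<le> exp (1 / \<epsilon> * (- b - d))"
        unfolding exp_le_cancel_iff using elim F \<epsilon> d(2) by (intro mult_left_mono) (auto simp: less_imp_le dest!: bspec)
      finally show "measure M (?A F) \<le> exp (1 / \<epsilon> * (- b - d))" .
    qed
    also have "\<dots> = real (card \<F>) * exp (1 / \<epsilon> * (- b - d))" by simp
    also have "\<dots> \<le> exp (1 / \<epsilon> * d) * exp (1 / \<epsilon> * (- b - d))"
      using elim by (intro mult_right_mono) auto
    also have "\<dots> = exp (- b / \<epsilon>)" by (simp add: exp_add[symmetric] algebra_simps)
    finally show ?case .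
  qed
qed

end

section \<open>The lower bound\<close>

lemma almost_minimizer:
  fixes g :: "'b \<Rightarrow> real"
  assumes "\<And>y. B \<le> g y" "\<kappa> > 0"
  shows "\<exists>y. \<forall>z. g y \<le> g z + \<kappa>"
proof -
  have less: "Inf (range g) < Inf (range g) + \<kappa>" using assms by simp
  obtain y where "g y < Inf (range g) + \<kappa>"
    using cInf_lessD[OF _ less] by auto
  moreover have "Inf (range g) \<le> g z" for z
    using assms(1) by (intro cInf_lower bdd_belowI2[of _ B]) auto
  ultimately have "g y \<le> g z + \<kappa>" for z
    by (metis add.commute add_le_cancel_left less_imp_le order_trans)
  then show ?thesis by blast
qed

lemma exp_le_quadratic:
  fixes z :: real
  assumes "\<bar>z\<bar> \<le> 1"
  shows "exp z \<le> 1 + z + z\<^sup>2"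
proof (cases "0 \<le> z")
  case True
  then show ?thesis using exp_bound[of z] assms by simp
next
  case False
  define w where "w = - z"
  have w: "0 \<le> w" "w \<le> 1" "z = - w" using False assms by (auto simp: w_def)
  have pos: "1 - w + w\<^sup>2 > 0"
  proof -
    have "1 - w + w\<^sup>2 = (w - 1/2)\<^sup>2 + 3/4" by (simp add: power2_eq_square algebra_simps)
    then show ?thesis using zero_le_power2[of "w - 1/2"] by linarith
  qed
  have "1 \<le> (1 + w + w\<^sup>2 / 2) * (1 - w + w\<^sup>2)"
  proof -
    have "(1 + w + w\<^sup>2 / 2) * (1 - w + w\<^sup>2) = 1 + w\<^sup>2 / 2 + w^3 / 2 + w^4 / 2"
      by (simp add: field_simps power2_eq_square power3_eq_cube power4_eq_xxxx)
    then show ?thesis using w by simp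
  qed
  also have "\<dots> \<le> exp w * (1 - w + w\<^sup>2)"
    using pos w exp_lower_Taylor_quadratic[of w] by (intro mult_right_mono) auto
  finally have "exp (- w) \<le> 1 - w + w\<^sup>2" by (simp add: exp_minus field_simps)
  then show ?thesis by (simp add: w)
qed

text \<open>Turns terms linear in the tilting parameter into a quarter of \<eta> times its square,
  which the quadratic penalty absorbs, plus a small constant.\<close>

lemma young:
  fixes u v :: real
  assumes "\<eta> > 0"
  shows "u * v \<le> \<eta> / 4 * u\<^sup>2 + v\<^sup>2 / \<eta>"
proof -
  have "0 \<le> (\<eta> * u / 2 - v)\<^sup>2 / \<eta>" using assms by simp
  also have "\<dots> = \<eta> / 4 * u\<^sup>2 + v\<^sup>2 / \<eta> - u * v"
    using assms by (simp add: power2_eq_square field_simps)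
  finally show ?thesis by simp
qed

text \<open>A basic open set of the product topology restricts finitely many coordinates; this
  reduces the lower bound to finitely many test functions.\<close>

lemma open_fun_nhd:
  fixes l :: "'b \<Rightarrow> real"
  assumes "open V" "l \<in> V"
  obtains I \<delta> where "finite I" "\<delta> > 0" "\<forall>l'. (\<forall>i\<in>I. \<bar>l' i - l i\<bar> < \<delta>) \<longrightarrow> l' \<in> V"
proof -
  obtain X where X: "l \<in> PiE UNIV X" "\<And>i. open (X i)" "finite {i. X i \<noteq> UNIV}" "PiE UNIV X \<subseteq> V"
    using product_topology_open_contains_basis[of "\<lambda>_. euclidean" UNIV V l] assms
    by (auto simp: open_fun_def)
  define I where "I = {i. X i \<noteq> UNIV}"
  have "\<forall>i\<in>I. \<forall>\<^sub>F \<delta> in at_right 0. ball (l i) \<delta> \<subseteq> X i"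
  proof
    fix i
    have "l i \<in> X i" using X(1) by auto
    then obtain d where d: "d > 0" "ball (l i) d \<subseteq> X i" using X(2) openE by blast
    then have "\<forall>\<^sub>F \<delta> in at_right 0. \<delta> < d" by (simp add: eventually_at_right_less eventually_at_right[OF d(1)]) (use d in auto)
    then show "\<forall>\<^sub>F \<delta> in at_right 0. ball (l i) \<delta> \<subseteq> X i"
      by eventually_elim (use d in \<open>auto simp: subset_eq\<close>)
  qed
  then have "\<forall>\<^sub>F \<delta> in at_right 0. \<forall>i\<in>I. ball (l i) \<delta> \<subseteq> X i"
    by (rule eventually_ball_finite[OF X(3)[folded I_def]])
  moreover have "\<forall>\<^sub>F \<delta>::real in at_right 0. \<delta> > 0" by (simp add: eventually_at_right_less)
  ultimately obtain \<delta> where \<delta>: "\<delta> > 0" "\<And>i. i \<in> I \<Longrightarrow> ball (l i) \<delta> \<subseteq> X i"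
    by (metis (mono_tags, lifting) eventually_conj eventually_happens trivial_limit_at_right_real)
  show ?thesis
  proof (rule that[OF _ \<delta>(1)])
    show "finite I" using X(3) by (simp add: I_def)
    show "\<forall>l'. (\<forall>i\<in>I. \<bar>l' i - l i\<bar> < \<delta>) \<longrightarrow> l' \<in> V"
    proof (intro allI impI)
      fix l' assume l': "\<forall>i\<in>I. \<bar>l' i - l i\<bar> < \<delta>"
      have "l' i \<in> X i" for i
      proof (cases "i \<in> I")
        case True
        then have "l' i \<in> ball (l i) \<delta>" using bspec[OF l' True] by (simp add: dist_real_def abs_minus_commute)
        then show ?thesis using \<delta>(2)[OF True] by auto
      qed (auto simp: I_def)
      then show "l' \<in> V" using X(4) by auto
    qed
  qed
qed

section \<open>Independent exponentially tilted blocks\<close>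

context brownian
begin

abbreviation block :: "real \<Rightarrow> nat \<Rightarrow> 'a \<Rightarrow> C01" where
  "block h j \<omega> \<equiv> xi W h (h * real j) \<omega>"

lemma measurable_block:
  assumes "h > 0" "continuous_on UNIV f"
  shows "(\<lambda>\<omega>. f (block h j \<omega>)) \<in> borel_measurable M"
  by (rule measurable_compose[OF measurable_xi borel_measurable_continuous_onI[OF assms(2)]]) (use assms in auto)

lemma expectation_prod_block:
  fixes G :: "nat \<Rightarrow> C01 \<Rightarrow> real"
  assumes "h > 0" "\<And>j. continuous_on UNIV (G j)" "\<And>j \<beta>. \<bar>G j \<beta>\<bar> \<le> B"
  shows "(LINT \<omega>|M. (\<Prod>j<k. G j (block h j \<omega>))) = (\<Prod>j<k. LINT \<beta>|wiener. G j \<beta>)"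
  using expectation_prod_xi[of h 0 k G B] assms by simp

text \<open>The product of the G is a density under which blocks stay independent and y is centred,
  so mixed terms vanish. The density is kept inside expectations under M instead of changing the
  measure.\<close>

lemma tilted_second_moment:
  fixes G y :: "C01 \<Rightarrow> real"
  assumes h: "h > 0" and G: "continuous_on UNIV G" "\<And>\<beta>. \<bar>G \<beta>\<bar> \<le> A" and y: "continuous_on UNIV y" "\<And>\<beta>. \<bar>y \<beta>\<bar> \<le> B"
    and G1: "(LINT \<beta>|wiener. G \<beta>) = 1" and Gy: "(LINT \<beta>|wiener. G \<beta> * y \<beta>) = 0"
  shows "integrable M (\<lambda>\<omega>. (\<Prod>j<k. G (block h j \<omega>)) * (\<Sum>j<k. y (block h j \<omega>))\<^sup>2)"
    and "(LINT \<omega>|M. (\<Prod>j<k. G (block h j \<omega>)) * (\<Sum>j<k. y (block h j \<omega>))\<^sup>2) = real k * (LINT \<beta>|wiener. G \<beta> * (y \<beta>)\<^sup>2)"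
    and "integrable M (\<lambda>\<omega>. \<Prod>j<k. G (block h j \<omega>))"
    and "(LINT \<omega>|M. (\<Prod>j<k. G (block h j \<omega>))) = 1"
proof -
  have AB: "A \<ge> 0" "B \<ge> 0" using G(2)[of undefined] y(2)[of undefined] by auto
  define C where "C = A * max 1 B * max 1 B"
  \<comment> \<open>Inserts a factor y in blocks i and m, hence its square if i = m, so that every
    term of the expanded square is a product over blocks.\<close>
  define f where "f i m j \<beta> = G \<beta> * (if j = i then y \<beta> else 1) * (if j = m then y \<beta> else 1)" for i m j :: nat and \<beta>
  have fc: "continuous_on UNIV (f i m j)" for i m j
    unfolding f_def by (cases "j = i"; cases "j = m") (auto intro!: continuous_intros G y)
  have fC: "\<bar>f i m j \<beta>\<bar> \<le> C" for i m j \<beta>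
  proof -
    have "\<bar>if b then y \<beta> else 1\<bar> \<le> max 1 B" for b using y(2)[of \<beta>] by auto
    then show ?thesis unfolding f_def abs_mult C_def
      using G(2)[of \<beta>] AB by (intro mult_mono) auto
  qed
  have fprod: "(\<Prod>j<k. f i m j (block h j \<omega>)) = (\<Prod>j<k. G (block h j \<omega>)) * (y (block h i \<omega>) * y (block h m \<omega>))"
    if "i < k" "m < k" for i m \<omega>
    using that unfolding f_def prod.distrib by (simp add: prod.delta mult.assoc)
  have fint: "integrable M (\<lambda>\<omega>. \<Prod>j<k. f i m j (block h j \<omega>))" for i m
  proof (rule integrable_bounded[where B = "C ^ k"])
    show "(\<lambda>\<omega>. \<Prod>j<k. f i m j (block h j \<omega>)) \<in> borel_measurable M"
      by (intro borel_measurable_prod measurable_block h fc)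
    have "\<bar>\<Prod>j<k. f i m j (block h j \<omega>)\<bar> \<le> (\<Prod>j<k. C)" for \<omega>
      unfolding abs_prod using fC by (intro prod_mono) auto
    then show "\<bar>\<Prod>j<k. f i m j (block h j \<omega>)\<bar> \<le> C ^ k" for \<omega> by simp
  qed
  have fE: "(LINT \<omega>|M. (\<Prod>j<k. f i m j (block h j \<omega>))) = (\<Prod>j<k. LINT \<beta>|wiener. f i m j \<beta>)" for i m
    by (rule expectation_prod_block[OF h fc fC])
  have fE': "(LINT \<omega>|M. (\<Prod>j<k. f i m j (block h j \<omega>))) = (if i = m then LINT \<beta>|wiener. G \<beta> * (y \<beta>)\<^sup>2 else 0)"
    if "i < k" "m < k" for i m
  proof (cases "i = m")
    case True
    have "(\<Prod>j<k. LINT \<beta>|wiener. f i m j \<beta>) = (\<Prod>j<k. if j = i then LINT \<beta>|wiener. G \<beta> * (y \<beta>)\<^sup>2 else 1)"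
      using True by (intro prod.cong) (auto simp: f_def G1 power2_eq_square mult.assoc)
    then show ?thesis using True that unfolding fE by (simp add: prod.delta)
  next
    case False
    have "(LINT \<beta>|wiener. f i m i \<beta>) = 0" using False by (simp add: f_def Gy)
    then show ?thesis using False that unfolding fE by auto
  qed
  have sq: "(\<Prod>j<k. G (block h j \<omega>)) * (\<Sum>j<k. y (block h j \<omega>))\<^sup>2 = (\<Sum>i<k. \<Sum>m<k. \<Prod>j<k. f i m j (block h j \<omega>))" for \<omega>
  proof -
    have "(\<Sum>j<k. y (block h j \<omega>))\<^sup>2 = (\<Sum>i<k. \<Sum>m<k. y (block h i \<omega>) * y (block h m \<omega>))"
      by (simp only: power2_eq_square sum_product)
    then show ?thesis
      unfolding sum_distrib_left by (auto simp: sum_distrib_left fprod intro!: sum.cong)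
  qed
  show "integrable M (\<lambda>\<omega>. (\<Prod>j<k. G (block h j \<omega>)) * (\<Sum>j<k. y (block h j \<omega>))\<^sup>2)"
    unfolding sq by (intro Bochner_Integration.integrable_sum fint)
  have "(LINT \<omega>|M. (\<Prod>j<k. G (block h j \<omega>)) * (\<Sum>j<k. y (block h j \<omega>))\<^sup>2) =
      (\<Sum>i<k. \<Sum>m<k. LINT \<omega>|M. (\<Prod>j<k. f i m j (block h j \<omega>)))"
    unfolding sq by (simp only: Bochner_Integration.integral_sum Bochner_Integration.integrable_sum fint)
  also have "\<dots> = (\<Sum>i<k. \<Sum>m<k. if i = m then LINT \<beta>|wiener. G \<beta> * (y \<beta>)\<^sup>2 else 0)"
    by (intro sum.cong refl fE') auto
  also have "\<dots> = real k * (LINT \<beta>|wiener. G \<beta> * (y \<beta>)\<^sup>2)" by (simp add: sum.delta)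
  finally show "(LINT \<omega>|M. (\<Prod>j<k. G (block h j \<omega>)) * (\<Sum>j<k. y (block h j \<omega>))\<^sup>2) = real k * (LINT \<beta>|wiener. G \<beta> * (y \<beta>)\<^sup>2)" .
  \<comment> \<open>The index k lies outside the range j < k, so no factor y is inserted.\<close>
  have fk: "(\<Prod>j<k. f k k j (block h j \<omega>)) = (\<Prod>j<k. G (block h j \<omega>))" for \<omega>
    by (intro prod.cong) (auto simp: f_def)
  show "integrable M (\<lambda>\<omega>. \<Prod>j<k. G (block h j \<omega>))" using fint[of k k] unfolding fk .
  show "(LINT \<omega>|M. (\<Prod>j<k. G (block h j \<omega>))) = 1"
  proof -
    have "(\<Prod>j<k. LINT \<beta>|wiener. f k k j \<beta>) = 1"
      by (intro prod.neutral ballI) (simp add: f_def G1)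
    then show ?thesis using fE[of k k] unfolding fk by simp
  qed
qed

definition tilt :: "(C01 \<Rightarrow>\<^sub>C real) set \<Rightarrow> ((C01 \<Rightarrow>\<^sub>C real) \<Rightarrow> real) \<Rightarrow> C01 \<Rightarrow>\<^sub>C real" where
  "tilt \<F> c = (\<Sum>F\<in>\<F>. c F *\<^sub>R F)"

text \<open>The expectation of the block mean of F under the tilted block law; it is the derivative
  of ln (Z S H) / S in the direction F.\<close>

definition tilted_mean :: "real \<Rightarrow> (C01 \<Rightarrow>\<^sub>C real) \<Rightarrow> (C01 \<Rightarrow>\<^sub>C real) \<Rightarrow> real" where
  "tilted_mean S H F = (LINT \<beta>|wiener. exp (S * window_mean (1 / S) H \<beta>) / Z S H * window_mean (1 / S) F \<beta>)"

lemma tilt_density: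
  assumes S: "S \<ge> 1"
  shows "continuous_on UNIV (\<lambda>\<beta>. exp (S * window_mean (1 / S) H \<beta>) / Z S H)"
    and "0 \<le> exp (S * window_mean (1 / S) H \<beta>) / Z S H"
    and "\<bar>exp (S * window_mean (1 / S) H \<beta>) / Z S H\<bar> \<le> exp (S * norm H) / Z S H"
    and "(LINT \<beta>|wiener. exp (S * window_mean (1 / S) H \<beta>) / Z S H) = 1"
proof -
  have Z: "Z S H > 0" by (rule Z_pos[OF S])
  show "continuous_on UNIV (\<lambda>\<beta>. exp (S * window_mean (1 / S) H \<beta>) / Z S H)"
    by (intro continuous_on_divide continuous_on_exp_window_mean S continuous_on_const) (use Z in auto)
  show "0 \<le> exp (S * window_mean (1 / S) H \<beta>) / Z S H" using Z by simp
  show "\<bar>exp (S * window_mean (1 / S) H \<beta>) / Z S H\<bar> \<le> exp (S * norm H) / Z S H"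
    using Z exp_window_mean_bounds(2)[OF S, of H \<beta>] by (simp add: divide_right_mono)
  show "(LINT \<beta>|wiener. exp (S * window_mean (1 / S) H \<beta>) / Z S H) = 1"
    using Z by (simp add: Z_def)
qed

lemma abs_window_mean_le': "S \<ge> 1 \<Longrightarrow> \<bar>window_mean (1 / S) F \<beta>\<bar> \<le> norm F"
  by (rule abs_window_mean_le) auto

lemma integrable_tilt_density:
  assumes S: "S \<ge> 1"
  shows "integrable wiener (\<lambda>\<beta>. exp (S * window_mean (1 / S) H \<beta>) / Z S H)"
    and "integrable wiener (\<lambda>\<beta>. exp (S * window_mean (1 / S) H \<beta>) / Z S H * window_mean (1 / S) F \<beta>)"
proof -
  note d = tilt_density[OF S, of H]
  show "integrable wiener (\<lambda>\<beta>. exp (S * window_mean (1 / S) H \<beta>) / Z S H)"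
    by (rule integrable_wiener[OF d(1,3)])
  have "0 < 1 / S" using S by simp
  show "integrable wiener (\<lambda>\<beta>. exp (S * window_mean (1 / S) H \<beta>) / Z S H * window_mean (1 / S) F \<beta>)"
  proof (rule integrable_wiener)
    show "continuous_on UNIV (\<lambda>\<beta>. exp (S * window_mean (1 / S) H \<beta>) / Z S H * window_mean (1 / S) F \<beta>)"
      by (intro continuous_on_mult d(1) continuous_on_window_mean \<open>0 < 1 / S\<close>)
    show "\<bar>exp (S * window_mean (1 / S) H \<beta>) / Z S H * window_mean (1 / S) F \<beta>\<bar> \<le> exp (S * norm H) / Z S H * norm F" for \<beta>
      unfolding abs_mult[of _ "window_mean (1 / S) F \<beta>"] using d(3)[of \<beta>] abs_window_mean_le'[OF S, of F \<beta>] Z_pos[OF S, of H]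
      by (intro mult_mono) auto
  qed
qed

lemma abs_tilted_mean_le:
  assumes S: "S \<ge> 1"
  shows "\<bar>tilted_mean S H F\<bar> \<le> norm F"
proof -
  note d = tilt_density[OF S, of H]
  let ?G = "\<lambda>\<beta>. exp (S * window_mean (1 / S) H \<beta>) / Z S H"
  have "\<bar>tilted_mean S H F\<bar> \<le> (LINT \<beta>|wiener. \<bar>?G \<beta> * window_mean (1 / S) F \<beta>\<bar>)"
    unfolding tilted_mean_def by (rule integral_abs_bound)
  also have "\<dots> \<le> (LINT \<beta>|wiener. ?G \<beta> * norm F)"
  proof (rule integral_mono)
    show "integrable wiener (\<lambda>\<beta>. \<bar>?G \<beta> * window_mean (1 / S) F \<beta>\<bar>)"
      by (intro integrable_abs integrable_tilt_density S)
    show "integrable wiener (\<lambda>\<beta>. ?G \<beta> * norm F)"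
      by (intro integrable_mult_left integrable_tilt_density S)
    show "\<bar>?G \<beta> * window_mean (1 / S) F \<beta>\<bar> \<le> ?G \<beta> * norm F" for \<beta>
      unfolding abs_mult[of _ "window_mean (1 / S) F \<beta>"] abs_of_nonneg[OF d(2)]
      using d(2) abs_window_mean_le'[OF S] by (intro mult_left_mono) auto
  qed
  also have "\<dots> = norm F" using d(4) by simp
  finally show ?thesis .
qed

text \<open>Where all block averages are within \<rho> of the tilted means, the tilted density is at
  most the exponential on the right. By Chebyshev, the complement of this event has tilted
  probability at most the fraction on the left.\<close>

lemma block_lower_bound:
  assumes S: "S \<ge> 1" and h: "h > 0" and \<F>: "finite \<F>" and k: "k > 0" and \<rho>: "\<rho> > 0"
    and K: "\<And>F. F \<in> \<F> \<Longrightarrow> norm F \<le> K"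
    and A: "A \<in> sets M"
    and sub: "\<And>\<omega>. \<omega> \<in> space M \<Longrightarrow>
      (\<And>F. F \<in> \<F> \<Longrightarrow> \<bar>(\<Sum>j<k. window_mean (1 / S) F (block h j \<omega>)) / real k - tilted_mean S (tilt \<F> c) F\<bar> < \<rho>) \<Longrightarrow> \<omega> \<in> A"
  shows "1 - real (card \<F>) * (2 * K)\<^sup>2 / (real k * \<rho>\<^sup>2) \<le>
    exp (S * real k * ((\<Sum>F\<in>\<F>. c F * tilted_mean S (tilt \<F> c) F + \<bar>c F\<bar> * \<rho>) - ln (Z S (tilt \<F> c)) / S)) * measure M A"
proof -
  define H where "H = tilt \<F> c"
  define m where "m F = tilted_mean S H F" for F
  define G where "G \<beta> = exp (S * window_mean (1 / S) H \<beta>) / Z S H" for \<beta>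
  define y where "y F \<beta> = window_mean (1 / S) F \<beta> - m F" for F \<beta>
  define D where "D \<omega> = (\<Prod>j<k. G (block h j \<omega>))" for \<omega>
  define Q where "Q F \<omega> = (\<Sum>j<k. y F (block h j \<omega>))\<^sup>2" for F \<omega>
  define E where "E = exp (S * real k * ((\<Sum>F\<in>\<F>. c F * m F + \<bar>c F\<bar> * \<rho>) - ln (Z S H) / S))"
  note d = tilt_density[OF S, of H, folded G_def]
  have Zp: "Z S H > 0" by (rule Z_pos[OF S])
  have S0: "0 < 1 / S" using S by simp
  have yc: "continuous_on UNIV (y F)" for F
    unfolding y_def by (intro continuous_intros continuous_on_window_mean S0)
  have yb: "\<bar>y F \<beta>\<bar> \<le> 2 * norm F" for F \<beta>
    using abs_window_mean_le'[OF S, of F \<beta>] abs_tilted_mean_le[OF S, of H F] by (simp add: y_def m_def)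
  note i = integrable_tilt_density[OF S, of H, folded G_def]
  have Gy: "(LINT \<beta>|wiener. G \<beta> * y F \<beta>) = 0" for F
  proof -
    have "(LINT \<beta>|wiener. G \<beta> * y F \<beta>) = (LINT \<beta>|wiener. G \<beta> * window_mean (1 / S) F \<beta>) - (LINT \<beta>|wiener. G \<beta> * m F)"
      unfolding y_def right_diff_distrib by (intro Bochner_Integration.integral_diff i integrable_mult_left)
    also have "(LINT \<beta>|wiener. G \<beta> * window_mean (1 / S) F \<beta>) = m F"
      by (simp only: m_def tilted_mean_def G_def)
    also have "(LINT \<beta>|wiener. G \<beta> * m F) = m F"
      by (simp only: integral_mult_left_zero d(4) mult_1_left)
    finally show ?thesis by simp
  qed
  note sm = tilted_second_moment[OF h d(1,3) yc yb d(4) Gy, of k, folded D_def Q_def]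
  have kp: "(real k * \<rho>)\<^sup>2 > 0" using k \<rho> by simp
  \<comment> \<open>Chebyshev's inequality in pointwise form: the bracket is at most 1 always and at
    most 0 as soon as one average deviates by \<rho>.\<close>
  have pw: "D \<omega> * (1 - (\<Sum>F\<in>\<F>. Q F \<omega> / (real k * \<rho>)\<^sup>2)) \<le> E * indicator A \<omega>" if w: "\<omega> \<in> space M" for \<omega>
  proof -
    have D0: "D \<omega> \<ge> 0" unfolding D_def by (intro prod_nonneg d(2))
    have Q0: "Q F \<omega> \<ge> 0" for F by (simp add: Q_def)
    have Ysum: "(\<Sum>j<k. y F (block h j \<omega>)) = (\<Sum>j<k. window_mean (1 / S) F (block h j \<omega>)) - real k * m F" for F
      by (simp add: y_def sum_subtractf)
    show ?thesis
    proof (cases "\<forall>F\<in>\<F>. \<bar>\<Sum>j<k. y F (block h j \<omega>)\<bar> < real k * \<rho>")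
      case True
      have "\<omega> \<in> A"
      proof (rule sub[OF w])
        fix F assume "F \<in> \<F>"
        then have "\<bar>(\<Sum>j<k. y F (block h j \<omega>)) / real k\<bar> < \<rho>"
          using True k by (simp add: abs_divide pos_divide_less_eq mult.commute)
        then show "\<bar>(\<Sum>j<k. window_mean (1 / S) F (block h j \<omega>)) / real k - tilted_mean S (tilt \<F> c) F\<bar> < \<rho>"
          using k by (simp add: Ysum diff_divide_distrib m_def H_def)
      qed
      have "D \<omega> = exp (\<Sum>j<k. S * window_mean (1 / S) H (block h j \<omega>)) / Z S H ^ k"
        by (simp add: D_def G_def prod_dividef exp_sum)
      also have "(\<Sum>j<k. S * window_mean (1 / S) H (block h j \<omega>)) = S * (\<Sum>F\<in>\<F>. c F * (\<Sum>j<k. window_mean (1 / S) F (block h j \<omega>)))"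
        unfolding H_def tilt_def window_mean_sum[OF S0] sum_distrib_left
        by (subst sum.swap) (simp add: mult.assoc)
      also have "Z S H ^ k = exp (real k * ln (Z S H))"
        using Zp by (simp add: exp_of_nat_mult)
      finally have Deq: "D \<omega> = exp (S * (\<Sum>F\<in>\<F>. c F * (\<Sum>j<k. window_mean (1 / S) F (block h j \<omega>))) - real k * ln (Z S H))"
        by (simp add: exp_diff)
      have "(\<Sum>F\<in>\<F>. c F * (\<Sum>j<k. window_mean (1 / S) F (block h j \<omega>))) \<le> (\<Sum>F\<in>\<F>. real k * (c F * m F + \<bar>c F\<bar> * \<rho>))"
      proof (rule sum_mono)
        fix F assume F: "F \<in> \<F>"
        have "c F * (\<Sum>j<k. y F (block h j \<omega>)) \<le> \<bar>c F\<bar> * \<bar>\<Sum>j<k. y F (block h j \<omega>)\<bar>"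
          by (metis abs_ge_self abs_mult)
        also have "\<dots> \<le> \<bar>c F\<bar> * (real k * \<rho>)" using True F by (intro mult_left_mono) auto
        finally show "c F * (\<Sum>j<k. window_mean (1 / S) F (block h j \<omega>)) \<le> real k * (c F * m F + \<bar>c F\<bar> * \<rho>)"
          by (simp add: Ysum algebra_simps)
      qed
      then have "S * (\<Sum>F\<in>\<F>. c F * (\<Sum>j<k. window_mean (1 / S) F (block h j \<omega>))) - real k * ln (Z S H) \<le>
          S * (\<Sum>F\<in>\<F>. real k * (c F * m F + \<bar>c F\<bar> * \<rho>)) - real k * ln (Z S H)"
        using S by (intro diff_right_mono mult_left_mono) auto
      also have "\<dots> = S * real k * ((\<Sum>F\<in>\<F>. c F * m F + \<bar>c F\<bar> * \<rho>) - ln (Z S H) / S)"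
        unfolding sum_distrib_left[symmetric] using S by (simp add: right_diff_distrib)
      finally have "D \<omega> \<le> E" unfolding Deq E_def by simp
      moreover have "D \<omega> * (1 - (\<Sum>F\<in>\<F>. Q F \<omega> / (real k * \<rho>)\<^sup>2)) \<le> D \<omega> * 1"
        using Q0 by (intro mult_left_mono D0) (auto intro!: sum_nonneg)
      ultimately show ?thesis using \<open>\<omega> \<in> A\<close> by simp
    next
      case False
      then obtain F where F: "F \<in> \<F>" "real k * \<rho> \<le> \<bar>\<Sum>j<k. y F (block h j \<omega>)\<bar>" by (auto simp: not_less)
      then have "(real k * \<rho>)\<^sup>2 \<le> Q F \<omega>"
        unfolding Q_def using \<rho> by (metis abs_le_square_iff abs_of_nonneg less_imp_le mult_nonneg_nonneg of_nat_0_le_iff)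
      then have "1 \<le> Q F \<omega> / (real k * \<rho>)\<^sup>2" using kp by simp
      also have "\<dots> \<le> (\<Sum>F\<in>\<F>. Q F \<omega> / (real k * \<rho>)\<^sup>2)"
        using \<F> F(1) Q0 by (intro member_le_sum) auto
      finally have "D \<omega> * (1 - (\<Sum>F\<in>\<F>. Q F \<omega> / (real k * \<rho>)\<^sup>2)) \<le> 0"
        by (intro mult_nonneg_nonpos D0) simp
      also have "0 \<le> E * indicator A \<omega>" by (simp add: E_def)
      finally show ?thesis .
    qed
  qed
  have expand: "D \<omega> * (1 - (\<Sum>F\<in>\<F>. Q F \<omega> / (real k * \<rho>)\<^sup>2)) = D \<omega> - (\<Sum>F\<in>\<F>. (D \<omega> * Q F \<omega>) / (real k * \<rho>)\<^sup>2)" for \<omega>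
    by (simp add: right_diff_distrib sum_distrib_left)
  have int: "integrable M (\<lambda>\<omega>. (D \<omega> * Q F \<omega>) / (real k * \<rho>)\<^sup>2)" for F
    by (intro integrable_divide sm(1))
  have "1 - (\<Sum>F\<in>\<F>. real k * (2 * K)\<^sup>2 / (real k * \<rho>)\<^sup>2) \<le> 1 - (\<Sum>F\<in>\<F>. (real k * (LINT \<beta>|wiener. G \<beta> * (y F \<beta>)\<^sup>2)) / (real k * \<rho>)\<^sup>2)"
  proof (intro diff_left_mono sum_mono divide_right_mono mult_left_mono)
    fix F assume F: "F \<in> \<F>"
    have y2: "(y F \<beta>)\<^sup>2 \<le> (2 * K)\<^sup>2" for \<beta>
      using yb[of F \<beta>] K[OF F] by (intro power2_le_iff_abs_le[THEN iffD2]) auto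
    have "(LINT \<beta>|wiener. G \<beta> * (y F \<beta>)\<^sup>2) \<le> (LINT \<beta>|wiener. G \<beta> * (2 * K)\<^sup>2)"
    proof (rule integral_mono)
      show "integrable wiener (\<lambda>\<beta>. G \<beta> * (2 * K)\<^sup>2)"
        by (intro integrable_mult_left integrable_wiener[OF d(1,3)])
      show "integrable wiener (\<lambda>\<beta>. G \<beta> * (y F \<beta>)\<^sup>2)"
      proof (rule integrable_wiener)
        show "continuous_on UNIV (\<lambda>\<beta>. G \<beta> * (y F \<beta>)\<^sup>2)" by (intro continuous_intros d(1) yc)
        show "\<bar>G \<beta> * (y F \<beta>)\<^sup>2\<bar> \<le> exp (S * norm H) / Z S H * (2 * K)\<^sup>2" for \<beta>
          unfolding abs_mult using d(3)[of \<beta>] y2[of \<beta>] Zp by (intro mult_mono) auto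
      qed
      show "G \<beta> * (y F \<beta>)\<^sup>2 \<le> G \<beta> * (2 * K)\<^sup>2" for \<beta> by (intro mult_left_mono y2 d(2))
    qed
    also have "\<dots> = (2 * K)\<^sup>2" using d(4) by simp
    finally show "(LINT \<beta>|wiener. G \<beta> * (y F \<beta>)\<^sup>2) \<le> (2 * K)\<^sup>2" .
  qed auto
  also have "\<dots> = (LINT \<omega>|M. D \<omega> * (1 - (\<Sum>F\<in>\<F>. Q F \<omega> / (real k * \<rho>)\<^sup>2)))"
    unfolding expand using sm int
    by (simp add: Bochner_Integration.integral_diff Bochner_Integration.integral_sum Bochner_Integration.integrable_sum)
  also have "\<dots> \<le> (LINT \<omega>|M. E * indicator A \<omega>)"
  proof (rule integral_mono[OF _ _ pw])
    show "integrable M (\<lambda>\<omega>. D \<omega> * (1 - (\<Sum>F\<in>\<F>. Q F \<omega> / (real k * \<rho>)\<^sup>2)))"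
      unfolding expand by (intro Bochner_Integration.integrable_diff sm(3) Bochner_Integration.integrable_sum int)
    show "integrable M (\<lambda>\<omega>. E * indicator A \<omega>)"
      using A by (intro integrable_mult_right integrable_real_indicator) (auto simp: emeasure_eq_measure)
  qed
  also have "\<dots> = E * measure M A" using A by simp
  also have "(\<Sum>F\<in>\<F>. real k * (2 * K)\<^sup>2 / (real k * \<rho>)\<^sup>2) = real (card \<F>) * (2 * K)\<^sup>2 / (real k * \<rho>\<^sup>2)"
    using k by (simp add: power2_eq_square field_simps)
  finally show ?thesis by (simp add: E_def m_def H_def)
qed

end

lemma states_tilt:
  assumes "l \<in> states"
  shows "l (\<Sum>F\<in>\<F>. c F *\<^sub>R F) = (\<Sum>F\<in>\<F>. c F * l F)"
proof (induction \<F> rule: infinite_finite_induct)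
  case (insert F \<F>)
  then show ?case using assms by (simp add: states_def)
next
  have "l (0 *\<^sub>R 0) = 0 * l 0" using assms unfolding states_def by blast
  then have "l 0 = 0" by simp
  then show "l (\<Sum>F\<in>{}. c F *\<^sub>R F) = (\<Sum>F\<in>{}. c F * l F)"
    "infinite \<F> \<Longrightarrow> l (\<Sum>F\<in>\<F>. c F *\<^sub>R F) = (\<Sum>F\<in>\<F>. c F * l F)" for \<F> by simp_all
qed

section \<open>Choice of the tilt, and the probability of open sets\<close>

context brownian
begin

lemma window_mean_tilt:
  "S \<ge> 1 \<Longrightarrow> window_mean (1 / S) (tilt \<F> c) \<beta> = (\<Sum>F\<in>\<F>. c F * window_mean (1 / S) F \<beta>)"
  unfolding tilt_def by (rule window_mean_sum) simp

lemma norm_tilt: "norm (tilt \<F> c) \<le> (\<Sum>F\<in>\<F>. \<bar>c F\<bar> * norm F)"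
  unfolding tilt_def by (rule order_trans[OF norm_sum]) simp

lemma Z_zero: "Z S 0 = 1"
proof -
  interpret w: prob_space wiener by (rule prob_space_wiener)
  show ?thesis by (simp add: Z_def window_mean_def set_lebesgue_integral_def w.prob_space)
qed

text \<open>A one-sided second-order expansion along a coordinate, from ln u \<le> u - 1 and exp z
  \<le> 1 + z + z^2. The condition on t keeps the exponent in [-1, 1], where the latter
  holds.\<close>

lemma Z_perturb:
  assumes S: "S \<ge> 1" and \<F>: "finite \<F>" "F \<in> \<F>" and K: "norm F \<le> K" and t: "S * \<bar>t\<bar> * K \<le> 1"
  shows "ln (Z S (tilt \<F> (c(F := c F + t)))) \<le> ln (Z S (tilt \<F> c)) + S * t * tilted_mean S (tilt \<F> c) F + (S * t * K)\<^sup>2"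
proof -
  define H where "H = tilt \<F> c"
  define H' where "H' = tilt \<F> (c(F := c F + t))"
  define G where "G \<beta> = exp (S * window_mean (1 / S) H \<beta>) / Z S H" for \<beta>
  note d = tilt_density[OF S, of H, folded G_def]
  note i = integrable_tilt_density[OF S, of H, folded G_def]
  have Zp: "Z S H > 0" "Z S H' > 0" using Z_pos[OF S] by auto
  have wm: "window_mean (1 / S) H' \<beta> = window_mean (1 / S) H \<beta> + t * window_mean (1 / S) F \<beta>" for \<beta>
  proof -
    have "(\<Sum>E\<in>\<F>. (c(F := c F + t)) E * window_mean (1 / S) E \<beta>) =
        (\<Sum>E\<in>\<F>. c E * window_mean (1 / S) E \<beta> + (if E = F then t * window_mean (1 / S) E \<beta> else 0))"
      by (intro sum.cong) (auto simp: distrib_right)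
    also have "\<dots> = (\<Sum>E\<in>\<F>. c E * window_mean (1 / S) E \<beta>) + t * window_mean (1 / S) F \<beta>"
      using \<F> by (simp add: sum.distrib)
    finally show ?thesis by (simp only: H_def H'_def window_mean_tilt[OF S])
  qed
  have pw: "exp (S * window_mean (1 / S) H' \<beta>) / Z S H \<le> G \<beta> + S * t * (G \<beta> * window_mean (1 / S) F \<beta>) + (S * t * K)\<^sup>2 * G \<beta>" for \<beta>
  proof -
    let ?z = "S * t * window_mean (1 / S) F \<beta>"
    have w: "\<bar>window_mean (1 / S) F \<beta>\<bar> \<le> K" using abs_window_mean_le'[OF S, of F \<beta>] K by simp
    have z: "\<bar>?z\<bar> \<le> \<bar>S * t * K\<bar>"
      unfolding abs_mult using w by (intro mult_mono) auto
    also have "\<bar>S * t * K\<bar> \<le> 1"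
      using t S order_trans[OF norm_ge_zero K] by (simp add: abs_mult abs_of_nonneg)
    finally have "exp ?z \<le> 1 + ?z + ?z\<^sup>2" by (rule exp_le_quadratic)
    also have "?z\<^sup>2 \<le> (S * t * K)\<^sup>2" using z by (simp only: abs_le_square_iff)
    finally have "G \<beta> * exp ?z \<le> G \<beta> * (1 + ?z + (S * t * K)\<^sup>2)"
      by (intro mult_left_mono d(2)) simp
    moreover have "exp (S * window_mean (1 / S) H' \<beta>) / Z S H = G \<beta> * exp ?z"
      by (simp add: G_def wm distrib_left exp_add mult.assoc)
    ultimately show ?thesis by (simp add: algebra_simps)
  qed
  have "Z S H' / Z S H = (LINT \<beta>|wiener. exp (S * window_mean (1 / S) H' \<beta>) / Z S H)"
    by (simp only: integral_divide_zero Z_def[of S H'])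
  also have "\<dots> \<le> (LINT \<beta>|wiener. G \<beta> + S * t * (G \<beta> * window_mean (1 / S) F \<beta>) + (S * t * K)\<^sup>2 * G \<beta>)"
  proof (rule integral_mono[OF _ _ pw])
    have "exp (S * window_mean (1 / S) H' \<beta>) / Z S H = (Z S H' / Z S H) * (exp (S * window_mean (1 / S) H' \<beta>) / Z S H')" for \<beta>
      using Zp by simp
    then show "integrable wiener (\<lambda>\<beta>. exp (S * window_mean (1 / S) H' \<beta>) / Z S H)"
      by (simp only:) (intro integrable_mult_right integrable_tilt_density S)
    show "integrable wiener (\<lambda>\<beta>. G \<beta> + S * t * (G \<beta> * window_mean (1 / S) F \<beta>) + (S * t * K)\<^sup>2 * G \<beta>)"
      by (intro Bochner_Integration.integrable_add integrable_mult_right i)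
  qed
  also have "\<dots> = (LINT \<beta>|wiener. G \<beta>) + S * t * (LINT \<beta>|wiener. G \<beta> * window_mean (1 / S) F \<beta>) + (S * t * K)\<^sup>2 * (LINT \<beta>|wiener. G \<beta>)"
    by (simp only: Bochner_Integration.integral_add Bochner_Integration.integrable_add integrable_mult_right i integral_mult_right_zero)
  also have "\<dots> = 1 + (S * t * tilted_mean S H F + (S * t * K)\<^sup>2)"
  proof -
    have "(LINT \<beta>|wiener. G \<beta> * window_mean (1 / S) F \<beta>) = tilted_mean S H F"
      by (simp only: tilted_mean_def G_def)
    then show ?thesis by (simp add: d(4))
  qed
  finally have le: "Z S H' / Z S H \<le> 1 + (S * t * tilted_mean S H F + (S * t * K)\<^sup>2)" .
  have "ln (Z S H') - ln (Z S H) = ln (Z S H' / Z S H)" using Zp by (simp add: ln_div)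
  also have "\<dots> \<le> Z S H' / Z S H - 1" using Zp by (intro ln_le_minus_one) auto
  also have "\<dots> \<le> S * t * tilted_mean S H F + (S * t * K)\<^sup>2" using le by simp
  finally show ?thesis by (simp add: H_def H'_def)
qed

text \<open>The penalized functional below is minimized approximately rather than exactly, so that neither
  compactness nor differentiability of \<open>Z\<close> in the tilting parameter is needed.\<close>

lemma tilt_exists:
  fixes x :: "(C01 \<Rightarrow>\<^sub>C real) \<Rightarrow> real"
  assumes \<F>: "finite \<F>" and S: "S \<ge> 1" and \<eta>: "\<eta> > 0" and \<rho>: "\<rho> > 0"
  obtains c where "ln (Z S (tilt \<F> c)) / S - (\<Sum>F\<in>\<F>. c F * x F) + \<eta> / 2 * (\<Sum>F\<in>\<F>. (c F)\<^sup>2) \<le> 1"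
    "\<forall>F\<in>\<F>. \<bar>tilted_mean S (tilt \<F> c) F - (x F - \<eta> * c F)\<bar> \<le> \<rho>"
proof -
  define g where "g c = ln (Z S (tilt \<F> c)) / S - (\<Sum>F\<in>\<F>. c F * x F) + \<eta> / 2 * (\<Sum>F\<in>\<F>. (c F)\<^sup>2)" for c
  define K where "K = (\<Sum>F\<in>\<F>. norm F)"
  have K: "norm F \<le> K" if "F \<in> \<F>" for F
    unfolding K_def using \<F> that by (intro member_le_sum) auto
  have K0: "K \<ge> 0" by (simp add: K_def sum_nonneg)
  define C where "C = S * K\<^sup>2 + \<eta> / 2"
  have C: "C > 0" using S \<eta> by (simp add: C_def add_nonneg_pos)
  \<comment> \<open>The size of the trial step: the first bound admits \<open>Z_perturb\<close>, the
    second makes the tolerance \<open>s\<^sup>2\<close> at most 1, so that g c \<le> g 0 + 1 = 1,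
    and the third makes the final error s * (1 + C) at most \<rho>.\<close>
  define s where "s = min (1 / (S * K + 1)) (min 1 (\<rho> / (1 + C)))"
  have SK: "S * K + 1 > 0" using S K0 by (simp add: add_nonneg_pos)
  have s: "s > 0" "s \<le> 1" using SK C \<rho> by (auto simp: s_def)
  have s1: "S * s * K \<le> 1"
  proof -
    have "s * (S * K + 1) \<le> 1" using SK by (simp add: pos_le_divide_eq[symmetric] s_def)
    then show ?thesis using s by (simp add: algebra_simps)
  qed
  have s2: "s * (1 + C) \<le> \<rho>" using C by (simp add: pos_le_divide_eq[symmetric] s_def)
  have lower: "- (\<Sum>F\<in>\<F>. (norm F + \<bar>x F\<bar>)\<^sup>2 / \<eta>) \<le> g c" for c
  proof -
    have "- (ln (Z S (tilt \<F> c)) / S) \<le> norm (tilt \<F> c)"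
      using abs_ln_Z[OF S, of "tilt \<F> c"] S by (simp add: pos_le_divide_eq abs_le_iff field_simps)
    also have "\<dots> \<le> (\<Sum>F\<in>\<F>. \<bar>c F\<bar> * norm F)" by (rule norm_tilt)
    finally have 1: "- (\<Sum>F\<in>\<F>. \<bar>c F\<bar> * norm F) \<le> ln (Z S (tilt \<F> c)) / S" by simp
    have "(\<Sum>F\<in>\<F>. \<bar>c F\<bar> * norm F + c F * x F - \<eta> / 2 * (c F)\<^sup>2) \<le> (\<Sum>F\<in>\<F>. (norm F + \<bar>x F\<bar>)\<^sup>2 / \<eta>)"
    proof (rule sum_mono)
      fix F
      have "c F * x F \<le> \<bar>c F\<bar> * \<bar>x F\<bar>" by (metis abs_ge_self abs_mult)
      moreover have "\<bar>c F\<bar> * (norm F + \<bar>x F\<bar>) \<le> \<eta> / 4 * (c F)\<^sup>2 + (norm F + \<bar>x F\<bar>)\<^sup>2 / \<eta>"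
        using young[OF \<eta>, of "\<bar>c F\<bar>"] by simp
      moreover have "\<eta> / 4 * (c F)\<^sup>2 \<le> \<eta> / 2 * (c F)\<^sup>2" using \<eta> by (intro mult_right_mono) auto
      ultimately show "\<bar>c F\<bar> * norm F + c F * x F - \<eta> / 2 * (c F)\<^sup>2 \<le> (norm F + \<bar>x F\<bar>)\<^sup>2 / \<eta>"
        by (simp add: distrib_left)
    qed
    moreover have "(\<Sum>F\<in>\<F>. \<bar>c F\<bar> * norm F + c F * x F - \<eta> / 2 * (c F)\<^sup>2) =
        (\<Sum>F\<in>\<F>. \<bar>c F\<bar> * norm F) + (\<Sum>F\<in>\<F>. c F * x F) - \<eta> / 2 * (\<Sum>F\<in>\<F>. (c F)\<^sup>2)"
      by (simp only: sum.distrib sum_subtractf sum_distrib_left)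
    ultimately show ?thesis using 1 unfolding g_def by linarith
  qed
  have "s\<^sup>2 > 0" using s by simp
  obtain c where c: "\<forall>c'. g c \<le> g c' + s\<^sup>2"
    using almost_minimizer[of _ g, OF lower \<open>s\<^sup>2 > 0\<close>] by blast
  have "tilt \<F> (\<lambda>_. 0) = 0" by (simp add: tilt_def)
  then have "g (\<lambda>_. 0) = 0" by (simp add: g_def Z_zero)
  moreover have "s\<^sup>2 \<le> 1" using s by (simp add: power_le_one)
  ultimately have g1: "g c \<le> 1" using spec[OF c, of "\<lambda>_. 0"] by simp
  have mean: "\<bar>tilted_mean S (tilt \<F> c) F - (x F - \<eta> * c F)\<bar> \<le> \<rho>" if F: "F \<in> \<F>" for F
  proof -
    define D where "D = tilted_mean S (tilt \<F> c) F - (x F - \<eta> * c F)"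
    \<comment> \<open>Moving coordinate F by s or by -s changes g by at most t * D in first order
      and \<open>C * s\<^sup>2\<close> in second order, and cannot lower it by more than
      \<open>s\<^sup>2\<close>. The two signs together bound the absolute value of D.\<close>
    have main: "- (s\<^sup>2 * (1 + C)) \<le> t * D" if t: "\<bar>t\<bar> = s" for t
    proof -
      let ?c = "c(F := c F + t)"
      have t2: "t\<^sup>2 = s\<^sup>2" using t by (metis power2_abs)
      have "ln (Z S (tilt \<F> ?c)) \<le> ln (Z S (tilt \<F> c)) + S * t * tilted_mean S (tilt \<F> c) F + (S * t * K)\<^sup>2"
        using s1 t by (intro Z_perturb S \<F> F K) simp
      then have "ln (Z S (tilt \<F> ?c)) / S \<le> (ln (Z S (tilt \<F> c)) + S * t * tilted_mean S (tilt \<F> c) F + (S * t * K)\<^sup>2) / S"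
        using S by (intro divide_right_mono) auto
      also have "\<dots> = ln (Z S (tilt \<F> c)) / S + t * tilted_mean S (tilt \<F> c) F + S * K\<^sup>2 * s\<^sup>2"
        using S by (simp add: add_divide_distrib power_mult_distrib t2) (simp add: power2_eq_square)
      finally have 1: "ln (Z S (tilt \<F> ?c)) / S \<le> ln (Z S (tilt \<F> c)) / S + t * tilted_mean S (tilt \<F> c) F + S * K\<^sup>2 * s\<^sup>2" .
      have "(\<Sum>E\<in>\<F>. ?c E * x E) = (\<Sum>E\<in>\<F>. c E * x E + (if E = F then t * x E else 0))"
        by (intro sum.cong) (auto simp: distrib_right)
      then have 2: "(\<Sum>E\<in>\<F>. ?c E * x E) = (\<Sum>E\<in>\<F>. c E * x E) + t * x F"
        using \<F> F by (simp add: sum.distrib)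
      have "(\<Sum>E\<in>\<F>. (?c E)\<^sup>2) = (\<Sum>E\<in>\<F>. (c E)\<^sup>2 + (if E = F then 2 * t * c E + t\<^sup>2 else 0))"
        by (intro sum.cong) (auto simp: power2_eq_square algebra_simps)
      then have 3: "(\<Sum>E\<in>\<F>. (?c E)\<^sup>2) = (\<Sum>E\<in>\<F>. (c E)\<^sup>2) + (2 * t * c F + s\<^sup>2)"
        using \<F> F t2 by (simp add: sum.distrib)
      have "g ?c \<le> g c + t * D + C * s\<^sup>2"
        using 1 unfolding g_def 2 3 D_def C_def by (simp add: algebra_simps)
      then show ?thesis using spec[OF c, of ?c] by (simp add: algebra_simps)
    qed
    have "\<bar>s * D\<bar> \<le> s * (s * (1 + C))"
      using main[of s] main[of "- s"] s by (simp add: abs_le_iff power2_eq_square mult.assoc)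
    then have "\<bar>D\<bar> \<le> s * (1 + C)" using s by (simp add: abs_mult)
    then show ?thesis using s2 by (simp add: D_def)
  qed
  show ?thesis using that[of c] g1 mean by (simp add: g_def)
qed

lemma Lam_zero_le: "Lam M W 0 \<le> 0"
proof -
  interpret w: prob_space wiener by (rule prob_space_wiener)
  show ?thesis using Lam_le[of 0] by (simp add: w.prob_space)
qed

text \<open>Three errors, each times norm F: 1 / S for the windows discarded at block ends,
  \<epsilon> * S for the rest of [0,1] after the last block, and \<epsilon> * S for the weight 1 / k
  in place of \<epsilon> * S.\<close>

lemma block_average_close:
  assumes w: "\<omega> \<in> space M" and \<epsilon>: "\<epsilon> > 0" and S: "S \<ge> 1" and k: "k > 0" "\<epsilon> * S * real k \<le> 1" "1 < \<epsilon> * S * (real k + 1)"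
  shows "\<bar>integrals (occupation_measure W \<epsilon> \<omega>) F - (\<Sum>j<k. window_mean (1 / S) F (block (\<epsilon> * S) j \<omega>)) / real k\<bar>
    \<le> norm F * (2 * (\<epsilon> * S) + 1 / S)"
proof -
  define h where "h = \<epsilon> * S"
  have h: "h > 0" "\<epsilon> \<le> h" "h * real k \<le> 1" "1 - h * real k \<le> h" using \<epsilon> S k by (auto simp: h_def algebra_simps)
  define A where "A = (\<Sum>j<k. window_mean (1 / S) F (block h j \<omega>)) / real k"
  have piece: "(LINT t:{h * real j..h * real j + (h - \<epsilon>)}|lborel. apply_bcontfun F (xi W \<epsilon> t \<omega>)) = h * window_mean (1 / S) F (block h j \<omega>)" for j
  proof -
    have "0 \<le> h * real j" "h - \<epsilon> = \<epsilon> * (S - 1)" using h(1) by (auto simp: h_def right_diff_distrib)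
    then show ?thesis using integral_xi[OF w \<epsilon> S, of "h * real j" F] by (simp add: h_def mult.assoc)
  qed
  have "\<bar>integrals (occupation_measure W \<epsilon> \<omega>) F - (\<Sum>j<k. h * window_mean (1 / S) F (block h j \<omega>))\<bar> \<le> norm F * (1 - real k * (h - \<epsilon>))"
    unfolding integrals_occupation_measure[OF w \<epsilon>] piece[symmetric]
    using h \<epsilon> by (intro block_integral continuous_on_xi_Icc w abs_apply_le) auto
  also have "(\<Sum>j<k. h * window_mean (1 / S) F (block h j \<omega>)) = h * real k * A"
    unfolding A_def sum_distrib_left[symmetric] using k by simp
  also have "norm F * (1 - real k * (h - \<epsilon>)) \<le> norm F * (h + 1 / S)"
  proof (rule mult_left_mono)
    have "real k * \<epsilon> \<le> 1 / S" using k S by (simp add: pos_le_divide_eq algebra_simps)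
    then show "1 - real k * (h - \<epsilon>) \<le> h + 1 / S" using h by (simp add: algebra_simps)
  qed simp
  finally have 1: "\<bar>integrals (occupation_measure W \<epsilon> \<omega>) F - h * real k * A\<bar> \<le> norm F * (h + 1 / S)" .
  have "\<bar>\<Sum>j<k. window_mean (1 / S) F (block h j \<omega>)\<bar> \<le> (\<Sum>j<k. norm F)"
    by (rule order_trans[OF sum_abs sum_mono]) (rule abs_window_mean_le'[OF S])
  then have "\<bar>A\<bar> \<le> norm F" using k by (simp add: A_def abs_divide pos_divide_le_eq mult.commute)
  then have "\<bar>(1 - h * real k) * A\<bar> \<le> h * norm F"
    unfolding abs_mult using h by (intro mult_mono) auto
  then have 2: "\<bar>h * real k * A - A\<bar> \<le> h * norm F" by (simp add: left_diff_distrib abs_minus_commute)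
  have "\<bar>integrals (occupation_measure W \<epsilon> \<omega>) F - A\<bar> \<le> norm F * (h + 1 / S) + h * norm F"
    using 1 2 by linarith
  then show ?thesis by (simp add: A_def h_def algebra_simps)
qed

text \<open>The parameters \<eta>, \<rho>, S and the tilt are fixed in this order before \<epsilon>
  tends to 0; only the number k of blocks grows. The surplus \<gamma> = b - a pays for all errors in
  the exponent.\<close>

proposition lower_bound:
  assumes U: "openin weak_topology U" and \<mu>: "\<mu> \<in> U" and a: "Lam_dual M W \<mu> \<le> ereal a" and ab: "a < b"
  shows "\<forall>\<^sub>F \<epsilon> in at_right 0. exp (- b / \<epsilon>) \<le> measure M {\<omega> \<in> space M. occupation_measure W \<epsilon> \<omega> \<in> U}"
proof -
  define x where "x = integrals \<mu>"
  obtain V where V: "open V" "U = {\<mu> \<in> borel_prob_measures. integrals \<mu> \<in> V}"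
    using openin_weak_topologyE[OF U] .
  have x: "x \<in> V" "x \<in> states" using \<mu> V(2) integrals_in_states by (auto simp: x_def)
  obtain \<F> \<delta> where \<F>: "finite \<F>" and \<delta>: "\<delta> > 0"
    and nhd: "\<forall>l. (\<forall>F\<in>\<F>. \<bar>l F - x F\<bar> < \<delta>) \<longrightarrow> l \<in> V"
    by (rule open_fun_nhd[OF V(1) x(1)])
  have rate: "(\<Sum>F\<in>\<F>. c F * x F) - Lam M W (tilt \<F> c) \<le> a" for c
  proof -
    have "x (tilt \<F> c) \<le> Lam M W (tilt \<F> c) + a" using a by (simp add: Lam_dual_le_iff x_def)
    moreover have "x (tilt \<F> c) = (\<Sum>F\<in>\<F>. c F * x F)" unfolding tilt_def by (rule states_tilt[OF x(2)])
    ultimately show ?thesis by simp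
  qed
  have a0: "0 \<le> a"
    using rate[of "\<lambda>_. 0"] Lam_zero_le by (simp add: tilt_def)
  define \<gamma> where "\<gamma> = b - a"
  have \<gamma>: "\<gamma> > 0" using ab by (simp add: \<gamma>_def)
  define n where "n = real (card \<F>)"
  have n: "n \<ge> 0" by (simp add: n_def)
  define K where "K = 1 + (\<Sum>F\<in>\<F>. norm F)"
  have KF: "norm F \<le> K" if "F \<in> \<F>" for F
    using member_le_sum[OF that, of norm] \<F> by (simp add: K_def)
  have K: "K > 0" by (simp add: K_def add_pos_nonneg sum_nonneg)
  \<comment> \<open>Below, \<eta> / 4 * Q \<le> a + 2 is obtained, whence every \<eta> * c F is at
    most \<delta> / 4 in absolute value: the penalty displaces the means by no more than
    that.\<close>
  define \<eta> where "\<eta> = \<delta>\<^sup>2 / (64 * (a + 2))"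
  have \<eta>: "\<eta> > 0" using \<delta> a0 by (simp add: \<eta>_def)
  have \<eta>a: "4 * \<eta> * (a + 2) = (\<delta> / 4)\<^sup>2"
    using a0 by (simp add: \<eta>_def power2_eq_square field_simps)
  \<comment> \<open>The bound \<delta> / 8 serves the neighbourhood of the target, the last one
    makes the Young remainder for 2 * \<rho> at most \<gamma> / 4.\<close>
  define \<rho> where "\<rho> = min 1 (min (\<delta> / 8) (\<eta> * \<gamma> / (16 * (n + 1))))"
  have "\<rho> > 0" using \<delta> \<eta> \<gamma> n by (simp add: \<rho>_def)
  moreover have "\<rho> \<le> 1" unfolding \<rho>_def by (rule min.cobounded1)
  moreover have "\<rho> \<le> \<delta> / 8" unfolding \<rho>_def by (rule min.coboundedI2[OF min.cobounded1])
  moreover have "\<rho> \<le> \<eta> * \<gamma> / (16 * (n + 1))" unfolding \<rho>_def by (rule min.coboundedI2[OF min.cobounded2])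
  ultimately have \<rho>: "\<rho> > 0" "\<rho> \<le> 1" "\<rho> \<le> \<delta> / 8" "\<rho> \<le> \<eta> * \<gamma> / (16 * (n + 1))" by blast+
  have \<rho>n: "n * ((2 * \<rho>)\<^sup>2 / \<eta>) \<le> \<gamma> / 4"
  proof -
    have "16 * (n + 1) > 0" using n by simp
    then have "\<rho> * (16 * (n + 1)) \<le> \<eta> * \<gamma>" using \<rho>(4) by (simp only: pos_le_divide_eq)
    then have "16 * (n * \<rho>) \<le> \<eta> * \<gamma>" using \<rho>(1) by (simp add: algebra_simps)
    moreover have "n * (\<rho> * \<rho>) \<le> n * \<rho>" using \<rho> n by (intro mult_left_mono) (auto simp: mult_left_le)
    ultimately have "n * (4 * (\<rho> * \<rho>)) \<le> \<eta> * \<gamma> / 4" by simp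
    then have "n * (4 * (\<rho> * \<rho>)) / \<eta> \<le> \<eta> * \<gamma> / 4 / \<eta>" using \<eta> by (intro divide_right_mono) auto
    then show ?thesis using \<eta> by (simp add: power2_eq_square algebra_simps)
  qed
  define \<theta> where "\<theta> = min 1 (\<gamma> / 4)"
  have \<theta>: "\<theta> > 0" "\<theta> \<le> 1" "\<theta> \<le> \<gamma> / 4" using \<gamma> by (auto simp: \<theta>_def)
  \<comment> \<open>The first ratio makes the error K / S from discarded windows at most \<delta> /
    8; the second bounds by \<theta> the Young remainder left by the rate of convergence to
    \<Lambda>.\<close>
  define S where "S = max 1 (max (8 * K / \<delta>) (n * K\<^sup>2 / (\<eta> * \<theta>)))"
  have S: "S \<ge> 1" "8 * K / \<delta> \<le> S" "n * K\<^sup>2 / (\<eta> * \<theta>) \<le> S" by (auto simp: S_def)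
  have KS: "K / S \<le> \<delta> / 8" using S(1,2) \<delta> by (simp add: field_simps)
  have n\<theta>: "n * ((K / S)\<^sup>2 / \<eta>) \<le> \<theta>"
  proof -
    have "n * K\<^sup>2 \<le> S * (\<eta> * \<theta>)" using S(3) \<eta> \<theta> by (simp add: pos_divide_le_eq)
    also have "\<dots> \<le> S\<^sup>2 * (\<eta> * \<theta>)" using S(1) \<eta> \<theta> by (intro mult_right_mono) (auto simp: power2_eq_square)
    finally have "n * K\<^sup>2 / (S\<^sup>2 * \<eta>) \<le> \<theta>" using S(1) \<eta> by (simp add: pos_divide_le_eq algebra_simps)
    then show ?thesis by (simp add: power_divide)
  qed
  obtain c where c1: "ln (Z S (tilt \<F> c)) / S - (\<Sum>F\<in>\<F>. c F * x F) + \<eta> / 2 * (\<Sum>F\<in>\<F>. (c F)\<^sup>2) \<le> 1"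
    and c2: "\<forall>F\<in>\<F>. \<bar>tilted_mean S (tilt \<F> c) F - (x F - \<eta> * c F)\<bar> \<le> \<rho>"
    by (rule tilt_exists[OF \<F> S(1) \<eta> \<rho>(1), of x])
  define H where "H = tilt \<F> c"
  define m where "m F = tilted_mean S H F" for F
  define L where "L = ln (Z S H) / S"
  define X where "X = (\<Sum>F\<in>\<F>. c F * x F)"
  define Q where "Q = (\<Sum>F\<in>\<F>. (c F)\<^sup>2)"
  have Q0: "Q \<ge> 0" by (simp add: Q_def sum_nonneg)
  have young_sum: "(\<Sum>F\<in>\<F>. \<bar>c F\<bar> * v) \<le> \<eta> / 4 * Q + n * (v\<^sup>2 / \<eta>)" for v
  proof -
    have "(\<Sum>F\<in>\<F>. \<bar>c F\<bar> * v) \<le> (\<Sum>F\<in>\<F>. \<eta> / 4 * \<bar>c F\<bar>\<^sup>2 + v\<^sup>2 / \<eta>)"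
      by (intro sum_mono young \<eta>)
    then show ?thesis by (simp add: sum.distrib Q_def n_def sum_distrib_left)
  qed
  \<comment> \<open>The tilt depends on S, but the error norm H / S grows only linearly in c and is
    therefore absorbed by a quarter of the penalty.\<close>
  have XL: "X - L \<le> a + \<eta> / 4 * Q + \<theta>"
  proof -
    have "Lam M W H - L \<le> norm H / S" using Lam_rate[OF S(1), of H] by (simp add: L_def abs_le_iff)
    also have "\<dots> \<le> (\<Sum>F\<in>\<F>. \<bar>c F\<bar> * K) / S"
      using S(1) norm_tilt[of \<F> c] sum_mono[of \<F> "\<lambda>F. \<bar>c F\<bar> * norm F" "\<lambda>F. \<bar>c F\<bar> * K"] KF
      by (intro divide_right_mono) (auto simp: H_def mult_left_mono intro: order_trans)
    also have "\<dots> = (\<Sum>F\<in>\<F>. \<bar>c F\<bar> * (K / S))" by (simp add: sum_divide_distrib)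
    also have "\<dots> \<le> \<eta> / 4 * Q + n * ((K / S)\<^sup>2 / \<eta>)" by (rule young_sum)
    finally show ?thesis using rate[of c] n\<theta> unfolding X_def H_def[symmetric] by linarith
  qed
  have "L - X + \<eta> / 2 * Q \<le> 1" using c1 by (simp add: L_def X_def Q_def H_def)
  moreover have "\<eta> / 2 * Q = \<eta> / 4 * Q + \<eta> / 4 * Q" by simp
  ultimately have "\<eta> / 4 * Q \<le> a + 2" using XL \<theta>(2) by linarith
  then have "4 * \<eta> * (\<eta> / 4 * Q) \<le> 4 * \<eta> * (a + 2)" using \<eta> by (intro mult_left_mono) auto
  then have \<eta>Q: "\<eta>\<^sup>2 * Q \<le> (\<delta> / 4)\<^sup>2" unfolding \<eta>a by (simp add: power2_eq_square)
  have \<eta>c: "\<bar>\<eta> * c F\<bar> \<le> \<delta> / 4" if "F \<in> \<F>" for F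
  proof -
    have "(c F)\<^sup>2 \<le> Q" unfolding Q_def using \<F> that by (intro member_le_sum) auto
    then have "(\<eta> * c F)\<^sup>2 \<le> \<eta>\<^sup>2 * Q" by (simp add: power_mult_distrib mult_left_mono)
    then have "\<bar>\<eta> * c F\<bar>\<^sup>2 \<le> (\<delta> / 4)\<^sup>2" using \<eta>Q by simp
    from power2_le_imp_le[OF this] show ?thesis using \<delta> by simp
  qed
  define E where "E = (\<Sum>F\<in>\<F>. c F * m F + \<bar>c F\<bar> * \<rho>) - L"
  \<comment> \<open>Since the tilted mean is close to x F - \<eta> * c F, the linear term
    contributes -\<eta> * Q. This outweighs both quarters \<eta> / 4 * Q, one from \<open>XL\<close>
    and one from the errors of size \<rho>.\<close>
  have E: "E \<le> a + \<gamma> / 2"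
  proof -
    have "(\<Sum>F\<in>\<F>. c F * m F + \<bar>c F\<bar> * \<rho>) \<le> (\<Sum>F\<in>\<F>. (c F * x F - \<eta> * (c F)\<^sup>2) + \<bar>c F\<bar> * (2 * \<rho>))"
    proof (rule sum_mono)
      fix F assume F: "F \<in> \<F>"
      have "c F * (m F - (x F - \<eta> * c F)) \<le> \<bar>c F\<bar> * \<bar>m F - (x F - \<eta> * c F)\<bar>"
        by (metis abs_ge_self abs_mult)
      also have "\<dots> \<le> \<bar>c F\<bar> * \<rho>" using bspec[OF c2 F] by (intro mult_left_mono) (auto simp: m_def H_def)
      finally show "c F * m F + \<bar>c F\<bar> * \<rho> \<le> (c F * x F - \<eta> * (c F)\<^sup>2) + \<bar>c F\<bar> * (2 * \<rho>)"
        by (simp add: power2_eq_square algebra_simps)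
    qed
    also have "\<dots> = X - \<eta> * Q + (\<Sum>F\<in>\<F>. \<bar>c F\<bar> * (2 * \<rho>))"
      by (simp only: sum.distrib sum_subtractf X_def Q_def sum_distrib_left)
    also have "\<dots> \<le> X - \<eta> * Q + (\<eta> / 4 * Q + n * ((2 * \<rho>)\<^sup>2 / \<eta>))"
      by (intro add_left_mono young_sum)
    finally have "E \<le> X - \<eta> * Q + (\<eta> / 4 * Q + n * ((2 * \<rho>)\<^sup>2 / \<eta>)) - L" by (simp add: E_def)
    moreover have "\<eta> * Q = 4 * (\<eta> / 4 * Q)" "0 \<le> \<eta> / 4 * Q" using \<eta> Q0 by auto
    ultimately show ?thesis using XL \<rho>n \<theta>(3) by linarith
  qed
  \<comment> \<open>With at least N - 1 blocks the Chebyshev term is at most 1 / 2; the summand 2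
    allows for rounding and keeps k positive.\<close>
  define N where "N = 8 * n * K\<^sup>2 / \<rho>\<^sup>2 + 2"
  have N: "N \<ge> 2" using n by (simp add: N_def)
  \<comment> \<open>The three thresholds give enough blocks, 2 * h * K \<le> \<delta> / 8, and a
    factor 1 / 2 that is at least exp (- \<gamma> / (2 * \<epsilon>)).\<close>
  have "\<forall>\<^sub>F T in at_top. max (S * N) (max (16 * K * S / \<delta>) (2 * ln 2 / \<gamma>)) \<le> T"
    by (rule eventually_ge_at_top)
  then have "\<forall>\<^sub>F \<epsilon> in at_right 0. max (S * N) (max (16 * K * S / \<delta>) (2 * ln 2 / \<gamma>)) \<le> 1 / \<epsilon>"
    using filterlim_inverse_scale by (auto simp: filterlim_iff)
  moreover have "\<forall>\<^sub>F \<epsilon>::real in at_right 0. \<epsilon> > 0" by (simp add: eventually_at_right_less)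
  ultimately show ?thesis
  proof eventually_elim
    case (elim \<epsilon>)
    then have \<epsilon>: "\<epsilon> > 0" and e1: "S * N \<le> 1 / \<epsilon>" and e2: "16 * K * S / \<delta> \<le> 1 / \<epsilon>" and e3: "2 * ln 2 / \<gamma> \<le> 1 / \<epsilon>"
      by auto
    define h where "h = \<epsilon> * S"
    have h: "h > 0" using \<epsilon> S by (simp add: h_def)
    define k where "k = nat \<lfloor>1 / h\<rfloor>"
    have hN: "N \<le> 1 / h" using e1 \<epsilon> S h by (simp add: h_def field_simps)
    have "1 / h \<ge> 0" using h by simp
    then have k: "real k \<le> 1 / h" "1 / h < real k + 1" by (auto simp: k_def)
    have k0: "k > 0"
    proof -
      have "real k > 0" using k(2) hN N by linarith
      then show ?thesis by simp
    qed
    have hk: "h * real k \<le> 1" "1 < h * (real k + 1)"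
      using k h by (auto simp: pos_le_divide_eq pos_divide_less_eq mult.commute)
    have hK: "2 * h * K \<le> \<delta> / 8" using e2 \<epsilon> \<delta> by (simp add: h_def field_simps)
    let ?A = "{\<omega> \<in> space M. occupation_measure W \<epsilon> \<omega> \<in> U}"
    have "1 - real (card \<F>) * (2 * K)\<^sup>2 / (real k * \<rho>\<^sup>2) \<le> exp (S * real k * E) * measure M ?A"
      unfolding E_def m_def L_def H_def
    proof (rule block_lower_bound[OF S(1) h \<F> k0 \<rho>(1) KF measurable_occupation_event[OF U \<epsilon>]])
      fix \<omega> assume w: "\<omega> \<in> space M"
        and close: "\<And>F. F \<in> \<F> \<Longrightarrow> \<bar>(\<Sum>j<k. window_mean (1 / S) F (block h j \<omega>)) / real k - tilted_mean S (tilt \<F> c) F\<bar> < \<rho>"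
      have "integrals (occupation_measure W \<epsilon> \<omega>) \<in> V"
      proof (intro nhd[rule_format])
        fix F assume F: "F \<in> \<F>"
        have "\<bar>integrals (occupation_measure W \<epsilon> \<omega>) F - (\<Sum>j<k. window_mean (1 / S) F (block h j \<omega>)) / real k\<bar> \<le> norm F * (2 * h + 1 / S)"
          unfolding h_def using hk by (intro block_average_close w \<epsilon> S(1) k0) (auto simp: h_def)
        also have "\<dots> \<le> K * (2 * h + 1 / S)" using KF[OF F] h S(1) by (intro mult_right_mono) auto
        also have "\<dots> = 2 * h * K + K / S" by (simp add: algebra_simps)
        finally have "\<bar>integrals (occupation_measure W \<epsilon> \<omega>) F - (\<Sum>j<k. window_mean (1 / S) F (block h j \<omega>)) / real k\<bar> \<le> 2 * h * K + K / S" .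
        \<comment> \<open>Four errors of at most \<delta> / 8 and the displacement \<delta> / 4
          caused by the penalty add up to at most 3 / 4 of \<delta>.\<close>
        then show "\<bar>integrals (occupation_measure W \<epsilon> \<omega>) F - x F\<bar> < \<delta>"
          using hK KS close[OF F] bspec[OF c2 F] \<eta>c[OF F] \<rho>(3) \<delta> by linarith
      qed
      then show "\<omega> \<in> ?A" using w V(2) occupation_measure_in[OF w \<epsilon>] by simp
    qed
    moreover have "real (card \<F>) * (2 * K)\<^sup>2 / (real k * \<rho>\<^sup>2) \<le> 1 / 2"
    proof -
      have "8 * n * K\<^sup>2 / \<rho>\<^sup>2 \<le> real k" using k hN by (simp add: N_def)
      then have "8 * n * K\<^sup>2 \<le> real k * \<rho>\<^sup>2" using \<rho>(1) by (simp add: pos_divide_le_eq)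
      then show ?thesis using k0 \<rho>(1) by (simp add: pos_divide_le_eq n_def power2_eq_square)
    qed
    ultimately have half: "1 / 2 \<le> exp (S * real k * E) * measure M ?A" by linarith
    have "S * real k * E \<le> S * real k * (a + \<gamma> / 2)" using E S(1) by (intro mult_left_mono) auto
    also have "\<dots> \<le> 1 / \<epsilon> * (a + \<gamma> / 2)"
      using hk(1) \<epsilon> a0 \<gamma> by (intro mult_right_mono) (auto simp: h_def pos_le_divide_eq algebra_simps)
    finally have "exp (S * real k * E) * measure M ?A \<le> exp (1 / \<epsilon> * (a + \<gamma> / 2)) * measure M ?A"
      by (intro mult_right_mono) auto
    with half have h2: "1 / 2 \<le> exp (1 / \<epsilon> * (a + \<gamma> / 2)) * measure M ?A" by linarith
    have "ln 2 \<le> 1 / \<epsilon> * (\<gamma> / 2)" using e3 \<gamma> by (simp add: field_simps)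
    then have "exp (- (1 / \<epsilon> * (\<gamma> / 2))) \<le> exp (- ln 2)" by simp
    also have "exp (- ln 2) = (1 / 2 :: real)" by (simp add: exp_minus)
    finally have h3: "exp (- (1 / \<epsilon> * (\<gamma> / 2))) \<le> 1 / 2" .
    have "- b / \<epsilon> = - (1 / \<epsilon> * (a + \<gamma> / 2)) + - (1 / \<epsilon> * (\<gamma> / 2))"
      by (simp add: \<gamma>_def diff_divide_distrib add_divide_distrib)
    then have "exp (- b / \<epsilon>) = exp (- (1 / \<epsilon> * (a + \<gamma> / 2))) * exp (- (1 / \<epsilon> * (\<gamma> / 2)))"
      by (simp only: exp_add)
    also have "\<dots> \<le> exp (- (1 / \<epsilon> * (a + \<gamma> / 2))) * (exp (1 / \<epsilon> * (a + \<gamma> / 2)) * measure M ?A)"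
      using h2 h3 by (intro mult_left_mono) auto
    also have "\<dots> = measure M ?A" by (simp only: mult.assoc[symmetric] exp_add[symmetric]) simp
    finally show ?case .
  qed
qed

end

section \<open>The large deviation principle\<close>

lemma elog_upper:
  assumes "\<epsilon> > 0" "0 \<le> p" "p \<le> exp (- b / \<epsilon>)"
  shows "ereal \<epsilon> * elog p \<le> ereal (- b)"
proof (cases "p = 0")
  case False
  then have "ln p \<le> - b / \<epsilon>" using assms by (metis exp_gt_zero ln_exp ln_le_cancel_iff order_le_less)
  then have "\<epsilon> * ln p \<le> \<epsilon> * (- b / \<epsilon>)" using assms by (intro mult_left_mono) auto
  then have "\<epsilon> * ln p \<le> - b" using assms by simp
  then show ?thesis using False by (simp add: elog_def)
qed (use assms in \<open>simp add: elog_def\<close>)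

lemma elog_lower:
  assumes "\<epsilon> > 0" "exp (- b / \<epsilon>) \<le> p"
  shows "ereal (- b) \<le> ereal \<epsilon> * elog p"
proof -
  have p: "p > 0" using assms by (meson exp_gt_zero less_le_trans)
  have "- b / \<epsilon> \<le> ln p" using assms p by (simp add: ln_ge_iff)
  then have "\<epsilon> * (- b / \<epsilon>) \<le> \<epsilon> * ln p" using assms by (intro mult_left_mono) auto
  then have "- b \<le> \<epsilon> * ln p" using assms by simp
  then show ?thesis using p by (simp add: elog_def)
qed

lemma ereal_le_uminus_reorder: "a \<le> - b \<longleftrightarrow> b \<le> - a" for a b :: ereal
  using ereal_minus_le_minus[of "- a" b] by simp

theorem proposition6p4:
  fixes M :: "'a measure" and W :: "real \<Rightarrow> 'a \<Rightarrow> real"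
  assumes "brownian_motion M W"
  shows "(\<forall>F :: C01 \<Rightarrow>\<^sub>C real. (log_mgf M W F \<longlongrightarrow> Lam M W F) at_top) \<and>
         good_ldp M (occupation_measure W) weak_topology (Lam_dual M W)"
proof -
  interpret brownian M W by unfold_locales (rule assms)
  have pos: "\<forall>\<^sub>F \<epsilon>::real in at_right 0. \<epsilon> > 0" by (simp add: eventually_at_right_less)
  let ?p = "\<lambda>A \<epsilon>. measure M {\<omega> \<in> space M. occupation_measure W \<epsilon> \<omega> \<in> A}"
  have upper: "Limsup (at_right 0) (\<lambda>\<epsilon>. ereal \<epsilon> * elog (?p C \<epsilon>)) \<le> - (INF \<mu>\<in>C. Lam_dual M W \<mu>)"
    if C: "closedin weak_topology C" for C
  proof -
    let ?L = "Limsup (at_right 0) (\<lambda>\<epsilon>. ereal \<epsilon> * elog (?p C \<epsilon>))"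
    have "(INF \<mu>\<in>C. Lam_dual M W \<mu>) \<le> - ?L"
    proof (rule dense_le)
      \<comment> \<open>The infimum may be infinite, so it is approached from below by reals; a
        second real between v and the infimum provides the strict gap that
        \<open>upper_bound\<close> consumes.\<close>
      fix v assume v: "v < (INF \<mu>\<in>C. Lam_dual M W \<mu>)"
      show "v \<le> - ?L"
      proof (cases v)
        case (real b)
        obtain a where a: "v < ereal a" "ereal a < (INF \<mu>\<in>C. Lam_dual M W \<mu>)"
          using ereal_dense2[OF v] by blast
        have "\<forall>\<^sub>F \<epsilon> in at_right 0. ?p C \<epsilon> \<le> exp (- b / \<epsilon>)"
          using a real by (intro upper_bound[OF C, of a]) (auto dest: less_INF_D)
        then have "\<forall>\<^sub>F \<epsilon> in at_right 0. ereal \<epsilon> * elog (?p C \<epsilon>) \<le> ereal (- b)"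
          using pos by eventually_elim (auto intro: elog_upper)
        then have "?L \<le> ereal (- b)" by (rule Limsup_bounded)
        then have "?L \<le> - v" using real by simp
        then show ?thesis by (rule iffD1[OF ereal_le_uminus_reorder])
      qed (use v in auto)
    qed
    then show ?thesis by (rule iffD1[OF ereal_le_uminus_reorder])
  qed
  have lower: "- (INF \<mu>\<in>U. Lam_dual M W \<mu>) \<le> Liminf (at_right 0) (\<lambda>\<epsilon>. ereal \<epsilon> * elog (?p U \<epsilon>))"
    if U: "openin weak_topology U" for U
  proof -
    let ?L = "Liminf (at_right 0) (\<lambda>\<epsilon>. ereal \<epsilon> * elog (?p U \<epsilon>))"
    have "- ?L \<le> (INF \<mu>\<in>U. Lam_dual M W \<mu>)"
    proof (rule INF_greatest, rule dense_ge)
      fix \<mu> v assume \<mu>: "\<mu> \<in> U" and v: "Lam_dual M W \<mu> < v"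
      show "- ?L \<le> v"
      proof (cases v)
        case (real b)
        obtain a where a: "Lam_dual M W \<mu> < ereal a" "ereal a < v"
          using ereal_dense2[OF v] by blast
        have "\<forall>\<^sub>F \<epsilon> in at_right 0. exp (- b / \<epsilon>) \<le> ?p U \<epsilon>"
          using a real by (intro lower_bound[OF U \<mu>, of a]) auto
        then have "\<forall>\<^sub>F \<epsilon> in at_right 0. ereal (- b) \<le> ereal \<epsilon> * elog (?p U \<epsilon>)"
          using pos by eventually_elim (auto intro: elog_lower)
        then have "ereal (- b) \<le> ?L" by (rule Liminf_bounded)
        then have "- v \<le> ?L" using real by simp
        then show ?thesis by (rule iffD1[OF ereal_uminus_le_reorder])
      qed (use v in auto)
    qed
    then show ?thesis by (rule iffD1[OF ereal_uminus_le_reorder])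
  qed
  show ?thesis
    unfolding good_ldp_def using log_mgf_tendsto compactin_Lam_dual upper lower by blast
qed

end
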